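(* Assume the Generalized Riemann Hypothesis. Let $s=\sigma+it$ where $1/2< \sigma<1$ and $t\in \mathbb{R}$, and let $x$ be large. Then there are $\gg x^{1/2}$ primes $p\leq x$ such that $$ \log |L(s,\chi_p)|\geq (\beta(s)+o(1))(\log x)^{1-\sigma}(\log_2 x)^{-\sigma},$$ and $\gg x^{1/2}$ primes $q\leq x$ such that $$ \log |L(s,\chi_q)|\leq -(\beta(s)+o(1))(\log x)^{1-\sigma}(\log_2 x)^{-\sigma},$$ where $\beta(\sigma)=(2\log 2)^{\sigma-1}/(1-\sigma)$ (the case $t=0$), and $\beta(s)=\beta(\sigma)t^2/\left((1-\sigma)^2+4 t^2\right)$ if $t\neq 0$.
   Context: For a prime $p$, $\chi_p=\left(\frac{\cdot}{p}\right)$ is the Legendre symbol modulo $p$ and $L(s,\chi_p)$ its Dirichlet $L$-function. $\log_2=\log\log$. *)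

theory Defs
  imports "HOL-Analysis.Analysis" "HOL-Number_Theory.Number_Theory"
begin

definition dirichlet_char :: "nat \<Rightarrow> (nat \<Rightarrow> complex) \<Rightarrow> bool" where
  "dirichlet_char q chi \<longleftrightarrow> q > 0 \<and> chi 1 = 1 \<and>
     (\<forall>m n. chi (m * n) = chi m * chi n) \<and>
     (\<forall>n. chi (n + q) = chi n) \<and>
     (\<forall>n. chi n = 0 \<longleftrightarrow> \<not> coprime n q)"

definition principal_char :: "nat \<Rightarrow> (nat \<Rightarrow> complex) \<Rightarrow> bool" where
  "principal_char q chi \<longleftrightarrow> (\<forall>n. coprime n q \<longrightarrow> chi n = 1)"

text \<open>Dirichlet series as the limit of its partial sums. For a non-principal
  character this converges for Re s > 0 and agrees there with the analytic
  continuation of L(s, chi).\<close>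
definition Lfun :: "(nat \<Rightarrow> complex) \<Rightarrow> complex \<Rightarrow> complex" where
  "Lfun chi s = lim (\<lambda>N. \<Sum>n=1..N. chi n / (of_nat n) powr s)"

text \<open>Dirichlet eta function (alternating zeta), convergent for Re s > 0;
  zeta(s) = eta(s) / (1 - 2^(1-s)), so RH in 1/2 < Re s < 1 is non-vanishing of eta there.\<close>
definition eta_fun :: "complex \<Rightarrow> complex" where
  "eta_fun s = lim (\<lambda>N. \<Sum>n=1..N. (-1) ^ (n - 1) / (of_nat n) powr s)"

definition GRH :: bool where
  "GRH \<longleftrightarrow>
     (\<forall>q chi s. dirichlet_char q chi \<and> \<not> principal_char q chi \<and> Re s > 1/2 \<longrightarrow> Lfun chi s \<noteq> 0) \<and>
     (\<forall>s. 1/2 < Re s \<and> Re s < 1 \<longrightarrow> eta_fun s \<noteq> 0)"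

definition legendre_char :: "nat \<Rightarrow> nat \<Rightarrow> complex" where
  "legendre_char p n = of_int (Legendre (int n) (int p))"

definition beta_fun :: "complex \<Rightarrow> real" where
  "beta_fun s = (let \<sigma> = Re s; t = Im s; b = (2 * ln 2) powr (\<sigma> - 1) / (1 - \<sigma>) in
     if t = 0 then b else b * t^2 / ((1 - \<sigma>)^2 + 4 * t^2))"

end

theory Submission
  imports Defs "HOL-Probability.Probability" "HOL-Complex_Analysis.Complex_Analysis"
    "HOL-Real_Asymp.Real_Asymp"
begin

text \<open>
  For a finite set \<open>S\<close> of odd primes and signs \<open>\<epsilon>\<^sub>q\<close>, the weight \<open>\<Prod>\<^bsub>q\<in>S\<^esub> (1 + \<epsilon>\<^sub>q (q/p))\<close> detects the
  primes \<open>p\<close> with \<open>(q/p) = \<epsilon>\<^sub>q\<close> for all \<open>q\<in>S\<close>. Expanding it, quadratic reciprocity turns every term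
  but the first into a nonprincipal character sum over \<open>p\<close>, which under GRH is at most
  \<open>X\<^sup>1\<^sup>/\<^sup>2\<^sup>+\<^sup>\<delta>\<close>; hence \<open>2\<^sup>|\<^sup>S\<^sup>|\<close> may be almost as large as \<open>X\<^sup>1\<^sup>/\<^sup>2\<close>, so the primes of \<open>S\<close> may reach
  almost to \<open>log X log log X / (2 log 2)\<close>. Under GRH \<open>log L(s, \<chi>\<^sub>p)\<close> is a smoothed sum over primes up to
  a power of \<open>log p\<close>, and a second moment shows that for most detected \<open>p\<close> the primes outside \<open>S\<close>
  contribute only \<open>O(1)\<close>. Choosing \<open>\<epsilon>\<^sub>q\<close> as the sign of \<open>\<plusminus>cos(t log q)\<close> leaves the sum of
  \<open>q\<^sup>-\<^sup>\<sigma> |cos(t log q)|\<close>, which the prime number theorem evaluates for \<open>t = 0\<close> and, via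
  \<open>|cos| \<ge> cos\<^sup>2\<close>, bounds from below for \<open>t \<noteq> 0\<close>.

  Logarithms of L-functions are controlled by Borel and Caratheodory, and all contour integrals use the
  kernel \<open>exp(w\<^sup>2/2 + \<mu>w)\<close>, whose decay makes every shift harmless.
\<close>

subsection \<open>Dirichlet series with bounded partial sums\<close>

text \<open>One balance fixes every constant. The Gaussian mass of the primes near x^(1-\<delta>) is
  about x^(1-\<delta>), up to a logarithm; a detected prime is counted with multiplicity 2^|S|, so
  dividing by 2^|S| must leave more than x^(1/2), while the GRH error x^(1/2+\<delta>) survives this
  division in full. Hence |S| log 2 is kept below (1/2 - 4\<delta>) log x. A set of primes up to y
  has about y / log y elements, so y may be \<theta> log x log log x for any \<theta> < 1/(2 log 2):
  this is the origin of (2 log 2)^(\<sigma>-1). Only the primes between e^(-B) y and y are put into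
  S, as the smaller ones carry a share e^(-(1-\<sigma>)B) of the sum; they are left to the averaged
  part.

  Two obstacles shape the analysis.

  For t nonzero, cos^2 yields the constant (1/\<alpha> - 1/|\<alpha> + 2it|)/2 with \<alpha> = 1 -
  \<sigma>, which is relaxed to an algebraic one. The o(1) comes from a diagonal choice among
  estimates with fixed loss.\<close>

lemma cmod_nat_powr: "cmod (of_nat n powr z) = real n powr Re z"
  by (subst norm_powr_real_powr) auto

text \<open>Mean value inequality along the segment: the condition Re w >= -1 makes the modulus of
  the derivative largest at the left end x.\<close>

lemma of_real_powr_minus_diff_bound:
  fixes x u :: real and w :: complex
  assumes "0 < x" "x \<le> u" "u \<le> x + 1" "Re w \<ge> -1"
  shows "cmod (of_real x powr (-w) - of_real u powr (-w)) \<le> cmod w * x powr (-Re w - 1)"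
proof -
  let ?S = "closed_segment (of_real x) (of_real u) :: complex set"
  have S: "z \<in> ?S \<Longrightarrow> \<exists>r. z = of_real r \<and> x \<le> r \<and> r \<le> u" for z
    using assms by (auto simp: closed_segment_of_real closed_segment_eq_real_ivl)
  have "cmod (of_real x powr (-w) - of_real u powr (-w)) \<le> (cmod w * x powr (-Re w - 1)) * cmod (of_real x - of_real u)"
  proof (rule field_differentiable_bound[of ?S _ "\<lambda>z. -w * z powr (-w - 1)"])
    fix z assume "z \<in> ?S"
    then obtain r where r: "z = of_real r" "x \<le> r" "r \<le> u" using S by blast
    have "z \<notin> \<real>\<^sub>\<le>\<^sub>0" using r assms by auto
    then show "((\<lambda>z. z powr (-w)) has_field_derivative - w * z powr (- w - 1)) (at z within ?S)"
      by (auto intro!: derivative_eq_intros)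
    have "cmod (z powr (-w-1)) = r powr (-Re w - 1)"
      unfolding r using assms r by (subst norm_powr_real_powr) auto
    also have "\<dots> \<le> x powr (-Re w - 1)"
      using r assms by (intro powr_mono2') auto
    finally show "cmod (- w * z powr (- w - 1)) \<le> cmod w * x powr (- Re w - 1)"
      by (simp add: norm_mult mult_left_mono)
  qed auto
  also have "\<dots> \<le> cmod w * x powr (-Re w - 1)"
  proof (rule mult_left_le)
    have "cmod (of_real x - of_real u) = \<bar>x - u\<bar>" by (metis norm_of_real of_real_diff)
    then show "cmod (of_real x - of_real u) \<le> 1" using assms by simp
  qed auto
  finally show ?thesis
    .
qed

lemma nat_powr_minus_diff_bound:
  assumes "Re w \<ge> -1"
  shows "cmod (of_nat (Suc n) powr (-w) - of_nat (Suc (Suc n)) powr (-w)) \<le> cmod w * real (Suc n) powr (-Re w - 1)"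
  using of_real_powr_minus_diff_bound[of "real (Suc n)" "real (Suc (Suc n))" w] assms
  by (simp del: of_nat_Suc)

lemma summable_Suc_powr: "s < -1 \<Longrightarrow> summable (\<lambda>n. real (Suc n) powr s)"
  using summable_real_powr_iff[of s] summable_Suc_iff[of "\<lambda>n. real n powr s"] by simp

text \<open>Weierstrass test on closed discs. Such a disc lies in some Re w >= \<sigma>, |w| <= R,
  so the majorant may depend on both \<sigma> and R; the terms met below grow polynomially in
  w.\<close>

lemma holomorphic_suminf_halfplane:
  fixes f :: "nat \<Rightarrow> complex \<Rightarrow> complex"
  assumes hol: "\<And>n. f n holomorphic_on {w. Re w > \<alpha>}"
    and bd: "\<And>\<sigma> R. \<sigma> > \<alpha> \<Longrightarrow> \<exists>h. summable h \<and> (\<forall>n w. Re w \<ge> \<sigma> \<and> cmod w \<le> R \<longrightarrow> cmod (f n w) \<le> h n)"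
  shows "(\<lambda>w. \<Sum>n. f n w) holomorphic_on {w. Re w > \<alpha>}"
proof (rule holomorphic_uniform_sequence[where f="\<lambda>N w. \<Sum>n<N. f n w"])
  show "open {w. Re w > \<alpha>}" by (rule open_halfspace_Re_gt)
  show "(\<lambda>w. \<Sum>n<N. f n w) holomorphic_on {w. Re w > \<alpha>}" for N
    using hol by (intro holomorphic_on_sum)
  fix z assume z: "z \<in> {w. Re w > \<alpha>}"
  define d where "d = (Re z - \<alpha>) / 2"
  have d: "d > 0" using z by (simp add: d_def)
  have *: "Re w \<ge> \<alpha> + d \<and> cmod w \<le> cmod z + d" if "w \<in> cball z d" for w
  proof -
    have "cmod (z - w) \<le> d" using that by (simp add: dist_norm)
    then have "Re z - Re w \<le> d" "cmod w \<le> cmod z + d"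
      using abs_Re_le_cmod[of "z - w"] norm_triangle_sub[of w z] by (auto simp: norm_minus_commute)
    then show ?thesis by (simp add: d_def field_simps)
  qed
  obtain h where h: "summable h" "\<And>n w. Re w \<ge> \<alpha> + d \<Longrightarrow> cmod w \<le> cmod z + d \<Longrightarrow> cmod (f n w) \<le> h n"
    using bd[of "\<alpha> + d" "cmod z + d"] d by auto
  have "uniform_limit (cball z d) (\<lambda>N w. \<Sum>n<N. f n w) (\<lambda>w. \<Sum>n. f n w) sequentially"
    by (rule Weierstrass_m_test[OF _ h(1)]) (use * h(2) in auto)
  moreover have "cball z d \<subseteq> {w. Re w > \<alpha>}" using * d by fastforce
  ultimately show "\<exists>d>0. cball z d \<subseteq> {w. Re w > \<alpha>} \<and>
     uniform_limit (cball z d) (\<lambda>N w. \<Sum>n<N. f n w) (\<lambda>w. \<Sum>n. f n w) sequentially"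
    using d by blast
qed

text \<open>Satisfied by nonprincipal characters and by the alternating signs of eta, so that both
  kinds of series are treated at once.\<close>

definition bounded_sums :: "(nat \<Rightarrow> complex) \<Rightarrow> real \<Rightarrow> bool" where
  "bounded_sums a M \<longleftrightarrow> (\<forall>N. cmod (\<Sum>n=1..N. a n) \<le> M)"

text \<open>A term of the series after summation by parts: the coefficients enter only through
  partial sums, and the difference of powers gains one power of n.\<close>

definition abel_term :: "(nat \<Rightarrow> complex) \<Rightarrow> nat \<Rightarrow> complex \<Rightarrow> complex" where
  "abel_term a n w = (\<Sum>k=1..Suc n. a k) * (of_nat (Suc n) powr (-w) - of_nat (Suc (Suc n)) powr (-w))"

lemma partial_sum_abel:
  "(\<Sum>n=1..N. a n / (of_nat n) powr w) =
    (\<Sum>n<N. abel_term a n w) + (\<Sum>k=1..N. a k) * of_nat (Suc N) powr (-w)"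
proof (induction N)
  case (Suc N)
  have "(\<Sum>n=1..Suc N. a n / (of_nat n) powr w) = (\<Sum>n=1..N. a n / (of_nat n) powr w) + a (Suc N) * of_nat (Suc N) powr (-w)"
    by (simp add: powr_minus_divide)
  then show ?case unfolding Suc abel_term_def by (simp add: algebra_simps del: of_nat_Suc)
qed simp

lemma abel_term_bound:
  assumes "bounded_sums a M" "Re w \<ge> -1"
  shows "cmod (abel_term a n w) \<le> M * cmod w * real (Suc n) powr (-Re w - 1)"
proof -
  have "M \<ge> 0" using assms(1) unfolding bounded_sums_def by (meson norm_ge_zero order_trans)
  have "cmod (\<Sum>k=1..Suc n. a k) \<le> M" using assms(1) unfolding bounded_sums_def by blast
  then have "cmod (abel_term a n w) \<le> M * (cmod w * real (Suc n) powr (-Re w - 1))"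
    unfolding abel_term_def norm_mult
    by (intro mult_mono nat_powr_minus_diff_bound assms) (use \<open>M \<ge> 0\<close> in auto)
  then show ?thesis by (simp add: mult.assoc)
qed

text \<open>Summation by parts turns the series into one with terms O(n^(-Re w - 1)), plus a
  boundary term that is O(N^(-Re w)).\<close>

lemma dirichlet_series_bounded_sums:
  assumes "bounded_sums a M" "Re w > 0"
  shows "summable (\<lambda>n. abel_term a n w)"
    and "(\<lambda>N. \<Sum>n=1..N. a n / (of_nat n) powr w) \<longlonglongrightarrow> (\<Sum>n. abel_term a n w)"
proof -
  show s: "summable (\<lambda>n. abel_term a n w)"
  proof (rule summable_comparison_test')
    show "summable (\<lambda>n. M * cmod w * real (Suc n) powr (-Re w - 1))"
      using assms by (intro summable_mult summable_Suc_powr) auto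
    show "cmod (abel_term a n w) \<le> M * cmod w * real (Suc n) powr (-Re w - 1)" if "n \<ge> 0" for n
      using abel_term_bound[OF assms(1)] assms(2) by auto
  qed
  have "(\<lambda>N. (\<Sum>k=1..N. a k) * of_nat (Suc N) powr (-w)) \<longlonglongrightarrow> 0"
  proof (rule Lim_null_comparison)
    have "(\<lambda>N. real (Suc N) powr (-Re w)) \<longlonglongrightarrow> 0"
      using assms(2) by (intro tendsto_neg_powr filterlim_compose[OF filterlim_real_sequentially filterlim_Suc]) auto
    then show "(\<lambda>N. M * real (Suc N) powr (-Re w)) \<longlonglongrightarrow> 0" by (rule tendsto_mult_right_zero)
    show "\<forall>\<^sub>F N in sequentially. cmod ((\<Sum>k=1..N. a k) * of_nat (Suc N) powr (-w)) \<le> M * real (Suc N) powr (-Re w)"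
    proof (intro always_eventually allI)
      fix N
      have "cmod (of_nat (Suc N) powr (-w)) = real (Suc N) powr (- Re w)" by (simp add: cmod_nat_powr del: of_nat_Suc)
      then show "cmod ((\<Sum>k=1..N. a k) * of_nat (Suc N) powr (-w)) \<le> M * real (Suc N) powr (-Re w)"
        using assms(1) by (auto simp: norm_mult bounded_sums_def intro!: mult_right_mono simp del: of_nat_Suc)
    qed
  qed
  from tendsto_add[OF summable_LIMSEQ[OF s] this]
  show "(\<lambda>N. \<Sum>n=1..N. a n / (of_nat n) powr w) \<longlonglongrightarrow> (\<Sum>n. abel_term a n w)"
    unfolding partial_sum_abel by simp
qed

lemma Lfun_eq_abel:
  assumes "bounded_sums a M" "Re w > 0"
  shows "Lfun a w = (\<Sum>n. abel_term a n w)"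
  unfolding Lfun_def using dirichlet_series_bounded_sums(2)[OF assms] by (rule limI)

lemma Lfun_holomorphic:
  assumes "bounded_sums a M"
  shows "Lfun a holomorphic_on {w. Re w > 0}"
proof -
  have M: "M \<ge> 0" using assms(1) unfolding bounded_sums_def by (meson norm_ge_zero order_trans)
  have "(\<lambda>w. \<Sum>n. abel_term a n w) holomorphic_on {w. Re w > 0}"
  proof (rule holomorphic_suminf_halfplane)
    show "abel_term a n holomorphic_on {w. Re w > 0}" for n
      unfolding abel_term_def by (intro holomorphic_intros)
    fix \<sigma> R :: real assume "\<sigma> > 0"
    show "\<exists>h. summable h \<and> (\<forall>n w. Re w \<ge> \<sigma> \<and> cmod w \<le> R \<longrightarrow> cmod (abel_term a n w) \<le> h n)"
    proof (intro exI[of _ "\<lambda>n. M * R * real (Suc n) powr (-\<sigma> - 1)"] conjI allI impI)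
      show "summable (\<lambda>n. M * R * real (Suc n) powr (-\<sigma> - 1))"
        using \<open>\<sigma> > 0\<close> by (intro summable_mult summable_Suc_powr) auto
      fix n w assume w: "Re w \<ge> \<sigma> \<and> cmod w \<le> R"
      have "cmod (abel_term a n w) \<le> M * cmod w * real (Suc n) powr (-Re w - 1)"
        using abel_term_bound[OF assms] w \<open>\<sigma> > 0\<close> by auto
      also have "\<dots> \<le> M * R * real (Suc n) powr (-\<sigma> - 1)"
        using w M by (intro mult_mono powr_mono mult_nonneg_nonneg) (auto intro: order_trans[OF norm_ge_zero])
      finally show "cmod (abel_term a n w) \<le> M * R * real (Suc n) powr (-\<sigma> - 1)" .
    qed
  qed
  then show ?thesis
    by (rule holomorphic_transform) (use Lfun_eq_abel[OF assms] in auto)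
qed

text \<open>For a character mod q the bound \<open>M\<close> is q, so log |L| is at most log q + log
  |w| + O(1). This crude bound is all that Borel and Caratheodory require.\<close>

lemma Lfun_bound:
  assumes "bounded_sums a M" "Re w \<ge> \<sigma>" "\<sigma> > 0"
  shows "cmod (Lfun a w) \<le> M * cmod w * (\<Sum>n. real (Suc n) powr (-\<sigma> - 1))"
proof -
  have M: "M \<ge> 0" using assms(1) unfolding bounded_sums_def by (meson norm_ge_zero order_trans)
  have w: "Re w > 0" using assms by simp
  have b: "cmod (abel_term a n w) \<le> M * cmod w * real (Suc n) powr (-\<sigma> - 1)" for n
  proof -
    have "cmod (abel_term a n w) \<le> M * cmod w * real (Suc n) powr (-Re w - 1)"
      using abel_term_bound[OF assms(1)] w by auto
    also have "\<dots> \<le> M * cmod w * real (Suc n) powr (-\<sigma> - 1)"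
      using assms M by (intro mult_left_mono powr_mono) auto
    finally show ?thesis .
  qed
  have s: "summable (\<lambda>n. real (Suc n) powr (-\<sigma> - 1))" using assms by (intro summable_Suc_powr) auto
  have "cmod (Lfun a w) \<le> (\<Sum>n. M * cmod w * real (Suc n) powr (-\<sigma> - 1))"
    unfolding Lfun_eq_abel[OF assms(1) w]
    by (rule norm_suminf_le[OF b]) (intro summable_mult s)
  also have "\<dots> = M * cmod w * (\<Sum>n. real (Suc n) powr (-\<sigma> - 1))"
    using s by (rule suminf_mult)
  finally show ?thesis .
qed

section \<open>Dirichlet characters and their partial sums\<close>

lemma dirichlet_char_periodic:
  assumes "dirichlet_char q chi"
  shows "chi (n + k * q) = chi n"
proof (induction k)
  case (Suc k)
  have "chi (n + Suc k * q) = chi ((n + k * q) + q)" by (simp add: algebra_simps)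
  also have "\<dots> = chi (n + k * q)" using assms unfolding dirichlet_char_def by blast
  finally show ?case using Suc by simp
qed simp

lemma dirichlet_char_mod:
  assumes "dirichlet_char q chi"
  shows "chi (n mod q) = chi n"
  using dirichlet_char_periodic[OF assms, of "n mod q" "n div q"] by (simp add: algebra_simps)

lemma dirichlet_char_cong:
  assumes "dirichlet_char q chi" "[m = n] (mod q)"
  shows "chi m = chi n"
  using assms dirichlet_char_mod[OF assms(1)] by (metis cong_def)

lemma dirichlet_char_power:
  assumes "dirichlet_char q chi"
  shows "chi (n ^ k) = chi n ^ k"
  using assms by (induction k) (auto simp: dirichlet_char_def)

text \<open>By Euler's theorem a nonzero value is a root of unity.\<close>

lemma dirichlet_char_norm:
  assumes "dirichlet_char q chi"
  shows "cmod (chi n) \<le> 1"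
proof (cases "coprime n q")
  case True
  have "[n ^ totient q = 1] (mod q)" using True by (rule euler_theorem)
  then have "chi n ^ totient q = 1"
    using dirichlet_char_cong[OF assms] dirichlet_char_power[OF assms] assms
    by (metis dirichlet_char_def)
  moreover have "totient q > 0" using assms by (auto simp: dirichlet_char_def)
  ultimately have "cmod (chi n) ^ totient q = 1" by (metis norm_one norm_power)
  then show ?thesis using \<open>totient q > 0\<close> by (metis less_numeral_extra(3) norm_ge_zero order.refl power_eq_1_iff norm_one abs_norm_cancel real_norm_def)
next
  case False
  then have "chi n = 0" using assms unfolding dirichlet_char_def by blast
  then show ?thesis by simp
qed

text \<open>Multiplication by \<open>a\<close> permutes the residues, so the sum equals
  \<open>chi a\<close> times itself, and \<open>a\<close> is chosen with \<open>chi a\<close>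
  different from 1.\<close>

lemma dirichlet_char_sum_period:
  assumes "dirichlet_char q chi" "\<not> principal_char q chi"
  shows "(\<Sum>n<q. chi n) = 0"
proof -
  obtain a where a: "coprime a q" "chi a \<noteq> 1" using assms(2) by (auto simp: principal_char_def)
  have q: "q > 0" using assms(1) by (simp add: dirichlet_char_def)
  have inj: "inj_on (\<lambda>n. (a * n) mod q) {..<q}"
  proof (rule inj_onI)
    fix x y assume xy: "x \<in> {..<q}" "y \<in> {..<q}" "(a * x) mod q = (a * y) mod q"
    then have "[x = y] (mod q)" using a(1) by (metis cong_def cong_mult_lcancel_nat)
    then show "x = y" using xy by (simp add: cong_def)
  qed
  have "(\<lambda>n. (a * n) mod q) ` {..<q} = {..<q}"
    by (rule endo_inj_surj[OF _ _ inj]) (use q in auto)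
  then have bij: "bij_betw (\<lambda>n. (a * n) mod q) {..<q} {..<q}"
    unfolding bij_betw_def using inj by simp
  have "(\<Sum>n<q. chi n) = (\<Sum>n<q. chi ((a * n) mod q))"
    by (rule sum.reindex_bij_betw[OF bij, symmetric])
  also have "\<dots> = (\<Sum>n<q. chi a * chi n)"
    using assms(1) by (intro sum.cong refl) (simp add: dirichlet_char_mod dirichlet_char_def)
  also have "\<dots> = chi a * (\<Sum>n<q. chi n)" by (simp add: sum_distrib_left)
  finally have "(1 - chi a) * (\<Sum>n<q. chi n) = 0" by (simp add: algebra_simps)
  then show ?thesis using a(2) by auto
qed

lemma dirichlet_char_sum_bound:
  assumes "dirichlet_char q chi" "\<not> principal_char q chi"
  shows "cmod (\<Sum>n<N. chi n) \<le> real q"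
proof (induction N rule: less_induct)
  case (less N)
  show ?case
  proof (cases "N < q")
    case True
    have "cmod (\<Sum>n<N. chi n) \<le> (\<Sum>n<N. 1)" by (intro sum_norm_le) (use dirichlet_char_norm[OF assms(1)] in auto)
    then show ?thesis using True by simp
  next
    case False
    then have N: "N = q + (N - q)" by simp
    have q: "q > 0" using assms(1) by (simp add: dirichlet_char_def)
    have "(\<Sum>n<N. chi n) = (\<Sum>n<q. chi n) + (\<Sum>n<N-q. chi (q + n))"
      using False sum.atLeastLessThan_concat[of 0 q N chi] sum.shift_bounds_nat_ivl[of chi 0 q "N - q"]
      by (simp add: lessThan_atLeast0 add.commute)
    also have "\<dots> = (\<Sum>n<N-q. chi n)"
      using assms(1) dirichlet_char_sum_period[OF assms] by (simp add: dirichlet_char_def add.commute)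
    finally show ?thesis using less[of "N - q"] q False by simp
  qed
qed

lemma dirichlet_char_bounded_sums:
  assumes "dirichlet_char q chi" "\<not> principal_char q chi"
  shows "bounded_sums chi (real q)"
  unfolding bounded_sums_def
proof
  fix N
  \<comment> \<open>Modulus 1 is the one case with \<open>chi 0\<close> nonzero; excluding it lets
    sums from 0 and sums from 1 be identified.\<close>
  have "q \<noteq> 1"
  proof
    assume "q = 1"
    then have "chi n = 1" for n using dirichlet_char_cong[OF assms(1), of n 1] assms(1)
      unfolding dirichlet_char_def by (metis cong_1)
    then show False using assms(2) by (simp add: principal_char_def)
  qed
  then have "chi 0 = 0" using assms(1) by (auto simp: dirichlet_char_def)
  then have "(\<Sum>n=1..N. chi n) = (\<Sum>n<Suc N. chi n)"
    by (subst lessThan_Suc_atMost, subst atMost_atLeast0, subst sum.atLeast_Suc_atMost) auto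
  then show "cmod (\<Sum>n=1..N. chi n) \<le> real q" using dirichlet_char_sum_bound[OF assms, of "Suc N"] by metis
qed

subsection \<open>The Euler product\<close>

text \<open>The common ground of Dirichlet characters and the constant function 1, so that one Euler
  product serves L-functions and zeta.\<close>

definition comp_mult :: "(nat \<Rightarrow> complex) \<Rightarrow> bool" where
  "comp_mult a \<longleftrightarrow> a 1 = 1 \<and> (\<forall>m n. a (m * n) = a m * a n) \<and> (\<forall>n. cmod (a n) \<le> 1)"

lemma dirichlet_char_comp_mult: "dirichlet_char q chi \<Longrightarrow> comp_mult chi"
  unfolding comp_mult_def using dirichlet_char_norm by (auto simp: dirichlet_char_def)

text \<open>The convention \<open>0 powr z = 0\<close> makes the term at n = 0 vanish, so sums may
  run over all naturals.\<close>

definition dterm :: "(nat \<Rightarrow> complex) \<Rightarrow> complex \<Rightarrow> nat \<Rightarrow> complex" where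
  "dterm a w n = a n * of_nat n powr (-w)"

definition prime_sum :: "(nat \<Rightarrow> complex) \<Rightarrow> complex \<Rightarrow> complex" where
  "prime_sum a w = (\<Sum>p. if prime p then dterm a w p else 0)"

text \<open>The part u^2/2 + u^3/3 + ... of -log(1 - u), that is, what the higher powers of one
  prime contribute.\<close>

definition log_term :: "complex \<Rightarrow> complex" where
  "log_term u = - Ln (1 - u) - u"

text \<open>Converges absolutely for Re w > 1/2 with a bound independent of the character, hence
  costs only O(1) in log L.\<close>

definition prime_power_sum :: "(nat \<Rightarrow> complex) \<Rightarrow> complex \<Rightarrow> complex" where
  "prime_power_sum a w = (\<Sum>p. if prime p then log_term (dterm a w p) else 0)"

lemma dterm_norm: "comp_mult a \<Longrightarrow> cmod (dterm a w n) \<le> real n powr (-Re w)"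
  unfolding dterm_def norm_mult cmod_nat_powr
  by (simp add: comp_mult_def mult_left_le_one_le)

lemma dterm_mult: "comp_mult a \<Longrightarrow> dterm a w (m * n) = dterm a w m * dterm a w n"
  unfolding dterm_def comp_mult_def by (simp add: powr_times_real)

text \<open>The derivative of \<open>log_term\<close> is z/(1 - z), at most 4|u| on the disc |z| <=
  |u| <= 3/4.\<close>

lemma log_term_bound:
  assumes "cmod u \<le> 3/4"
  shows "cmod (log_term u) \<le> 4 * cmod u ^ 2"
proof -
  have "cmod (log_term u - log_term 0) \<le> (4 * cmod u) * cmod (u - 0)"
  proof (rule field_differentiable_bound[of "cball 0 (cmod u)" log_term "\<lambda>z. z / (1 - z)" "4 * cmod u" u 0])
    fix z :: complex assume "z \<in> cball 0 (cmod u)"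
    then have z: "cmod z \<le> cmod u" "cmod z \<le> 3/4" using assms by auto
    have "1 - Re z > 0" using complex_Re_le_cmod[of z] z by linarith
    then have nz: "1 - z \<notin> \<real>\<^sub>\<le>\<^sub>0" "1 - z \<noteq> 0" by (auto simp: complex_nonpos_Reals_iff)
    show "(log_term has_field_derivative z / (1 - z)) (at z within cball 0 (cmod u))"
      unfolding log_term_def[abs_def] using nz
      by (auto intro!: derivative_eq_intros simp: field_simps)
    have "cmod (1 - z) \<ge> 1/4" using norm_triangle_ineq2[of 1 z] z by simp
    then have "cmod z / cmod (1 - z) \<le> cmod u / (1/4)" using z by (intro frac_le) auto
    then show "cmod (z / (1 - z)) \<le> 4 * cmod u" by (simp add: norm_divide)
  qed auto
  then show ?thesis by (simp add: log_term_def power2_eq_square)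
qed

text \<open>The worst case is p = 2, where 2^(-1/2) < 3/4. The bound keeps 1 -
  \<open>dterm a w p\<close> off the branch cut of \<open>Ln\<close>.\<close>

lemma prime_powr_half_bound:
  assumes "comp_mult a" "Re w > 1/2" "prime p"
  shows "cmod (dterm a w p) \<le> 3/4"
proof -
  have "real p \<ge> 2" using prime_ge_2_nat[OF assms(3)] by simp
  then have "real p powr (-Re w) \<le> 2 powr (-Re w)" using assms(2) by (intro powr_mono2') auto
  also have "\<dots> \<le> 2 powr (-(1/2))" using assms(2) by (intro powr_mono) auto
  also have "\<dots> \<le> 3/4"
  proof -
    have "(4/3)^2 \<le> (2::real)" by (simp add: power2_eq_square)
    then have "4/3 \<le> sqrt 2" by (rule real_le_rsqrt)
    then show ?thesis by (simp add: powr_minus powr_half_sqrt field_simps)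
  qed
  finally show ?thesis using dterm_norm[OF assms(1), of w p] by linarith
qed

lemma log_dterm_bound:
  assumes "comp_mult a" "Re w \<ge> \<sigma>" "\<sigma> > 1/2"
  shows "cmod (if prime p then log_term (dterm a w p) else 0) \<le> 4 * real p powr (-2*\<sigma>)"
proof (cases "prime p")
  case True
  have "cmod (log_term (dterm a w p)) \<le> 4 * cmod (dterm a w p) ^ 2"
    using log_term_bound prime_powr_half_bound[OF assms(1) _ True] assms by auto
  also have "\<dots> \<le> 4 * (real p powr (-\<sigma>)) ^ 2"
  proof -
    have "real p powr (-Re w) \<le> real p powr (-\<sigma>)"
      using assms prime_ge_2_nat[OF True] by (intro powr_mono) auto
    then show ?thesis using dterm_norm[OF assms(1), of w p] by (intro mult_left_mono power_mono) auto
  qed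
  also have "\<dots> = 4 * real p powr (-2*\<sigma>)"
    by (simp add: power2_eq_square flip: powr_add)
  finally show ?thesis using True by simp
qed auto

lemma prime_power_sum_bound:
  assumes "comp_mult a" "Re w \<ge> \<sigma>" "\<sigma> > 1/2"
  shows "summable (\<lambda>p. if prime p then log_term (dterm a w p) else 0)"
    and "cmod (prime_power_sum a w) \<le> 4 * (\<Sum>n. real n powr (-2*\<sigma>))"
proof -
  have s: "summable (\<lambda>n. real n powr (-2*\<sigma>))" using assms by (simp add: summable_real_powr_iff)
  show "summable (\<lambda>p. if prime p then log_term (dterm a w p) else 0)"
    by (rule summable_comparison_test'[OF summable_mult[OF s, of 4]]) (rule log_dterm_bound[OF assms])
  have "cmod (prime_power_sum a w) \<le> (\<Sum>n. 4 * real n powr (-2*\<sigma>))"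
    unfolding prime_power_sum_def
    by (rule norm_suminf_le[OF log_dterm_bound[OF assms] summable_mult[OF s]])
  then show "cmod (prime_power_sum a w) \<le> 4 * (\<Sum>n. real n powr (-2*\<sigma>))"
    using suminf_mult[OF s, of 4] by simp
qed

lemma prime_power_sum_holomorphic:
  assumes "comp_mult a"
  shows "prime_power_sum a holomorphic_on {w. Re w > 1/2}"
  unfolding prime_power_sum_def[abs_def]
proof (rule holomorphic_suminf_halfplane)
  show "(\<lambda>w. if prime n then log_term (dterm a w n) else 0) holomorphic_on {w. Re w > 1/2}" for n
  proof (cases "prime n")
    case True
    have "1 - dterm a w n \<notin> \<real>\<^sub>\<le>\<^sub>0" if "Re w > 1/2" for w
    proof -
      have "Re (dterm a w n) \<le> 3/4"
        using prime_powr_half_bound[OF assms that True] complex_Re_le_cmod[of "dterm a w n"] by linarith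
      then show ?thesis by (auto simp: complex_nonpos_Reals_iff)
    qed
    then have "(\<lambda>w. log_term (dterm a w n)) holomorphic_on {w. Re w > 1/2}"
      unfolding log_term_def dterm_def by (intro holomorphic_intros) auto
    then show ?thesis using True by simp
  qed auto
  fix \<sigma> R :: real assume "\<sigma> > 1/2"
  then have "summable (\<lambda>n. 4 * real n powr (-2*\<sigma>))"
    by (intro summable_mult) (simp add: summable_real_powr_iff)
  then show "\<exists>h. summable h \<and> (\<forall>n w. Re w \<ge> \<sigma> \<and> cmod w \<le> R \<longrightarrow>
      cmod (if prime n then log_term (dterm a w n) else 0) \<le> h n)"
    using log_dterm_bound[OF assms _ \<open>\<sigma> > 1/2\<close>] by blast
qed

lemma prime_dterm_bound:
  assumes "comp_mult a" "Re w \<ge> \<sigma>"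
  shows "cmod (if prime p then dterm a w p else 0) \<le> real p powr (-\<sigma>)"
proof (cases "prime p")
  case True
  have "real p powr (-Re w) \<le> real p powr (-\<sigma>)"
    using assms prime_ge_2_nat[OF True] by (intro powr_mono) auto
  then show ?thesis using dterm_norm[OF assms(1), of w p] True by auto
qed auto

lemma prime_sum_bound:
  assumes "comp_mult a" "Re w \<ge> \<sigma>" "\<sigma> > 1"
  shows "summable (\<lambda>p. if prime p then dterm a w p else 0)"
    and "cmod (prime_sum a w) \<le> (\<Sum>n. real n powr (-\<sigma>))"
proof -
  have s: "summable (\<lambda>n. real n powr (-\<sigma>))" using assms by (simp add: summable_real_powr_iff)
  show "summable (\<lambda>p. if prime p then dterm a w p else 0)"
    by (rule summable_comparison_test'[OF s]) (rule prime_dterm_bound[OF assms(1,2)])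
  show "cmod (prime_sum a w) \<le> (\<Sum>n. real n powr (-\<sigma>))"
    unfolding prime_sum_def by (rule norm_suminf_le[OF prime_dterm_bound[OF assms(1,2)] s])
qed

lemma prime_sum_holomorphic:
  assumes "comp_mult a"
  shows "prime_sum a holomorphic_on {w. Re w > 1}"
  unfolding prime_sum_def[abs_def]
proof (rule holomorphic_suminf_halfplane)
  show "(\<lambda>w. if prime n then dterm a w n else 0) holomorphic_on {w. Re w > 1}" for n
    by (cases "prime n") (auto simp: dterm_def intro!: holomorphic_intros)
  fix \<sigma> R :: real assume "\<sigma> > 1"
  then have "summable (\<lambda>n. real n powr (-\<sigma>))" by (simp add: summable_real_powr_iff)
  then show "\<exists>h. summable h \<and> (\<forall>n w. Re w \<ge> \<sigma> \<and> cmod w \<le> R \<longrightarrow>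
      cmod (if prime n then dterm a w n else 0) \<le> h n)"
    using prime_dterm_bound[OF assms] by blast
qed

lemma dterm_summable:
  assumes "comp_mult a" "Re w > 1"
  shows "summable (\<lambda>n. cmod (dterm a w n))"
proof (rule summable_comparison_test')
  show "summable (\<lambda>n. real n powr (-Re w))" using assms by (simp add: summable_real_powr_iff)
  show "norm (cmod (dterm a w n)) \<le> real n powr (-Re w)" if "n \<ge> 0" for n
    using dterm_norm[OF assms(1)] by simp
qed

section \<open>Sieving out the small primes\<close>

definition rough :: "nat \<Rightarrow> nat set" where
  "rough N = {n. \<forall>p<N. prime p \<longrightarrow> \<not> p dvd n}"

lemma rough_Suc_not_prime: "\<not> prime N \<Longrightarrow> rough (Suc N) = rough N"
  unfolding rough_def using less_Suc_eq by auto

lemma rough_Suc_prime: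
  assumes "prime N"
  shows "rough N = rough (Suc N) \<union> (*) N ` rough N" "rough (Suc N) \<inter> (*) N ` rough N = {}"
proof -
  have *: "N * m \<in> rough N \<longleftrightarrow> m \<in> rough N" for m
  proof -
    have "p dvd N * m \<longleftrightarrow> p dvd m" if "p < N" "prime p" for p
    proof -
      have "\<not> p dvd N" using that assms primes_dvd_imp_eq by blast
      then show ?thesis using that prime_dvd_mult_iff by blast
    qed
    then show ?thesis unfolding rough_def by auto
  qed
  show "rough N = rough (Suc N) \<union> (*) N ` rough N"
  proof (intro equalityI subsetI)
    fix n assume n: "n \<in> rough N"
    show "n \<in> rough (Suc N) \<union> (*) N ` rough N"
    proof (cases "N dvd n")
      case True then show ?thesis using n * by auto
    next
      case False then show ?thesis using n unfolding rough_def using less_Suc_eq by auto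
    qed
  next
    fix n assume "n \<in> rough (Suc N) \<union> (*) N ` rough N"
    then show "n \<in> rough N" using * unfolding rough_def by auto
  qed
  show "rough (Suc N) \<inter> (*) N ` rough N = {}"
    using assms unfolding rough_def by auto
qed

text \<open>Passing a prime N removes the multiples N m with m in \<open>rough N\<close>. By
  multiplicativity their sum is \<open>dterm a w N\<close> times the previous sum, which produces
  one Euler factor.\<close>

lemma sieved_sum:
  assumes "comp_mult a" "Re w > 1"
  shows "infsum (dterm a w) (rough N) = infsum (dterm a w) UNIV * (\<Prod>p | p < N \<and> prime p. (1 - dterm a w p))"
proof (induction N)
  case 0
  then show ?case by (simp add: rough_def)
next
  case (Suc N)
  show ?case
  proof (cases "prime N")
    case False
    then have "{p. p < Suc N \<and> prime p} = {p. p < N \<and> prime p}" using less_Suc_eq by auto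
    then show ?thesis using Suc rough_Suc_not_prime[OF False] by simp
  next
    case True
    have sm: "dterm a w summable_on A" for A
      using norm_summable_imp_summable_on[OF dterm_summable[OF assms]] summable_on_subset_banach by blast
    have "infsum (dterm a w) (rough N) = infsum (dterm a w) (rough (Suc N)) + infsum (dterm a w) ((*) N ` rough N)"
      by (subst rough_Suc_prime(1)[OF True]) (intro infsum_Un_disjoint sm rough_Suc_prime(2)[OF True])
    also have "infsum (dterm a w) ((*) N ` rough N) = infsum (\<lambda>n. dterm a w (N * n)) (rough N)"
      using True by (subst infsum_reindex) (auto simp: inj_on_def o_def prime_gt_0_nat)
    also have "\<dots> = dterm a w N * infsum (dterm a w) (rough N)"
      by (simp add: dterm_mult[OF assms(1)] infsum_cmult_right sm)
    finally have "infsum (dterm a w) (rough (Suc N)) =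
        infsum (dterm a w) (rough N) - dterm a w N * infsum (dterm a w) (rough N)"
      by (metis add_diff_cancel_right')
    then have "infsum (dterm a w) (rough (Suc N)) = infsum (dterm a w) (rough N) * (1 - dterm a w N)"
      by (simp only: left_diff_distrib right_diff_distrib mult_1_left mult_1_right mult.commute)
    moreover have "{p. p < Suc N \<and> prime p} = insert N {p. p < N \<and> prime p}" using True less_Suc_eq by auto
    ultimately show ?thesis using Suc by (simp add: mult_ac)
  qed
qed

text \<open>A number other than 0 and 1 has a prime factor not exceeding it.\<close>

lemma rough_cases: "n \<in> rough N \<Longrightarrow> n = 1 \<or> n \<ge> N \<or> n = 0"
proof (rule ccontr)
  assume n: "n \<in> rough N" "\<not> (n = 1 \<or> n \<ge> N \<or> n = 0)"
  then obtain p where "prime p" "p dvd n" using prime_factor_nat by blast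
  moreover have "p \<le> n" using \<open>p dvd n\<close> n by (simp add: dvd_imp_le)
  ultimately show False using n unfolding rough_def by auto
qed

text \<open>Only n = 1 survives every stage; the other nonzero rough numbers are at least N, so they
  are dominated by a tail of an absolutely convergent series.\<close>

lemma sieved_sum_tendsto:
  assumes "comp_mult a" "Re w > 1"
  shows "(\<lambda>N. infsum (dterm a w) (rough N)) \<longlonglongrightarrow> 1"
proof -
  note s = dterm_summable[OF assms]
  have sm: "dterm a w summable_on A" for A
    using norm_summable_imp_summable_on[OF s] summable_on_subset_banach by blast
  have "(\<lambda>N. infsum (dterm a w) (rough N) - 1) \<longlonglongrightarrow> 0"
  proof (rule Lim_null_comparison)
    show "(\<lambda>N. \<Sum>n. cmod (dterm a w (n + N))) \<longlonglongrightarrow> 0" using suminf_exist_split2[OF s] .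
    show "\<forall>\<^sub>F N in sequentially. cmod (infsum (dterm a w) (rough N) - 1) \<le> (\<Sum>n. cmod (dterm a w (n + N)))"
      using eventually_ge_at_top[of 2]
    proof eventually_elim
      case (elim N)
      have 1: "1 \<in> rough N" unfolding rough_def by auto
      have d1: "dterm a w 1 = 1" "dterm a w 0 = 0" using assms by (auto simp: dterm_def comp_mult_def)
      have "infsum (dterm a w) (rough N) = infsum (dterm a w) {1} + infsum (dterm a w) (rough N - {1})"
        using infsum_Un_disjoint[OF sm sm, of "{1}" "rough N - {1}"] 1 by (simp add: insert_absorb)
      then have "infsum (dterm a w) (rough N) - 1 = infsum (dterm a w) (rough N - {1})" using d1 by simp
      also have "\<dots> = infsum (dterm a w) (rough N - {1} - {0})"
        by (rule infsum_cong_neutral) (use d1 in auto)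
      finally have eq: "infsum (dterm a w) (rough N) - 1 = infsum (dterm a w) (rough N - {1} - {0})" .
      have na: "(\<lambda>n. cmod (dterm a w n)) summable_on A" for A
        by (rule summable_on_subset_banach[OF norm_summable_imp_summable_on]) (use s in auto)
      have "cmod (infsum (dterm a w) (rough N - {1} - {0})) \<le> infsum (\<lambda>n. cmod (dterm a w n)) (rough N - {1} - {0})"
        by (rule norm_infsum_bound) (rule na)
      also have "\<dots> \<le> infsum (\<lambda>n. cmod (dterm a w n)) {N..}"
        by (rule infsum_mono_neutral[OF na na]) (use rough_cases in auto)
      also have "{N..} = (\<lambda>n. n + N) ` UNIV"
        by (auto simp: image_iff) (metis add.commute le_iff_add)
      also have "infsum (\<lambda>n. cmod (dterm a w n)) ((\<lambda>n. n + N) ` UNIV) = infsum (\<lambda>n. cmod (dterm a w (n + N))) UNIV"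
        by (subst infsum_reindex) (auto simp: o_def)
      also have "\<dots> = (\<Sum>n. cmod (dterm a w (n + N)))"
        by (rule infsumI, rule sums_nonneg_imp_has_sum, rule summable_sums, rule summable_ignore_initial_segment[OF s]) simp
      finally show ?case unfolding eq .
    qed
  qed
  then show ?thesis by (simp add: LIM_zero_iff)
qed

text \<open>The finite Euler products are exponentials of partial sums and hence converge; the sieve
  identity in the limit says that the series times exp(-(...)) is 1.\<close>

lemma euler_product:
  assumes "comp_mult a" "Re w > 1"
  shows "(\<Sum>n. dterm a w n) = exp (prime_sum a w + prime_power_sum a w)"
proof -
  note s = dterm_summable[OF assms]
  have inf: "infsum (dterm a w) UNIV = (\<Sum>n. dterm a w n)"
    by (rule infsumI, rule norm_summable_imp_has_sum[OF s], rule summable_sums, rule summable_norm_cancel[OF s])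
  let ?t = "\<lambda>p. if prime p then Ln (1 - dterm a w p) else 0"
  have t: "?t p = - ((if prime p then dterm a w p else 0) + (if prime p then log_term (dterm a w p) else 0))" for p
    by (simp add: log_term_def)
  have w: "Re w > 1/2" using assms by simp
  have "(\<lambda>N. \<Sum>p<N. ?t p) \<longlonglongrightarrow> - (prime_sum a w + prime_power_sum a w)"
    unfolding t prime_sum_def prime_power_sum_def sum_negf sum.distrib
    by (intro tendsto_intros summable_LIMSEQ prime_sum_bound(1)[OF assms(1) order.refl assms(2)]
        prime_power_sum_bound(1)[OF assms(1) order.refl w])
  then have "(\<lambda>N. exp (\<Sum>p<N. ?t p)) \<longlonglongrightarrow> exp (- (prime_sum a w + prime_power_sum a w))"
    by (intro tendsto_intros)
  moreover have "exp (\<Sum>p<N. ?t p) = (\<Prod>p | p < N \<and> prime p. (1 - dterm a w p))" for N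
  proof -
    have "exp (\<Sum>p<N. ?t p) = (\<Prod>p<N. if prime p then 1 - dterm a w p else 1)"
      unfolding exp_sum[OF finite_lessThan]
    proof (intro prod.cong refl)
      fix p
      have "prime p \<Longrightarrow> dterm a w p \<noteq> 1" using prime_powr_half_bound[OF assms(1) w, of p] by auto
      then show "exp (?t p) = (if prime p then 1 - dterm a w p else 1)" by simp
    qed
    also have "\<dots> = (\<Prod>p\<in>{p\<in>{..<N}. prime p}. (1 - dterm a w p))"
      by (rule prod.inter_filter[symmetric]) simp
    also have "{p\<in>{..<N}. prime p} = {p. p < N \<and> prime p}" by auto
    finally show ?thesis .
  qed
  ultimately have "(\<lambda>N. \<Prod>p | p < N \<and> prime p. (1 - dterm a w p)) \<longlonglongrightarrow> exp (- (prime_sum a w + prime_power_sum a w))"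
    by simp
  then have "(\<lambda>N. infsum (dterm a w) (rough N)) \<longlonglongrightarrow> (\<Sum>n. dterm a w n) * exp (- (prime_sum a w + prime_power_sum a w))"
    unfolding sieved_sum[OF assms] inf by (intro tendsto_intros)
  then have "(\<Sum>n. dterm a w n) * exp (- (prime_sum a w + prime_power_sum a w)) = 1"
    using sieved_sum_tendsto[OF assms] LIMSEQ_unique by blast
  then show ?thesis by (metis exp_minus_inverse mult.commute mult.left_commute mult.right_neutral)
qed

lemma Lfun_eq_dseries:
  assumes "comp_mult a" "Re w > 1"
  shows "Lfun a w = (\<Sum>n. dterm a w n)"
proof -
  have "(\<lambda>N. \<Sum>n<Suc N. dterm a w n) \<longlonglongrightarrow> (\<Sum>n. dterm a w n)"
    by (rule LIMSEQ_Suc, rule summable_LIMSEQ, rule summable_norm_cancel[OF dterm_summable[OF assms]])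
  moreover have "(\<Sum>n<Suc N. dterm a w n) = (\<Sum>n=1..N. a n / (of_nat n) powr w)" for N
  proof -
    have "(\<Sum>n<Suc N. dterm a w n) = dterm a w 0 + (\<Sum>n=1..N. dterm a w n)"
      by (subst lessThan_Suc_atMost, subst atMost_atLeast0, subst sum.atLeast_Suc_atMost) auto
    then show ?thesis by (simp add: dterm_def powr_minus_divide)
  qed
  ultimately show ?thesis unfolding Lfun_def by (intro limI) simp
qed

subsection \<open>The zeta function and its zeros\<close>

text \<open>With m = n + 1 this is (w - 1) times the difference of m^(-w) and the integral of u^(-w)
  over [m, m + 1].\<close>

definition zeta_term :: "nat \<Rightarrow> complex \<Rightarrow> complex" where
  "zeta_term n w = (w - 1) * of_nat (Suc n) powr (-w) + of_nat (Suc (Suc n)) powr (1 - w) - of_nat (Suc n) powr (1 - w)"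

text \<open>This is (w - 1) zeta(w), the pole already removed; the summand 1 is (w - 1) times the
  integral of u^(-w) from 1 to infinity.\<close>

definition zeta1 :: "complex \<Rightarrow> complex" where
  "zeta1 w = 1 + (\<Sum>n. zeta_term n w)"

lemma zeta_term_bound:
  assumes "Re w \<ge> -1"
  shows "cmod (zeta_term n w) \<le> cmod (w - 1) * cmod w * real (Suc n) powr (-Re w - 1)"
proof -
  define x where "x = real (Suc n)"
  define B where "B = cmod (w - 1) * (cmod w * x powr (-Re w - 1))"
  \<comment> \<open>Chosen so that its increment from x to x + 1 is \<open>zeta_term\<close> and its
    derivative is again a difference of powers, small by the previous bound.\<close>
  define \<phi> where "\<phi> z = (w - 1) * of_real x powr (-w) * z + z powr (1 - w)" for z :: complex
  let ?S = "closed_segment (of_real x) (of_real (x + 1)) :: complex set"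
  have x: "x > 0" by (simp add: x_def)
  have "cmod (\<phi> (of_real (x + 1)) - \<phi> (of_real x)) \<le> B * cmod (of_real (x + 1) - of_real x :: complex)"
  proof (rule field_differentiable_bound[of ?S \<phi> "\<lambda>z. (w - 1) * (of_real x powr (-w) - z powr (-w))"])
    fix z assume "z \<in> ?S"
    then have "z \<in> of_real ` closed_segment x (x + 1)" unfolding closed_segment_of_real .
    then obtain r where r: "z = of_real r" "x \<le> r" "r \<le> x + 1"
      by (auto simp: closed_segment_eq_real_ivl)
    have "z \<notin> \<real>\<^sub>\<le>\<^sub>0" using r x by auto
    then show "(\<phi> has_field_derivative (w - 1) * (of_real x powr (-w) - z powr (-w))) (at z within ?S)"
      unfolding \<phi>_def by (auto intro!: derivative_eq_intros simp: algebra_simps)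
    show "cmod ((w - 1) * (of_real x powr (-w) - z powr (-w))) \<le> B"
      unfolding B_def norm_mult r using of_real_powr_minus_diff_bound[of x r w] assms r x
      by (intro mult_left_mono) auto
  qed auto
  moreover have "\<phi> (of_real (x + 1)) - \<phi> (of_real x) = zeta_term n w"
    unfolding \<phi>_def zeta_term_def x_def by (simp add: algebra_simps)
  ultimately show ?thesis unfolding B_def x_def by (simp add: mult.assoc)
qed

lemma zeta1_holomorphic: "zeta1 holomorphic_on {w. Re w > 0}"
proof -
  have "(\<lambda>w. \<Sum>n. zeta_term n w) holomorphic_on {w. Re w > 0}"
  proof (rule holomorphic_suminf_halfplane)
    show "zeta_term n holomorphic_on {w. Re w > 0}" for n
      unfolding zeta_term_def[abs_def] by (intro holomorphic_intros)
    fix \<sigma> R :: real assume "\<sigma> > 0"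
    show "\<exists>h. summable h \<and> (\<forall>n w. Re w \<ge> \<sigma> \<and> cmod w \<le> R \<longrightarrow> cmod (zeta_term n w) \<le> h n)"
    proof (intro exI[of _ "\<lambda>n. (R + 1) * R * real (Suc n) powr (-\<sigma> - 1)"] conjI allI impI)
      show "summable (\<lambda>n. (R + 1) * R * real (Suc n) powr (-\<sigma> - 1))"
        using \<open>\<sigma> > 0\<close> by (intro summable_mult summable_Suc_powr) auto
      fix n w assume w: "Re w \<ge> \<sigma> \<and> cmod w \<le> R"
      have R: "R \<ge> 0" using w norm_ge_zero order_trans by blast
      have "cmod (zeta_term n w) \<le> cmod (w - 1) * cmod w * real (Suc n) powr (-Re w - 1)"
        using zeta_term_bound w \<open>\<sigma> > 0\<close> by auto
      also have "\<dots> \<le> (R + 1) * R * real (Suc n) powr (-\<sigma> - 1)"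
        using w R norm_triangle_ineq4[of w 1] by (intro mult_mono powr_mono mult_nonneg_nonneg) auto
      finally show "cmod (zeta_term n w) \<le> (R + 1) * R * real (Suc n) powr (-\<sigma> - 1)" .
    qed
  qed
  then show ?thesis unfolding zeta1_def[abs_def] by (intro holomorphic_intros)
qed

lemma zeta1_bound:
  assumes "Re w \<ge> \<sigma>" "\<sigma> > 0"
  shows "cmod (zeta1 w) \<le> 1 + cmod (w - 1) * cmod w * (\<Sum>n. real (Suc n) powr (-\<sigma> - 1))"
proof -
  have w: "Re w > 0" using assms by simp
  have b: "cmod (zeta_term n w) \<le> cmod (w - 1) * cmod w * real (Suc n) powr (-\<sigma> - 1)" for n
  proof -
    have "cmod (zeta_term n w) \<le> cmod (w - 1) * cmod w * real (Suc n) powr (-Re w - 1)"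
      using zeta_term_bound w by auto
    also have "\<dots> \<le> cmod (w - 1) * cmod w * real (Suc n) powr (-\<sigma> - 1)"
      using assms by (intro mult_left_mono powr_mono) auto
    finally show ?thesis .
  qed
  have s: "summable (\<lambda>n. real (Suc n) powr (-\<sigma> - 1))" using assms by (intro summable_Suc_powr) auto
  have "cmod (\<Sum>n. zeta_term n w) \<le> (\<Sum>n. cmod (w - 1) * cmod w * real (Suc n) powr (-\<sigma> - 1))"
    by (rule norm_suminf_le[OF b]) (intro summable_mult s)
  also have "\<dots> = cmod (w - 1) * cmod w * (\<Sum>n. real (Suc n) powr (-\<sigma> - 1))"
    using s by (rule suminf_mult)
  finally show ?thesis unfolding zeta1_def using norm_triangle_ineq[of 1 "\<Sum>n. zeta_term n w"] by simp
qed

abbreviation one :: "nat \<Rightarrow> complex" where "one \<equiv> \<lambda>_. 1"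

lemma comp_mult_one: "comp_mult one" by (simp add: comp_mult_def)

lemma dterm_one_sums:
  assumes "Re w > 1"
  shows "(\<lambda>n. of_nat (Suc n) powr (-w)) sums (\<Sum>n. dterm one w n)"
proof -
  have "(\<lambda>n. dterm one w n) sums (\<Sum>n. dterm one w n)"
    by (rule summable_sums, rule summable_norm_cancel[OF dterm_summable[OF comp_mult_one assms]])
  then have "(\<lambda>n. dterm one w (Suc n)) sums ((\<Sum>n. dterm one w n) - dterm one w 0)" by (subst sums_Suc_iff) simp
  then show ?thesis by (simp add: dterm_def)
qed

text \<open>The powers with exponent 1 - w telescope, and their boundary term vanishes in the limit
  for Re w > 1.\<close>

lemma zeta1_eq:
  assumes "Re w > 1"
  shows "zeta1 w = (w - 1) * (\<Sum>n. dterm one w n)"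
proof -
  have part: "(\<Sum>n<N. zeta_term n w) = (w - 1) * (\<Sum>n<N. of_nat (Suc n) powr (-w)) + of_nat (Suc N) powr (1 - w) - 1" for N
  proof (induction N)
    case (Suc N)
    then show ?case unfolding sum.lessThan_Suc zeta_term_def by (simp add: algebra_simps)
  qed simp
  have "(\<lambda>N. of_nat (Suc N) powr (1 - w) :: complex) \<longlonglongrightarrow> 0"
  proof (rule Lim_null_comparison)
    show "(\<lambda>N. real (Suc N) powr (1 - Re w)) \<longlonglongrightarrow> 0"
      using assms by (intro tendsto_neg_powr filterlim_compose[OF filterlim_real_sequentially filterlim_Suc]) auto
    show "\<forall>\<^sub>F N in sequentially. cmod (of_nat (Suc N) powr (1 - w)) \<le> real (Suc N) powr (1 - Re w)"
      by (intro always_eventually allI) (simp add: cmod_nat_powr del: of_nat_Suc)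
  qed
  then have "(\<lambda>N. (w - 1) * (\<Sum>n<N. of_nat (Suc n) powr (-w)) + of_nat (Suc N) powr (1 - w) - 1)
     \<longlonglongrightarrow> (w - 1) * (\<Sum>n. dterm one w n) + 0 - 1"
    using dterm_one_sums[OF assms] unfolding sums_def by (intro tendsto_intros)
  then have "(\<lambda>N. \<Sum>n<N. zeta_term n w) \<longlonglongrightarrow> (w - 1) * (\<Sum>n. dterm one w n) - 1"
    unfolding part by simp
  then have "(\<Sum>n. zeta_term n w) = (w - 1) * (\<Sum>n. dterm one w n) - 1"
    by (intro sums_unique[symmetric]) (simp add: sums_def)
  then show ?thesis unfolding zeta1_def by simp
qed

section \<open>The alternating series and zeta\<close>

abbreviation alt :: "nat \<Rightarrow> complex" where "alt \<equiv> \<lambda>n. (-1) ^ (n - 1)"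

lemma eta_fun_eq_Lfun: "eta_fun = Lfun alt"
  unfolding eta_fun_def[abs_def] Lfun_def[abs_def] by simp

lemma alt_bounded_sums: "bounded_sums alt 1"
proof -
  have "(\<Sum>n=1..N. alt n) = (if even N then 0 else 1)" for N by (induction N) auto
  then show ?thesis unfolding bounded_sums_def by simp
qed

text \<open>Along even partial sums, the alternating sum is the plain sum minus twice its even
  terms, and these are 2^(-w) times the plain sum up to half the length.\<close>

lemma eta_eq_halfplane1:
  assumes "Re w > 1"
  shows "eta_fun w = (1 - 2 powr (1 - w)) * (\<Sum>n. dterm one w n)"
proof -
  let ?f = "\<lambda>n. 1 / of_nat n powr w :: complex"
  have part: "(\<Sum>n=1..2*N. alt n / of_nat n powr w) = (\<Sum>n=1..2*N. ?f n) - 2 powr (1 - w) * (\<Sum>n=1..N. ?f n)" for N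
  proof (induction N)
    case (Suc N)
    have b: "(of_nat (2 * Suc N) :: complex) powr w = 2 powr w * of_nat (Suc N) powr w"
      using powr_times_real[of 2 "of_nat (Suc N)" w] by (simp only: of_nat_mult of_nat_numeral) simp
    have pd: "2 powr (1 - w) = 2 / (2 powr w :: complex)" by (simp add: powr_diff)
    have *: "2 powr (1 - w) * ?f (Suc N) = 2 * ?f (2 * Suc N)"
      by (subst b, subst pd) (simp del: of_nat_Suc of_nat_mult)
    have s: "(\<Sum>n=1..2 * Suc N. g n) = (\<Sum>n=1..2*N. g n) + g (Suc (2 * N)) + g (2 * Suc N)" for g :: "nat \<Rightarrow> complex"
      by (simp add: numeral_2_eq_2)
    have "(\<Sum>n=1..Suc N. ?f n) = (\<Sum>n=1..N. ?f n) + ?f (Suc N)" by simp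
    then have m1: "2 powr (1 - w) * (\<Sum>n=1..Suc N. ?f n) = 2 powr (1 - w) * (\<Sum>n=1..N. ?f n) + 2 * ?f (2 * Suc N)"
      by (simp only: distrib_left *)
    have m2: "alt (Suc (2 * N)) / of_nat (Suc (2 * N)) powr w = ?f (Suc (2 * N))"
      and m3: "alt (2 * Suc N) / of_nat (2 * Suc N) powr w = - ?f (2 * Suc N)" by simp_all
    have aux: "F2 - c + f1 + - f2 = F2 + f1 + f2 - (c + 2 * f2)" for F2 c f1 f2 :: complex by simp
    show ?case unfolding s Suc m1 m2 m3 by (rule aux)
  qed simp
  have l1: "(\<lambda>N. \<Sum>n=1..N. ?f n) \<longlonglongrightarrow> (\<Sum>n. dterm one w n)"
  proof -
    have "(\<Sum>n=1..N. ?f n) = (\<Sum>n<N. of_nat (Suc n) powr (-w))" for N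
      by (induction N) (simp_all add: powr_minus_divide)
    then show ?thesis using dterm_one_sums[OF assms] unfolding sums_def by simp
  qed
  have sub: "filterlim (\<lambda>N. 2 * N :: nat) sequentially sequentially"
    by (rule filterlim_subseq) (simp add: strict_mono_def)
  have "(\<lambda>N. \<Sum>n=1..2*N. alt n / of_nat n powr w) \<longlonglongrightarrow> (\<Sum>n. dterm one w n) - 2 powr (1 - w) * (\<Sum>n. dterm one w n)"
    unfolding part by (intro tendsto_intros l1 filterlim_compose[OF l1 sub])
  moreover have "(\<lambda>N. \<Sum>n=1..2*N. alt n / of_nat n powr w) \<longlonglongrightarrow> eta_fun w"
  proof -
    have "Re w > 0" using assms by simp
    then have "(\<lambda>N. \<Sum>n=1..N. alt n / of_nat n powr w) \<longlonglongrightarrow> eta_fun w"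
      using dirichlet_series_bounded_sums(2)[OF alt_bounded_sums] Lfun_eq_abel[OF alt_bounded_sums] eta_fun_eq_Lfun by simp
    then show ?thesis using filterlim_compose[OF _ sub] by fast
  qed
  ultimately show ?thesis using LIMSEQ_unique by (fastforce simp: algebra_simps)
qed

text \<open>Both sides are holomorphic for Re w > 0 and agree for Re w > 1. It carries the zero-free
  strip, which \<open>GRH\<close> states for eta, over to \<open>zeta1\<close>.\<close>

lemma eta_zeta1:
  assumes "Re w > 0"
  shows "(w - 1) * eta_fun w = (1 - 2 powr (1 - w)) * zeta1 w"
proof -
  let ?S = "{w. Re w > 0}"
  have "(w - 1) * eta_fun w - (1 - 2 powr (1 - w)) * zeta1 w = 0"
  proof (rule analytic_continuation_open[of "{w. Re w > 1}" ?S "\<lambda>w. (w - 1) * eta_fun w - (1 - 2 powr (1 - w)) * zeta1 w" "\<lambda>_. 0" w])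
    show "connected ?S" by (intro convex_connected convex_halfspace_Re_gt)
    show "{w::complex. Re w > 1} \<noteq> {}" by (auto intro!: exI[of _ 2])
    show "(\<lambda>w. (w - 1) * eta_fun w - (1 - 2 powr (1 - w)) * zeta1 w) holomorphic_on ?S"
      unfolding eta_fun_eq_Lfun by (intro holomorphic_intros Lfun_holomorphic[OF alt_bounded_sums] zeta1_holomorphic)
    show "(z - 1) * eta_fun z - (1 - 2 powr (1 - z)) * zeta1 z = 0" if "z \<in> {w. Re w > 1}" for z
      using that eta_eq_halfplane1[of z] zeta1_eq[of z] by simp
  qed (use assms in \<open>auto intro: open_halfspace_Re_gt\<close>)
  then show ?thesis by simp
qed

section \<open>No zeros of zeta on the line Re w = 1\<close>

lemma dterm_one_Re:
  assumes "p > 0"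
  shows "Re (dterm one (Complex \<sigma> \<tau>) p) = real p powr (-\<sigma>) * cos (\<tau> * ln (real p))"
proof -
  have "dterm one (Complex \<sigma> \<tau>) p = exp (- Complex \<sigma> \<tau> * of_real (ln (real p)))"
    using assms by (simp add: dterm_def powr_def Ln_of_nat)
  then show ?thesis using assms by (simp add: Re_exp powr_def mult.commute)
qed

text \<open>The classical inequality 3 + 4 cos x + cos 2x = 2 (1 + cos x)^2 >= 0, applied prime by
  prime.\<close>

lemma three_four_one:
  assumes "\<sigma> > 1"
  shows "Re (3 * prime_sum one (Complex \<sigma> 0) + 4 * prime_sum one (Complex \<sigma> \<tau>) + prime_sum one (Complex \<sigma> (2*\<tau>))) \<ge> 0"
proof -
  have s: "(\<lambda>p. Re (if prime p then dterm one (Complex \<sigma> u) p else 0)) sums Re (prime_sum one (Complex \<sigma> u))" for u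
    unfolding prime_sum_def by (intro sums_Re summable_sums prime_sum_bound(1)[OF comp_mult_one _ assms]) simp
  have "(\<lambda>p. 3 * Re (if prime p then dterm one (Complex \<sigma> 0) p else 0) + 4 * Re (if prime p then dterm one (Complex \<sigma> \<tau>) p else 0) + Re (if prime p then dterm one (Complex \<sigma> (2*\<tau>)) p else 0)) sums
     (3 * Re (prime_sum one (Complex \<sigma> 0)) + 4 * Re (prime_sum one (Complex \<sigma> \<tau>)) + Re (prime_sum one (Complex \<sigma> (2*\<tau>))))"
    by (intro sums_add sums_mult s)
  moreover have "3 * Re (if prime p then dterm one (Complex \<sigma> 0) p else 0) + 4 * Re (if prime p then dterm one (Complex \<sigma> \<tau>) p else 0) + Re (if prime p then dterm one (Complex \<sigma> (2*\<tau>)) p else 0) \<ge> 0" for p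
  proof (cases "prime p")
    case True
    have "3 + 4 * cos (\<tau> * ln p) + cos (2 * \<tau> * ln p) = 2 * (1 + cos (\<tau> * ln p))^2"
      using cos_double_cos[of "\<tau> * ln p"] by (simp add: power2_eq_square algebra_simps)
    then have "real p powr (-\<sigma>) * (3 + 4 * cos (\<tau> * ln p) + cos (2 * \<tau> * ln p)) \<ge> 0" by simp
    then show ?thesis using True by (simp add: dterm_one_Re prime_gt_0_nat algebra_simps)
  qed auto
  ultimately have "3 * Re (prime_sum one (Complex \<sigma> 0)) + 4 * Re (prime_sum one (Complex \<sigma> \<tau>)) + Re (prime_sum one (Complex \<sigma> (2*\<tau>))) \<ge> 0"
    by (metis (no_types, lifting) sums_le sums_zero)
  then show ?thesis by simp
qed

text \<open>The previous inequality exponentiated. The factor (\<sigma> - 1)^3 comes from w - 1 in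
  \<open>zeta1\<close> at the real point, and the 8 counts 3 + 4 + 1 bounds for prime
  powers.\<close>

lemma zeta1_three_four_one:
  assumes "\<sigma> > 1"
  shows "cmod (zeta1 (Complex \<sigma> 0)) ^ 3 * cmod (zeta1 (Complex \<sigma> \<tau>)) ^ 4 * cmod (zeta1 (Complex \<sigma> (2*\<tau>)))
     \<ge> (\<sigma> - 1) ^ 3 * (\<bar>\<tau>\<bar> ^ 4 * \<bar>2 * \<tau>\<bar> * exp (-8 * (4 * (\<Sum>n. real n powr (-2)))))"
proof -
  define C where "C = 4 * (\<Sum>n. real n powr (-2))"
  have z: "cmod (zeta1 (Complex \<sigma> u)) = cmod (Complex (\<sigma> - 1) u) * exp (Re (prime_sum one (Complex \<sigma> u)) + Re (prime_power_sum one (Complex \<sigma> u)))" for u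
  proof -
    have "zeta1 (Complex \<sigma> u) = Complex (\<sigma> - 1) u * exp (prime_sum one (Complex \<sigma> u) + prime_power_sum one (Complex \<sigma> u))"
      using zeta1_eq[of "Complex \<sigma> u"] euler_product[OF comp_mult_one, of "Complex \<sigma> u"] assms
      by (simp add: complex_eq_iff)
    then show ?thesis by (simp add: norm_mult)
  qed
  have H: "Re (prime_power_sum one (Complex \<sigma> u)) \<ge> -C" for u
    using prime_power_sum_bound(2)[OF comp_mult_one, of 1 "Complex \<sigma> u"] assms
      abs_Re_le_cmod[of "prime_power_sum one (Complex \<sigma> u)"] unfolding C_def by simp
  let ?P = "\<lambda>u. Re (prime_sum one (Complex \<sigma> u))"
  let ?H = "\<lambda>u. Re (prime_power_sum one (Complex \<sigma> u))"
  have "exp (-8 * C) \<le> exp ((3 * ?P 0 + 4 * ?P \<tau> + ?P (2*\<tau>)) + (3 * ?H 0 + 4 * ?H \<tau> + ?H (2*\<tau>)))"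
    using three_four_one[OF assms, of \<tau>] H[of 0] H[of \<tau>] H[of "2*\<tau>"] by simp
  also have "\<dots> = exp (?P 0 + ?H 0) ^ 3 * exp (?P \<tau> + ?H \<tau>) ^ 4 * exp (?P (2*\<tau>) + ?H (2*\<tau>))"
    by (simp add: exp_add[symmetric] exp_of_nat_mult[symmetric] algebra_simps)
  finally have e: "exp (-8 * C) \<le> exp (?P 0 + ?H 0) ^ 3 * exp (?P \<tau> + ?H \<tau>) ^ 4 * exp (?P (2*\<tau>) + ?H (2*\<tau>))" .
  have c: "cmod (Complex (\<sigma> - 1) u) \<ge> \<bar>u\<bar>" for u using abs_Im_le_cmod[of "Complex (\<sigma> - 1) u"] by simp
  have c0: "cmod (Complex (\<sigma> - 1) 0) = \<sigma> - 1" using assms by (simp add: cmod_def)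
  have "(\<sigma> - 1) ^ 3 * (\<bar>\<tau>\<bar> ^ 4 * \<bar>2 * \<tau>\<bar> * exp (-8 * C)) \<le>
      (\<sigma> - 1) ^ 3 * (cmod (Complex (\<sigma> - 1) \<tau>) ^ 4 * cmod (Complex (\<sigma> - 1) (2*\<tau>)) * (exp (?P 0 + ?H 0) ^ 3 * exp (?P \<tau> + ?H \<tau>) ^ 4 * exp (?P (2*\<tau>) + ?H (2*\<tau>))))"
    using c[of \<tau>] c[of "2*\<tau>"] assms
    by (intro mult_left_mono[OF mult_mono[OF mult_mono[OF power_mono] e]]) auto
  also have "\<dots> = cmod (zeta1 (Complex \<sigma> 0)) ^ 3 * cmod (zeta1 (Complex \<sigma> \<tau>)) ^ 4 * cmod (zeta1 (Complex \<sigma> (2*\<tau>)))"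
    unfolding z c0 power_mult_distrib by (simp only: mult_ac)
  finally show ?thesis unfolding C_def by simp
qed

lemma cancel_cube_aux:
  fixes e x y z :: real
  assumes "e > 0"
  shows "x ^ 3 * y ^ 4 * z = e ^ 3 * (x ^ 3 * (y / e) ^ 4 * e * z)"
proof -
  have "e ^ 4 = e ^ 3 * e" by (simp add: power3_eq_cube power4_eq_xxxx)
  then show ?thesis using assms by (simp add: power_divide)
qed

text \<open>A zero at 1 + i\<tau> would make the fourth power O((\<sigma> - 1)^4) while the other
  factors stay bounded, against a lower bound of order (\<sigma> - 1)^3.\<close>

lemma zeta1_nonzero_line_1:
  assumes "\<tau> \<noteq> 0"
  shows "zeta1 (Complex 1 \<tau>) \<noteq> 0"
proof
  assume 0: "zeta1 (Complex 1 \<tau>) = 0"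
  have ev: "\<forall>\<^sub>F \<sigma> in at_right 1. \<sigma> > (1::real)" by (simp add: eventually_at_right_less)
  have dif: "zeta1 field_differentiable at w" if "Re w > 0" for w
    using zeta1_holomorphic open_halfspace_Re_gt[of 0] that holomorphic_on_imp_differentiable_at by blast
  have ct: "((\<lambda>\<sigma>. Complex \<sigma> u) \<longlongrightarrow> Complex 1 u) (at_right 1)" for u
    by (intro tendsto_Complex tendsto_intros)
  have l: "((\<lambda>\<sigma>. zeta1 (Complex \<sigma> u)) \<longlongrightarrow> zeta1 (Complex 1 u)) (at_right 1)" for u
    using dif[of "Complex 1 u"] by (intro isCont_tendsto_compose[OF field_differentiable_imp_continuous_at ct]) auto
  obtain D where "(zeta1 has_field_derivative D) (at (Complex 1 \<tau>))"
    using dif[of "Complex 1 \<tau>"] by (auto simp: field_differentiable_def)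
  then have "((\<lambda>y. (zeta1 y - zeta1 (Complex 1 \<tau>)) / (y - Complex 1 \<tau>)) \<longlongrightarrow> D) (at (Complex 1 \<tau>))"
    by (simp add: has_field_derivative_iff)
  moreover have "filterlim (\<lambda>\<sigma>. Complex \<sigma> \<tau>) (at (Complex 1 \<tau>)) (at_right 1)"
    unfolding filterlim_at by (intro conjI ct eventually_mono[OF ev]) (auto simp: complex_eq_iff)
  ultimately have "((\<lambda>\<sigma>. (zeta1 (Complex \<sigma> \<tau>) - zeta1 (Complex 1 \<tau>)) / (Complex \<sigma> \<tau> - Complex 1 \<tau>)) \<longlongrightarrow> D) (at_right 1)"
    by (rule filterlim_compose)
  moreover have "Complex \<sigma> \<tau> - Complex 1 \<tau> = of_real (\<sigma> - 1)" for \<sigma> by (simp add: complex_eq_iff)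
  ultimately have d: "((\<lambda>\<sigma>. zeta1 (Complex \<sigma> \<tau>) / of_real (\<sigma> - 1)) \<longlongrightarrow> D) (at_right 1)"
    by (simp add: 0)
  let ?g = "\<lambda>\<sigma>. cmod (zeta1 (Complex \<sigma> 0)) ^ 3 * cmod (zeta1 (Complex \<sigma> \<tau>) / of_real (\<sigma> - 1)) ^ 4 * (\<sigma> - 1) * cmod (zeta1 (Complex \<sigma> (2*\<tau>)))"
  have lim: "(?g \<longlongrightarrow> cmod (zeta1 (Complex 1 0)) ^ 3 * cmod D ^ 4 * (1 - 1) * cmod (zeta1 (Complex 1 (2*\<tau>)))) (at_right 1)"
    by (intro tendsto_intros l d)
  define c where "c = \<bar>\<tau>\<bar> ^ 4 * \<bar>2 * \<tau>\<bar> * exp (-8 * (4 * (\<Sum>n. real n powr (-2))))"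
  have "c > 0" using assms by (simp add: c_def)
  have "\<forall>\<^sub>F \<sigma> in at_right 1. c \<le> ?g \<sigma>"
    using ev
  proof eventually_elim
    case (elim \<sigma>)
    have "(\<sigma> - 1) ^ 3 * c \<le> cmod (zeta1 (Complex \<sigma> 0)) ^ 3 * cmod (zeta1 (Complex \<sigma> \<tau>)) ^ 4 * cmod (zeta1 (Complex \<sigma> (2*\<tau>)))"
      using zeta1_three_four_one[OF elim, of \<tau>] unfolding c_def by simp
    also have "\<dots> = (\<sigma> - 1) ^ 3 * ?g \<sigma>"
    proof -
      have "cmod (zeta1 (Complex \<sigma> \<tau>) / of_real (\<sigma> - 1)) = cmod (zeta1 (Complex \<sigma> \<tau>)) / (\<sigma> - 1)"
        using elim by (simp add: norm_divide norm_of_real del: of_real_diff)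
      then show ?thesis by (simp only:) (rule cancel_cube_aux, use elim in simp)
    qed
    finally show ?case using elim by (simp add: mult_le_cancel_left)
  qed
  then have "c \<le> cmod (zeta1 (Complex 1 0)) ^ 3 * cmod D ^ 4 * (1 - 1) * cmod (zeta1 (Complex 1 (2*\<tau>)))"
    by (intro tendsto_lowerbound[OF lim]) auto
  then show False using \<open>c > 0\<close> by simp
qed

text \<open>\<open>GRH\<close> speaks of zeta only inside the strip. To its right the Euler product
  decides, on its edge the three-four-one argument, and at w = 1 the value is 1.\<close>

lemma zeta1_nonzero:
  assumes "GRH" "Re w > 1/2"
  shows "zeta1 w \<noteq> 0"
proof -
  consider "Re w > 1" | "Re w < 1" | "w = 1" | "Re w = 1" "Im w \<noteq> 0"
    by (metis Im_complex_of_real Re_complex_of_real complex_eqI linorder_neqE_linordered_idom of_real_1)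
  then show ?thesis
  proof cases
    case 1
    then have "w \<noteq> 1" by auto
    then show ?thesis using zeta1_eq[OF 1] euler_product[OF comp_mult_one 1] by simp
  next
    case 2
    then have "eta_fun w \<noteq> 0" "w \<noteq> 1" using assms unfolding GRH_def by auto
    then show ?thesis using eta_zeta1[of w] assms by auto
  next
    case 3
    have "zeta_term n 1 = 0" for n unfolding zeta_term_def by (simp del: of_nat_Suc)
    then show ?thesis using 3 by (simp add: zeta1_def)
  next
    case 4
    then show ?thesis using zeta1_nonzero_line_1[of "Im w"] by (metis complex.collapse)
  qed
qed

subsection \<open>Logarithms of L-functions under GRH\<close>

text \<open>A one-sided bound for the real part controls the whole function: composing with a
  Moebius map gives a self-map of the disc that fixes 0, and Schwarz's lemma applies.\<close>

lemma borel_caratheodory: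
  assumes hol: "f holomorphic_on ball c R" and re: "\<And>z. z \<in> ball c R \<Longrightarrow> Re (f z) < A"
    and r: "dist c z \<le> r" "r < R"
  shows "cmod (f z - f c) \<le> 2 * r / (R - r) * (A - Re (f c))"
proof -
  have r0: "r \<ge> 0" using r zero_le_dist order_trans by blast
  then have R: "R > 0" using r by linarith
  define B where "B = A - Re (f c)"
  have B: "B > 0" using re[of c] R by (simp add: B_def)
  define g where "g u = f (c + of_real R * u) - f c" for u
  \<comment> \<open>The Moebius map z / (2B - z) sends the half plane Re z < B into the unit disc
    and 0 to 0.\<close>
  define \<phi> where "\<phi> u = g u / (2 * of_real B - g u)" for u
  have im: "c + of_real R * u \<in> ball c R" if "cmod u < 1" for u
    using that R by (simp add: dist_norm norm_mult)
  have reg: "Re (g u) < B" if "cmod u < 1" for u using re[OF im[OF that]] by (simp add: g_def B_def)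
  have nz: "2 * of_real B - g u \<noteq> 0" if "cmod u < 1" for u
  proof
    assume "2 * of_real B - g u = 0"
    then have "Re (2 * of_real B - g u) = 0" by simp
    then show False using reg[OF that] B by simp
  qed
  have g: "g holomorphic_on ball 0 1"
    unfolding g_def
    by (intro holomorphic_intros holomorphic_on_compose_gen[OF _ hol, unfolded o_def]) (use im in \<open>auto\<close>)
  have phi: "\<phi> holomorphic_on ball 0 1"
    unfolding \<phi>_def by (intro holomorphic_intros g) (use nz in auto)
  have lt: "cmod (\<phi> u) < 1" if "cmod u < 1" for u
  proof -
    have "cmod (g u) ^ 2 < cmod (2 * of_real B - g u) ^ 2"
      using reg[OF that] B unfolding cmod_power2 by (simp add: power2_eq_square algebra_simps)
    then have "cmod (g u) < cmod (2 * of_real B - g u)" by (rule power_less_imp_less_base) simp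
    then show ?thesis unfolding \<phi>_def norm_divide by (simp add: divide_less_eq_1)
  qed
  define u where "u = (z - c) / of_real R"
  have cu: "cmod u \<le> r / R" using r R by (simp add: u_def norm_divide dist_norm norm_minus_commute divide_right_mono)
  moreover have "r / R < 1" using r R by simp
  ultimately have u1: "cmod u < 1" by linarith
  have le: "cmod (\<phi> u) \<le> cmod u"
    using Schwarz_Lemma(1)[OF phi _ lt u1] by (simp add: \<phi>_def g_def)
  have "\<phi> u * (2 * of_real B - g u) = g u" using nz[OF u1] by (simp add: \<phi>_def)
  then have gu: "g u = \<phi> u * (2 * of_real B - g u)" by simp
  have "cmod (g u) \<le> cmod u * (2 * B + cmod (g u))"
  proof -
    have "cmod (g u) = cmod (\<phi> u) * cmod (2 * of_real B - g u)" by (subst gu) (simp add: norm_mult)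
    also have "cmod (2 * of_real B - g u) \<le> 2 * B + cmod (g u)"
      using norm_triangle_ineq4[of "2 * of_real B" "g u"] B by (simp add: norm_mult)
    finally show ?thesis using le mult_mono[OF le order.refl, of "2 * B + cmod (g u)"] B
      by (smt (verit, ccfv_SIG) mult_left_mono norm_ge_zero)
  qed
  also have "\<dots> \<le> r / R * (2 * B + cmod (g u))" using cu B by (intro mult_right_mono) auto
  finally have "R * cmod (g u) \<le> r * (2 * B + cmod (g u))" using R by (simp add: field_simps)
  then have "cmod (g u) \<le> 2 * r / (R - r) * B" using r by (simp add: field_simps)
  moreover have "g u = f z - f c" using R by (simp add: g_def u_def)
  ultimately show ?thesis by (simp add: B_def)
qed

lemma convex_halfplane_holomorphic_log:
  assumes "f holomorphic_on {w. Re w > \<alpha>}" "\<And>w. Re w > \<alpha> \<Longrightarrow> f w \<noteq> 0"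
  obtains g where "g holomorphic_on {w. Re w > \<alpha>}" "\<And>w. Re w > \<alpha> \<Longrightarrow> f w = exp (g w)"
proof -
  have "contractible {w::complex. Re w > \<alpha>}" by (intro convex_imp_contractible convex_halfspace_Re_gt)
  from contractible_imp_holomorphic_log[OF assms(1) this] assms(2) that show ?thesis by auto
qed

text \<open>A logarithm of L with the higher prime powers removed, normalised to be the series over
  primes for Re w > 1. The normalisation allows the Dirichlet series to be inserted on a far right
  contour.\<close>

definition log_branch :: "(nat \<Rightarrow> complex) \<Rightarrow> (complex \<Rightarrow> complex) \<Rightarrow> bool" where
  "log_branch chi G \<longleftrightarrow> G holomorphic_on {w. Re w > 1/2} \<and>
     (\<forall>w. Re w > 1/2 \<longrightarrow> Lfun chi w = exp (G w + prime_power_sum chi w)) \<and>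
     (\<forall>w. Re w > 1 \<longrightarrow> G w = prime_sum chi w)"

text \<open>On Re w > 1 an arbitrary logarithm differs from the Euler product's by a continuous
  function with values in 2\<pi>i times the integers, hence by a constant, which is subtracted
  everywhere.\<close>

lemma log_branch_exists:
  assumes "GRH" "dirichlet_char q chi" "\<not> principal_char q chi"
  shows "\<exists>G. log_branch chi G"
proof -
  note cm = dirichlet_char_comp_mult[OF assms(2)]
  let ?S = "{w::complex. Re w > 1/2}" and ?S1 = "{w::complex. Re w > 1}"
  have L: "Lfun chi holomorphic_on ?S"
    using Lfun_holomorphic[OF dirichlet_char_bounded_sums[OF assms(2,3)]] by (rule holomorphic_on_subset) auto
  have nz: "Lfun chi w \<noteq> 0" if "Re w > 1/2" for w using assms that unfolding GRH_def by blast
  obtain g where g: "g holomorphic_on ?S" "\<And>w. Re w > 1/2 \<Longrightarrow> Lfun chi w = exp (g w)"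
    using convex_halfplane_holomorphic_log[OF L nz] by blast
  define h where "h w = g w - (prime_sum chi w + prime_power_sum chi w)" for w
  have eh: "exp (h w) = 1" if "Re w > 1" for w
    using g(2)[of w] euler_product[OF cm that] Lfun_eq_dseries[OF cm that] that
    by (simp add: h_def exp_diff)
  have "h holomorphic_on ?S1"
    unfolding h_def by (intro holomorphic_intros prime_sum_holomorphic[OF cm]
      holomorphic_on_subset[OF g(1)] holomorphic_on_subset[OF prime_power_sum_holomorphic[OF cm]]) auto
  then have "h constant_on ?S1"
  proof (intro continuous_discrete_range_constant)
    show "connected ?S1" by (intro convex_connected convex_halfspace_Re_gt)
    show "continuous_on ?S1 h" using \<open>h holomorphic_on ?S1\<close> by (rule holomorphic_on_imp_continuous_on)
    fix x assume x: "x \<in> ?S1"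
    \<comment> \<open>Distinct values of \<open>h\<close> differ by a nonzero multiple of
      2\<pi>i.\<close>
    show "\<exists>e>0. \<forall>y. y \<in> ?S1 \<and> h y \<noteq> h x \<longrightarrow> e \<le> cmod (h y - h x)"
    proof (intro exI[of _ "2*pi"] conjI allI impI)
      fix y assume y: "y \<in> ?S1 \<and> h y \<noteq> h x"
      have "exp (h y - h x) = 1" using eh[of y] eh[of x] x y by (simp add: exp_diff)
      then obtain n where n: "Re (h y - h x) = 0" "Im (h y - h x) = of_int (2 * n) * pi"
        unfolding exp_eq_1 by blast
      have "n \<noteq> 0"
      proof
        assume "n = 0"
        then have "h y - h x = 0" using n by (simp add: complex_eq_iff)
        then show False using y by simp
      qed
      then have "\<bar>real_of_int n\<bar> \<ge> 1" by linarith
      then have "2 * pi \<le> \<bar>Im (h y - h x)\<bar>" unfolding n by (simp add: abs_mult)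
      then show "2 * pi \<le> cmod (h y - h x)" using abs_Im_le_cmod order_trans by blast
    qed simp
  qed
  then obtain k where k: "\<And>w. Re w > 1 \<Longrightarrow> h w = k" by (auto simp: constant_on_def)
  have ek: "exp k = 1" using eh[of 2] k[of 2] by simp
  define G where "G w = g w - prime_power_sum chi w - k" for w
  have "log_branch chi G"
    unfolding log_branch_def
  proof (intro conjI allI impI)
    show "G holomorphic_on ?S" unfolding G_def by (intro holomorphic_intros g prime_power_sum_holomorphic[OF cm])
    show "Lfun chi w = exp (G w + prime_power_sum chi w)" if "Re w > 1/2" for w
      using g(2)[OF that] ek by (simp add: G_def exp_diff)
    show "G w = prime_sum chi w" if "Re w > 1" for w
      using k[OF that] by (auto simp: G_def h_def diff_eq_eq add_ac)
  qed
  then show ?thesis by blast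
qed

lemma nonprincipal_modulus_ge_3:
  assumes "dirichlet_char q chi" "\<not> principal_char q chi"
  shows "q \<ge> 3"
proof (rule ccontr)
  assume "\<not> q \<ge> 3"
  moreover have "q > 0" using assms by (simp add: dirichlet_char_def)
  ultimately have q: "q = 1 \<or> q = 2" by linarith
  have "chi n = 1" if "coprime n q" for n
  proof -
    have "[n = 1] (mod q)" using q that by (auto simp: cong_def odd_iff_mod_2_eq_one)
    then show ?thesis using dirichlet_char_cong[OF assms(1)] assms(1) unfolding dirichlet_char_def by metis
  qed
  then show False using assms(2) by (simp add: principal_char_def)
qed

text \<open>Lets additive constants be absorbed into multiples of log q; 3 is the least modulus with
  a nonprincipal character, and e < 3.\<close>

lemma ln_modulus_ge_1:
  assumes "dirichlet_char q chi" "\<not> principal_char q chi"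
  shows "ln (real q) \<ge> 1"
proof -
  have "exp (1::real) \<le> 3" using exp_le by simp
  also have "\<dots> \<le> real q" using nonprincipal_modulus_ge_3[OF assms] by simp
  finally show ?thesis using nonprincipal_modulus_ge_3[OF assms] by (subst ln_ge_iff) auto
qed

text \<open>Borel and Caratheodory on the disc about 2 + i Im w of radius 3/2, which just reaches
  the line Re = 1/2. Under GRH log L is holomorphic there, its real part is bounded by the trivial
  bound for |L|, and at the centre it is O(1).\<close>

lemma log_branch_bound:
  assumes "\<sigma>0 > 1/2"
  shows "\<exists>K>0. \<forall>q chi G w. dirichlet_char q chi \<and> \<not> principal_char q chi \<and> log_branch chi G \<and> Re w \<ge> \<sigma>0
     \<longrightarrow> cmod (G w) \<le> K * ln (real q) * (1 + \<bar>Im w\<bar>)"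
proof -
  \<comment> \<open>Capping at 1 keeps the radius 2 - \<sigma>1 positive and the centre inside the
    region of the prime power bound.\<close>
  define \<sigma>1 where "\<sigma>1 = min \<sigma>0 1"
  have s1: "\<sigma>1 > 1/2" "\<sigma>1 \<le> \<sigma>0" "\<sigma>1 \<le> 1" using assms by (auto simp: \<sigma>1_def)
  define Z where "Z = (\<Sum>n. real (Suc n) powr (-(1/2) - 1))"
  define C1 where "C1 = (\<Sum>n. real n powr (-2))"
  define C2 where "C2 = 4 * (\<Sum>n. real n powr (-2*\<sigma>1))"
  have Z0: "Z \<ge> 0" unfolding Z_def by (intro suminf_nonneg summable_Suc_powr) auto
  have C1: "C1 \<ge> 0" unfolding C1_def by (intro suminf_nonneg) (auto simp: summable_real_powr_iff)
  have C2: "C2 \<ge> 0" unfolding C2_def using s1 by (intro mult_nonneg_nonneg suminf_nonneg) (auto simp: summable_real_powr_iff)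
  define D where "D = 6 + ln (Z + 1) + C1 + C2"
  define K where "K = 3 / (\<sigma>1 - 1/2) * D + C1 + 2 * C2 + 1"
  have D0: "D \<ge> 0" unfolding D_def using Z0 C1 C2 by simp
  have s3: "3 / (\<sigma>1 - 1/2) \<ge> 0" using s1 by simp
  have K0: "K > 0" unfolding K_def using D0 s3 C1 C2 mult_nonneg_nonneg[OF s3 D0] by linarith
  show ?thesis
  proof (intro exI[of _ K] conjI K0 allI impI)
    fix q chi G w
    assume as: "dirichlet_char q chi \<and> \<not> principal_char q chi \<and> log_branch chi G \<and> Re w \<ge> \<sigma>0"
    then have ch: "dirichlet_char q chi" "\<not> principal_char q chi" and lb: "log_branch chi G" and w: "Re w \<ge> \<sigma>1" using s1 by auto
    note cm = dirichlet_char_comp_mult[OF ch(1)]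
    have lq: "ln (real q) \<ge> 1" by (rule ln_modulus_ge_1[OF ch])
    have qpos: "real q \<ge> 3" using nonprincipal_modulus_ge_3[OF ch] by simp
    define \<tau> where "\<tau> = Im w"
    define c where "c = Complex 2 \<tau>"
    define L where "L = ln (real q) * (1 + \<bar>\<tau>\<bar>)"
    have L1: "L \<ge> 1" unfolding L_def using mult_mono[of 1 "ln (real q)" 1 "1 + \<bar>\<tau>\<bar>"] lq by simp
    have P: "cmod (G v) \<le> C1" if "Re v \<ge> 2" for v
      using prime_sum_bound(2)[OF cm that] lb that unfolding log_branch_def C1_def by simp
    have H: "cmod (prime_power_sum chi v) \<le> C2" if "Re v \<ge> \<sigma>1" for v
      using prime_power_sum_bound(2)[OF cm that s1(1)] unfolding C2_def .
    show "cmod (G w) \<le> K * ln (real q) * (1 + \<bar>Im w\<bar>)"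
    proof (cases "Re w \<ge> 2")
      case True
      have "K * 1 \<le> K * L" using K0 L1 by (intro mult_left_mono) auto
      moreover have "C1 \<le> K" unfolding K_def using mult_nonneg_nonneg[OF s3 D0] C2 by linarith
      ultimately show ?thesis using P[OF True] unfolding L_def \<tau>_def by (simp add: mult.assoc)
    next
      case False
      define g where "g v = G v + prime_power_sum chi v" for v
      \<comment> \<open>Bounds log |L| on the disc; 5 + |\<tau>| replaces its own logarithm, since
        linear growth in |\<tau>| is harmless.\<close>
      define A where "A = ln (real q) + (5 + \<bar>\<tau>\<bar>) + ln (Z + 1)"
      have ball: "Re v > 1/2 \<and> cmod v \<le> 5 + \<bar>\<tau>\<bar>" if "v \<in> ball c (3/2)" for v
      proof -
        have d: "cmod (v - c) < 3/2" using that by (simp add: dist_norm norm_minus_commute)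
        then have "\<bar>Re v - 2\<bar> < 3/2" "\<bar>Im v - \<tau>\<bar> < 3/2"
          using abs_Re_le_cmod[of "v - c"] abs_Im_le_cmod[of "v - c"] by (auto simp: c_def)
        moreover from this have "cmod v \<le> \<bar>Re v\<bar> + \<bar>Im v\<bar>" by (intro cmod_le)
        ultimately show ?thesis by linarith
      qed
      have gh: "g holomorphic_on ball c (3/2)"
        unfolding g_def using lb ball
        by (intro holomorphic_intros holomorphic_on_subset[OF prime_power_sum_holomorphic[OF cm]])
           (auto simp: log_branch_def elim!: holomorphic_on_subset)
      have re: "Re (g v) < A" if v: "v \<in> ball c (3/2)" for v
      proof -
        have v2: "Re v > 1/2" "cmod v \<le> 5 + \<bar>\<tau>\<bar>" using ball[OF v] by auto
        have "Lfun chi v = exp (g v)" using lb v2 unfolding log_branch_def g_def by simp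
        then have "exp (Re (g v)) = cmod (Lfun chi v)" by simp
        also have "\<dots> \<le> real q * cmod v * Z"
          using Lfun_bound[OF dirichlet_char_bounded_sums[OF ch], of "1/2" v] v2 unfolding Z_def by simp
        also have "\<dots> \<le> real q * (5 + \<bar>\<tau>\<bar>) * Z" using v2 Z0 by (intro mult_right_mono mult_left_mono) auto
        also have "\<dots> < real q * (5 + \<bar>\<tau>\<bar>) * (Z + 1)" using qpos by (intro mult_strict_left_mono) auto
        also have "\<dots> \<le> exp (ln (real q)) * exp (5 + \<bar>\<tau>\<bar>) * exp (ln (Z + 1))"
        proof -
          have "5 + \<bar>\<tau>\<bar> \<le> exp (5 + \<bar>\<tau>\<bar>)" using exp_ge_add_one_self[of "5 + \<bar>\<tau>\<bar>"] by linarith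
          then show ?thesis using qpos Z0 by (intro mult_mono) auto
        qed
        also have "\<dots> = exp A" by (simp add: A_def exp_add)
        finally show ?thesis by simp
      qed
      have rc: "cmod (g c) \<le> C1 + C2"
        unfolding g_def using P[of c] H[of c] s1 by (intro order_trans[OF norm_triangle_ineq]) (auto simp: c_def)
      have "w - c = of_real (Re w - 2)" by (simp add: complex_eq_iff c_def \<tau>_def)
      then have "dist c w = \<bar>Re w - 2\<bar>" by (metis dist_commute dist_norm norm_of_real)
      then have dw: "dist c w \<le> 2 - \<sigma>1" using w False by simp
      have "cmod (g w - g c) \<le> 2 * (2 - \<sigma>1) / (3/2 - (2 - \<sigma>1)) * (A - Re (g c))"
        by (rule borel_caratheodory[OF gh re dw]) (use s1 in auto)
      also have "\<dots> \<le> 3 / (\<sigma>1 - 1/2) * (D * L)"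
      proof (rule mult_mono)
        show "2 * (2 - \<sigma>1) / (3/2 - (2 - \<sigma>1)) \<le> 3 / (\<sigma>1 - 1/2)" using s1 by (intro frac_le) auto
        have "A - Re (g c) \<le> ln (real q) + \<bar>\<tau>\<bar> + (D - 1)"
          using abs_Re_le_cmod[of "g c"] rc unfolding A_def D_def by linarith
        also have "\<dots> \<le> L + (D - 1) * L"
        proof -
          have "ln (real q) + \<bar>\<tau>\<bar> \<le> L" unfolding L_def using mult_right_mono[OF lq, of "\<bar>\<tau>\<bar>"] by (simp add: algebra_simps)
          moreover have "D \<ge> 1" unfolding D_def using Z0 C1 C2 by simp
          then have "D - 1 \<le> (D - 1) * L" using mult_left_mono[OF L1, of "D - 1"] by simp
          ultimately show ?thesis by (rule add_mono)
        qed
        finally show "A - Re (g c) \<le> D * L" by (simp add: algebra_simps)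
        show "A - Re (g c) \<ge> 0" using re[of c] by simp
      qed (use s3 in auto)
      also have "\<dots> = 3 / (\<sigma>1 - 1/2) * D * L" by (simp only: mult.assoc)
      finally have 1: "cmod (g w - g c) \<le> 3 / (\<sigma>1 - 1/2) * D * L" .
      define X where "X = 3 / (\<sigma>1 - 1/2) * D * L"
      have "G w = (g w - g c) + g c - prime_power_sum chi w" by (simp add: g_def)
      then have "cmod (G w) \<le> cmod (g w - g c) + cmod (g c) + cmod (prime_power_sum chi w)"
        by (metis add_right_mono norm_triangle_ineq norm_triangle_ineq4 order_trans)
      also have "\<dots> \<le> X + (C1 + C2) + C2" by (intro add_mono 1[folded X_def] rc H[OF w])
      also have "\<dots> \<le> X + (C1 + 2 * C2 + 1) * 1" by simp
      also have "\<dots> \<le> X + (C1 + 2 * C2 + 1) * L"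
        using L1 C1 C2 by (intro add_left_mono mult_left_mono) auto
      also have "\<dots> = K * L" unfolding K_def X_def by (simp only: distrib_right add.assoc)
      finally show ?thesis unfolding L_def \<tau>_def by (simp add: mult.assoc)
    qed
  qed
qed

text \<open>Termwise differentiation supplies the weights ln p under which sums over primes are
  asymptotically a plain integral.\<close>

lemma deriv_prime_sum_one:
  assumes "Re w > 1"
  shows "(\<lambda>p. if prime p then of_real (ln (real p)) * dterm one w p else 0) sums (- deriv (prime_sum one) w)"
proof -
  let ?S = "{w::complex. Re w > 1}"
  let ?f = "\<lambda>p w. if prime p then dterm one w p else 0"
  let ?f' = "\<lambda>p w. if prime p then - of_real (ln (real p)) * dterm one w p else 0"
  have "\<exists>g g'. \<forall>x\<in>?S. (\<lambda>n. ?f n x) sums g x \<and> (\<lambda>n. ?f' n x) sums g' x \<and> (g has_field_derivative g' x) (at x)"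
  proof (rule series_and_derivative_comparison_local)
    show "open ?S" by (rule open_halfspace_Re_gt)
    show "(?f n has_field_derivative ?f' n x) (at x)" for n x
    proof (cases "prime n")
      case True
      then have n: "n > 0" by (rule prime_gt_0_nat)
      have "((\<lambda>w. of_nat n powr (-w) :: complex) has_field_derivative - of_real (ln (real n)) * of_nat n powr (-x)) (at x)"
      proof -
        have "of_nat n powr (-w) = exp (- w * of_real (ln (real n)))" for w :: complex
          using n by (simp add: powr_def Ln_of_nat)
        then show ?thesis by (auto intro!: derivative_eq_intros)
      qed
      then show ?thesis using True by (simp add: dterm_def)
    qed simp
    fix x assume x: "x \<in> ?S"
    define d where "d = (Re x - 1) / 2"
    have d: "d > 0" using x by (simp add: d_def)
    have "\<forall>y\<in>ball x d \<inter> ?S. cmod (?f n y) \<le> real n powr (-(1 + d))" for n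
    proof
      fix y assume "y \<in> ball x d \<inter> ?S"
      then have "cmod (x - y) < d" by (simp add: dist_norm)
      moreover have "\<bar>Re x - Re y\<bar> \<le> cmod (x - y)" using abs_Re_le_cmod[of "x - y"] by simp
      moreover have "Re x = 1 + 2 * d" by (simp add: d_def field_simps)
      ultimately have "Re y \<ge> 1 + d" by linarith
      then show "cmod (?f n y) \<le> real n powr (-(1 + d))" by (rule prime_dterm_bound[OF comp_mult_one])
    qed
    moreover have "summable (\<lambda>n. real n powr (-(1 + d)))" using d by (simp add: summable_real_powr_iff)
    ultimately show "\<exists>d h. 0 < d \<and> summable h \<and> (\<forall>\<^sub>F n in sequentially. \<forall>y\<in>ball x d \<inter> ?S. norm (?f n y) \<le> h n)"
      using d by (intro exI[of _ d] exI[of _ "\<lambda>n. real n powr (-(1 + d))"]) simp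
  qed
  then obtain g g' where g: "\<And>x. x \<in> ?S \<Longrightarrow> (\<lambda>n. ?f n x) sums g x \<and> (\<lambda>n. ?f' n x) sums g' x \<and> (g has_field_derivative g' x) (at x)"
    by blast
  have eq: "prime_sum one x = g x" if "x \<in> ?S" for x
    unfolding prime_sum_def using g[OF that] sums_unique by metis
  have "(prime_sum one has_field_derivative g' w) (at w)"
  proof (rule has_field_derivative_transform_within_open)
    show "(g has_field_derivative g' w) (at w)" using g assms by simp
    show "open ?S" by (rule open_halfspace_Re_gt)
  qed (use assms eq in auto)
  then have "deriv (prime_sum one) w = g' w" by (rule DERIV_imp_deriv)
  moreover have "(\<lambda>n. - ?f' n w) sums - g' w" using g[of w] assms by (intro sums_minus) simp
  ultimately show ?thesis by (simp add: if_distrib[of uminus] cong: if_cong)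
qed

text \<open>The function below continues \<open>1/(w - 1) - \<Sum>\<^sub>p (ln p) p\<^sup>-\<^sup>w\<close>, the logarithmic derivative of
  \<open>(w - 1) \<zeta>(w)\<close> without its prime powers, to the half plane of the Riemann hypothesis.\<close>

lemma zeta_log_derivative:
  assumes "GRH" "1/2 < \<sigma>0" "\<sigma>0 \<le> 1"
  shows "\<exists>F M. F holomorphic_on {w. Re w > 1/2} \<and>
    (\<forall>w. Re w > 1 \<longrightarrow> F w = 1 / (w - 1) + deriv (prime_sum one) w) \<and>
    (\<forall>w. \<sigma>0 \<le> Re w \<and> Re w \<le> 2 \<longrightarrow> cmod (F w) \<le> M * exp \<bar>Im w\<bar>)"
proof -
  let ?S = "{w::complex. Re w > 1/2}"
  note cm = comp_mult_one
  have opS: "open ?S" by (rule open_halfspace_Re_gt)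
  have zh: "zeta1 holomorphic_on ?S" using zeta1_holomorphic by (rule holomorphic_on_subset) auto
  obtain g where g: "g holomorphic_on ?S" "\<And>w. Re w > 1/2 \<Longrightarrow> zeta1 w = exp (g w)"
    using convex_halfplane_holomorphic_log[OF zh zeta1_nonzero[OF assms(1)]] by blast
  define G where "G w = g w - prime_power_sum one w" for w
  have Gh: "G holomorphic_on ?S" unfolding G_def by (intro holomorphic_intros g prime_power_sum_holomorphic[OF cm])
  define F where "F = deriv G"
  have Fh: "F holomorphic_on ?S" unfolding F_def by (rule holomorphic_deriv[OF Gh opS])
  have Feq: "F w = 1 / (w - 1) + deriv (prime_sum one) w" if w: "Re w > 1" for w
  proof -
    have w1: "w \<noteq> 1" using w by auto
    let ?Q = "\<lambda>w. prime_sum one w + prime_power_sum one w"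
    have dP: "(prime_sum one has_field_derivative deriv (prime_sum one) w) (at w)"
      using w by (intro holomorphic_derivI[OF prime_sum_holomorphic[OF cm]] open_halfspace_Re_gt) auto
    have dH: "(prime_power_sum one has_field_derivative deriv (prime_power_sum one) w) (at w)"
      using w by (intro holomorphic_derivI[OF prime_power_sum_holomorphic[OF cm]] open_halfspace_Re_gt) auto
    have dg: "(g has_field_derivative deriv g w) (at w)"
      using w by (intro holomorphic_derivI[OF g(1) opS]) auto
    have E: "exp (g v) = (v - 1) * exp (?Q v)" if "Re v > 1" for v
      using g(2)[of v] zeta1_eq[OF that] euler_product[OF cm that] that by simp
    have "((\<lambda>v. (v - 1) * exp (?Q v)) has_field_derivative (exp (?Q w) + (w - 1) * (exp (?Q w) * (deriv (prime_sum one) w + deriv (prime_power_sum one) w)))) (at w)"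
      by (auto intro!: derivative_eq_intros dP dH simp: algebra_simps)
    moreover have "((\<lambda>v. (v - 1) * exp (?Q v)) has_field_derivative (exp (g w) * deriv g w)) (at w)"
    proof (rule has_field_derivative_transform_within_open)
      show "((\<lambda>v. exp (g v)) has_field_derivative (exp (g w) * deriv g w)) (at w)"
        by (auto intro!: derivative_eq_intros dg)
      show "open {v::complex. Re v > 1}" by (rule open_halfspace_Re_gt)
    qed (use w E in auto)
    ultimately have "exp (g w) * deriv g w = exp (?Q w) + (w - 1) * (exp (?Q w) * (deriv (prime_sum one) w + deriv (prime_power_sum one) w))"
      by (rule DERIV_unique[symmetric])
    then have "exp (?Q w) * ((w - 1) * deriv g w) = exp (?Q w) * (1 + (w - 1) * (deriv (prime_sum one) w + deriv (prime_power_sum one) w))"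
    proof -
      have "v * q * d = q + v * (q * D) \<Longrightarrow> q * (v * d) = q * (1 + v * D)" for v q d D :: complex
        by (simp add: algebra_simps)
      then show "exp (g w) * deriv g w = exp (?Q w) + (w - 1) * (exp (?Q w) * (deriv (prime_sum one) w + deriv (prime_power_sum one) w)) \<Longrightarrow> ?thesis"
        unfolding E[OF w] .
    qed
    then have "(w - 1) * deriv g w = 1 + (w - 1) * (deriv (prime_sum one) w + deriv (prime_power_sum one) w)"
      by simp
    then have "deriv g w = 1 / (w - 1) + (deriv (prime_sum one) w + deriv (prime_power_sum one) w)"
      using w1 by (simp add: field_simps)
    moreover have "deriv G w = deriv g w - deriv (prime_power_sum one) w"
      unfolding G_def[abs_def] by (rule DERIV_imp_deriv) (intro derivative_intros dg dH)
    ultimately show ?thesis unfolding F_def by simp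
  qed
  \<comment> \<open>Half the distance to the critical line: a disc of radius \<rho> about w stays in
    Re >= 1/2 + \<rho> and within 3/2 - \<rho> of the centre used below.\<close>
  define \<rho> where "\<rho> = (\<sigma>0 - 1/2) / 2"
  have rho: "\<rho> > 0" "\<rho> \<le> 1/4" using assms by (auto simp: \<rho>_def)
  define Z where "Z = (\<Sum>n. real (Suc n) powr (-(1/2) - 1))"
  define C1 where "C1 = (\<Sum>n. real n powr (-2))"
  define C2 where "C2 = 4 * (\<Sum>n. real n powr (-2*(1/2 + \<rho>)))"
  have Z0: "Z \<ge> 0" unfolding Z_def by (intro suminf_nonneg summable_Suc_powr) auto
  have C1: "C1 \<ge> 0" unfolding C1_def by (intro suminf_nonneg) (auto simp: summable_real_powr_iff)
  have C2: "C2 \<ge> 0" unfolding C2_def using rho by (intro mult_nonneg_nonneg suminf_nonneg) (auto simp: summable_real_powr_iff)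
  define B where "B = 3 / \<rho> * (2 + 60 * Z + C1 + C2) + 2 * C2"
  have Fb: "cmod (F w) \<le> B / \<rho> * exp \<bar>Im w\<bar>" if w: "\<sigma>0 \<le> Re w" "Re w \<le> 2" for w
  proof -
    define \<tau> where "\<tau> = Im w"
    define c where "c = Complex 2 \<tau>"
    have ball: "Re v > 1/2 \<and> cmod v \<le> 5 + \<bar>\<tau>\<bar>" if "v \<in> ball c (3/2)" for v
    proof -
      have d: "cmod (v - c) < 3/2" using that by (simp add: dist_norm norm_minus_commute)
      then have "\<bar>Re v - 2\<bar> < 3/2" "\<bar>Im v - \<tau>\<bar> < 3/2"
        using abs_Re_le_cmod[of "v - c"] abs_Im_le_cmod[of "v - c"] by (auto simp: c_def)
      moreover from this have "cmod v \<le> \<bar>Re v\<bar> + \<bar>Im v\<bar>" by (intro cmod_le)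
      ultimately show ?thesis by linarith
    qed
    \<comment> \<open>Exponential growth suffices, as the Gaussian kernel absorbs it; 60 is large
      enough for 60 exp |\<tau>| to dominate (6 + |\<tau>|)(5 + |\<tau>|).\<close>
    define A where "A = 2 + 60 * Z * exp \<bar>\<tau>\<bar>"
    have gh: "g holomorphic_on ball c (3/2)" using g(1) by (rule holomorphic_on_subset) (use ball in auto)
    have re: "Re (g v) < A" if v: "v \<in> ball c (3/2)" for v
    proof -
      have v2: "Re v > 1/2" "cmod v \<le> 5 + \<bar>\<tau>\<bar>" using ball[OF v] by auto
      have "exp (Re (g v)) = cmod (zeta1 v)" using g(2) v2 by simp
      also have "\<dots> \<le> 1 + cmod (v - 1) * cmod v * Z"
        using zeta1_bound[of "1/2" v] v2 unfolding Z_def by simp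
      also have "\<dots> \<le> 1 + (6 + \<bar>\<tau>\<bar>) * (5 + \<bar>\<tau>\<bar>) * Z"
        using v2 Z0 norm_triangle_ineq4[of v 1] by (intro add_left_mono mult_right_mono mult_mono) auto
      also have "\<dots> \<le> 1 + (60 * exp \<bar>\<tau>\<bar>) * Z"
      proof -
        have "exp \<bar>\<tau>\<bar> \<ge> 1 + \<bar>\<tau>\<bar> + \<bar>\<tau>\<bar>\<^sup>2 / 2" by (rule exp_lower_Taylor_quadratic) simp
        moreover have "(6 + \<bar>\<tau>\<bar>) * (5 + \<bar>\<tau>\<bar>) = 30 + 11 * \<bar>\<tau>\<bar> + \<bar>\<tau>\<bar>\<^sup>2"
          by (simp add: algebra_simps power2_eq_square del: abs_mult_self_eq)
        moreover have "\<bar>\<tau>\<bar> \<ge> 0" "\<bar>\<tau>\<bar>\<^sup>2 \<ge> 0" by simp_all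
        ultimately have "(6 + \<bar>\<tau>\<bar>) * (5 + \<bar>\<tau>\<bar>) \<le> 60 * exp \<bar>\<tau>\<bar>" by linarith
        then show ?thesis using Z0 by (intro add_left_mono mult_right_mono)
      qed
      finally have "exp (Re (g v)) < A" unfolding A_def by (simp add: mult_ac)
      moreover have "Re (g v) < exp (Re (g v))" using exp_ge_add_one_self[of "Re (g v)"] by linarith
      ultimately show ?thesis by linarith
    qed
    have rc: "Re (g c) \<ge> - (C1 + C2)"
    proof -
      have c: "Re c > 1" by (simp add: c_def)
      have "exp (Re (g c)) = cmod (c - 1) * exp (Re (prime_sum one c + prime_power_sum one c))"
      proof -
        have "exp (g c) = (c - 1) * exp (prime_sum one c + prime_power_sum one c)"
          using g(2)[of c] zeta1_eq[OF c] euler_product[OF cm c] c by simp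
        then show ?thesis by (metis norm_exp_eq_Re norm_mult)
      qed
      also have "cmod (c - 1) \<ge> 1" using abs_Re_le_cmod[of "c - 1"] by (simp add: c_def)
      then have "cmod (c - 1) * exp (Re (prime_sum one c + prime_power_sum one c)) \<ge> 1 * exp (Re (prime_sum one c + prime_power_sum one c))"
        by (intro mult_right_mono) auto
      finally have "Re (g c) \<ge> Re (prime_sum one c) + Re (prime_power_sum one c)" by simp
      moreover have "cmod (prime_sum one c) \<le> C1"
        using prime_sum_bound(2)[OF cm, of 2 c] unfolding C1_def by (simp add: c_def)
      moreover have "cmod (prime_power_sum one c) \<le> C2"
        using prime_power_sum_bound(2)[OF cm, of "1/2+\<rho>" c] rho unfolding C2_def by (simp add: c_def)
      ultimately show ?thesis
        using abs_Re_le_cmod[of "prime_sum one c"] abs_Re_le_cmod[of "prime_power_sum one c"] by linarith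
    qed
    have Gb: "cmod (G v - g c) \<le> B * exp \<bar>\<tau>\<bar>" if v: "v \<in> cball w \<rho>" for v
    proof -
      have "w - c = of_real (Re w - 2)" by (simp add: complex_eq_iff c_def \<tau>_def)
      then have "dist c w = \<bar>Re w - 2\<bar>" by (metis dist_commute dist_norm norm_of_real)
      then have dw: "dist c v \<le> 3/2 - \<rho>" using w v dist_triangle[of c v w] by (simp add: \<rho>_def field_simps)
      have "cmod (g v - g c) \<le> 2 * (3/2 - \<rho>) / (3/2 - (3/2 - \<rho>)) * (A - Re (g c))"
        by (rule borel_caratheodory[OF gh re dw]) (use rho in auto)
      also have "\<dots> \<le> 3 / \<rho> * ((2 + 60 * Z + C1 + C2) * exp \<bar>\<tau>\<bar>)"
      proof (rule mult_mono)
        show "2 * (3/2 - \<rho>) / (3/2 - (3/2 - \<rho>)) \<le> 3 / \<rho>" using rho by (intro frac_le) auto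
        have "(2 + C1 + C2) * 1 \<le> (2 + C1 + C2) * exp \<bar>\<tau>\<bar>" using C1 C2 by (intro mult_left_mono) auto
        then have "A + (C1 + C2) \<le> (2 + 60 * Z + C1 + C2) * exp \<bar>\<tau>\<bar>"
          unfolding A_def by (simp add: algebra_simps)
        then show "A - Re (g c) \<le> (2 + 60 * Z + C1 + C2) * exp \<bar>\<tau>\<bar>" using rc by linarith
        show "0 \<le> A - Re (g c)" using re[of c] by simp
      qed (use rho in auto)
      also have "\<dots> = 3 / \<rho> * (2 + 60 * Z + C1 + C2) * exp \<bar>\<tau>\<bar>" by (simp only: mult.assoc)
      finally have 1: "cmod (g v - g c) \<le> 3 / \<rho> * (2 + 60 * Z + C1 + C2) * exp \<bar>\<tau>\<bar>" .
      define X where "X = 3 / \<rho> * (2 + 60 * Z + C1 + C2) * exp \<bar>\<tau>\<bar>"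
      have "cmod (w - v) \<le> \<rho>" using v by (simp add: dist_norm)
      then have "Re v \<ge> 1/2 + \<rho>" using w abs_Re_le_cmod[of "w - v"] by (simp add: \<rho>_def field_simps)
      then have 2: "cmod (prime_power_sum one v) \<le> C2"
        unfolding C2_def by (intro prime_power_sum_bound(2)[OF cm]) (use rho in auto)
      have 3: "C2 * 1 \<le> C2 * exp \<bar>\<tau>\<bar>" using C2 by (intro mult_left_mono) auto
      have "C2 * exp \<bar>\<tau>\<bar> \<ge> 0" using C2 by simp
      have "cmod (G v - g c) \<le> cmod (g v - g c) + cmod (prime_power_sum one v)"
        unfolding G_def using norm_triangle_ineq4[of "g v - g c" "prime_power_sum one v"] by (simp add: algebra_simps)
      also have "\<dots> \<le> X + 2 * C2 * exp \<bar>\<tau>\<bar>"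
        using 1[folded X_def] 2 3 \<open>C2 * exp \<bar>\<tau>\<bar> \<ge> 0\<close> by linarith
      also have "\<dots> = B * exp \<bar>\<tau>\<bar>" unfolding B_def X_def by (simp only: distrib_right)
      finally show ?thesis .
    qed
    have cbS: "cball w \<rho> \<subseteq> ?S"
    proof
      fix v assume "v \<in> cball w \<rho>"
      then have "cmod (w - v) \<le> \<rho>" by (simp add: dist_norm)
      then show "v \<in> ?S" using w rho abs_Re_le_cmod[of "w - v"] assms by (simp add: \<rho>_def field_simps)
    qed
    have hol: "(\<lambda>v. G v - g c) holomorphic_on cball w \<rho>"
      using cbS by (intro holomorphic_intros holomorphic_on_subset[OF Gh])
    \<comment> \<open>Cauchy's inequality passes from the logarithm to its derivative; subtracting
      the constant \<open>g c\<close> makes the Borel-Caratheodory bound applicable.\<close>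
    have "cmod ((deriv ^^ 1) (\<lambda>v. G v - g c) w) \<le> fact 1 * (B * exp \<bar>\<tau>\<bar>) / \<rho> ^ 1"
    proof (rule Cauchy_inequality)
      show "(\<lambda>v. G v - g c) holomorphic_on ball w \<rho>" using hol by (rule holomorphic_on_subset) auto
      show "continuous_on (cball w \<rho>) (\<lambda>v. G v - g c)" by (rule holomorphic_on_imp_continuous_on[OF hol])
      show "cmod (G x - g c) \<le> B * exp \<bar>\<tau>\<bar>" if "cmod (w - x) = \<rho>" for x
        using that by (intro Gb) (simp add: dist_norm)
    qed (rule rho)
    moreover have "deriv (\<lambda>v. G v - g c) w = F w"
      unfolding F_def
    proof (rule DERIV_imp_deriv)
      have "(G has_field_derivative deriv G w) (at w)"
        using w assms by (intro holomorphic_derivI[OF Gh opS]) auto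
      then show "((\<lambda>v. G v - g c) has_field_derivative deriv G w) (at w)" by (auto intro!: derivative_eq_intros)
    qed
    ultimately show ?thesis by (simp add: \<tau>_def field_simps)
  qed
  show ?thesis using Fh Feq Fb by blast
qed

subsection \<open>Vertical line integrals\<close>

text \<open>The common integrable majorant for all vertical line integrals.\<close>

definition inv_sq :: "real \<Rightarrow> real" where "inv_sq v = inverse (1 + v^2)"

lemma inv_sq_pos: "inv_sq v > 0"
  unfolding inv_sq_def by (simp add: add_pos_nonneg)

lemma inv_sq_integrable: "integrable lborel inv_sq"
  using integrable_inverse_1_plus_square unfolding inv_sq_def[abs_def]
  by (simp add: einterval_eq_UNIV set_integrable_def)

lemma inv_sq_tendsto: "(\<lambda>n. inv_sq (real n)) \<longlonglongrightarrow> 0"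
  unfolding inv_sq_def by real_asymp

text \<open>Connects gauge integrals over finite segments, where primitives can be evaluated, with
  the Lebesgue integral over the whole line.\<close>

lemma symmetric_integral_limit:
  fixes h :: "real \<Rightarrow> complex"
  assumes "integrable lborel h"
  shows "(\<lambda>n. integral {-real n..real n} h) \<longlonglongrightarrow> (LINT v|lborel. h v)"
proof -
  have s: "set_integrable lborel {-real n..real n} h" for n
    using assms unfolding set_integrable_def by (intro integrable_mult_indicator) auto
  have "(\<lambda>n. LINT v|lborel. indicator {-real n..real n} v *\<^sub>R h v) \<longlonglongrightarrow> (LINT v|lborel. h v)"
  proof (rule integral_dominated_convergence[where w="\<lambda>v. norm (h v)"])
    show "AE v in lborel. (\<lambda>n. indicator {-real n..real n} v *\<^sub>R h v) \<longlonglongrightarrow> h v"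
    proof (intro AE_I2 tendsto_eventually)
      fix v :: real
      obtain N where N: "\<bar>v\<bar> \<le> real N" using real_arch_simple by blast
      show "\<forall>\<^sub>F n in sequentially. indicator {-real n..real n} v *\<^sub>R h v = h v"
        using eventually_ge_at_top[of N]
      proof eventually_elim
        case (elim n)
        then have "v \<in> {-real n..real n}" using N by auto
        then show ?case by simp
      qed
    qed
    show "AE v in lborel. norm (indicator {-real n..real n} v *\<^sub>R h v) \<le> norm (h v)" for n
      by (intro AE_I2) (auto simp: indicator_def)
  qed (use assms s in \<open>auto simp: set_integrable_def\<close>)
  then show ?thesis
    using set_borel_integral_eq_integral(2)[OF s] by (simp add: set_lebesgue_integral_def)
qed

text \<open>Holomorphy on a half plane containing the strip provides a primitive; decay on the strip
  makes the integrals converge and the horizontal sides disappear.\<close>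

locale strip_decay =
  fixes H :: "complex \<Rightarrow> complex" and \<alpha> c0 c1 M :: real
  assumes hol: "H holomorphic_on {w. Re w > \<alpha>}" and c: "\<alpha> < c0" "c0 < c1"
    and decay: "\<And>w. c0 \<le> Re w \<Longrightarrow> Re w \<le> c1 \<Longrightarrow> cmod (H w) \<le> M * inv_sq (Im w)"
begin

lemma M_nonneg: "M \<ge> 0"
proof -
  have "0 \<le> M * inv_sq 0" using decay[of "Complex c0 0"] c by (auto intro: order_trans[OF norm_ge_zero])
  then show ?thesis by (simp add: inv_sq_def)
qed

lemma cont_vertical:
  assumes "c0 \<le> a"
  shows "continuous_on UNIV (\<lambda>v. H (Complex a v))"
proof -
  have "continuous_on UNIV (H \<circ> (\<lambda>v. Complex a v))"
  proof (rule continuous_on_compose)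
    show "continuous_on UNIV (Complex a)" unfolding Complex_eq by (intro continuous_intros)
    show "continuous_on (range (Complex a)) H"
      by (rule continuous_on_subset[OF holomorphic_on_imp_continuous_on[OF hol]]) (use assms c in auto)
  qed
  then show ?thesis by (simp add: o_def)
qed

lemma integrable_vertical:
  assumes "c0 \<le> a" "a \<le> c1"
  shows "integrable lborel (\<lambda>v. H (Complex a v))"
proof (rule Bochner_Integration.integrable_bound)
  show "integrable lborel (\<lambda>v. M * inv_sq v)" by (intro integrable_mult_right inv_sq_integrable)
  show "(\<lambda>v. H (Complex a v)) \<in> borel_measurable lborel"
    using borel_measurable_continuous_onI[OF cont_vertical[OF assms(1)]] by simp
  show "AE v in lborel. norm (H (Complex a v)) \<le> norm (M * inv_sq v)"
  proof (intro AE_I2)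
    fix v
    have "cmod (H (Complex a v)) \<le> M * inv_sq v" using decay[of "Complex a v"] assms by simp
    then show "norm (H (Complex a v)) \<le> norm (M * inv_sq v)" unfolding real_norm_def by linarith
  qed
qed

text \<open>A primitive on the convex half plane replaces contour integration: the two vertical
  integrals differ by two horizontal increments of the primitive. \<open>Q\<close> is arbitrary so
  that a quotient with its pole removed can be inserted too.\<close>

lemma shift_limit:
  fixes Q :: "complex \<Rightarrow> complex"
  assumes Q: "Q holomorphic_on {w. Re w > \<alpha>}"
    and bd: "\<And>w. c0 \<le> Re w \<Longrightarrow> Re w \<le> c1 \<Longrightarrow> \<bar>Im w\<bar> = real n \<Longrightarrow> cmod (Q w) \<le> B"
  shows "cmod (integral {-real n..real n} (\<lambda>v. Q (Complex c1 v)) - integral {-real n..real n} (\<lambda>v. Q (Complex c0 v)))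
    \<le> 2 * B * (c1 - c0)"
proof -
  let ?S = "{w. Re w > \<alpha>}"
  obtain \<Psi> where "\<And>w. w \<in> ?S \<Longrightarrow> (\<Psi> has_field_derivative Q w) (at w within ?S)"
    using holomorphic_convex_primitive'[OF convex_halfspace_Re_gt open_halfspace_Re_gt Q] by blast
  then have \<Psi>: "(\<Psi> has_field_derivative Q w) (at w)" if "Re w > \<alpha>" for w
    using that at_within_open[OF _ open_halfspace_Re_gt[of \<alpha>], of w] by force
  have ftc: "integral {-real n..real n} (\<lambda>v. Q (Complex a v)) = -\<i> * (\<Psi> (Complex a (real n)) - \<Psi> (Complex a (- real n)))"
    if a: "c0 \<le> a" for a
  proof (rule integral_unique)
    have "((\<lambda>v. Q (Complex a v)) has_integral (-\<i> * \<Psi> (Complex a (real n)) - (-\<i> * \<Psi> (Complex a (- real n))))) {-real n..real n}"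
    proof (rule fundamental_theorem_of_calculus)
      fix v assume "v \<in> {-real n..real n}"
      have "((\<lambda>v. Complex a v) has_vector_derivative \<i>) (at v within {-real n..real n})"
        unfolding Complex_eq by (auto intro!: derivative_eq_intros simp: has_vector_derivative_def scaleR_conv_of_real)
      moreover have "(\<Psi> has_field_derivative Q (Complex a v)) (at (Complex a v) within (Complex a ` {-real n..real n}))"
        by (rule DERIV_subset[OF \<Psi>]) (use a c in auto)
      ultimately have "(\<Psi> \<circ> Complex a has_vector_derivative \<i> * Q (Complex a v)) (at v within {-real n..real n})"
        by (rule field_vector_diff_chain_within)
      then have "((\<lambda>v. -\<i> * \<Psi> (Complex a v)) has_vector_derivative -\<i> * (\<i> * Q (Complex a v))) (at v within {-real n..real n})"
        unfolding o_def by (rule has_vector_derivative_mult_right)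
      then show "((\<lambda>v. -\<i> * \<Psi> (Complex a v)) has_vector_derivative Q (Complex a v)) (at v within {-real n..real n})"
        by simp
    qed simp
    then show "((\<lambda>v. Q (Complex a v)) has_integral -\<i> * (\<Psi> (Complex a (real n)) - \<Psi> (Complex a (- real n)))) {-real n..real n}"
      by (simp add: algebra_simps)
  qed
  have side: "cmod (\<Psi> (Complex c1 y) - \<Psi> (Complex c0 y)) \<le> B * (c1 - c0)" if y: "\<bar>y\<bar> = real n" for y
  proof -
    let ?L = "{w. Im w = y \<and> c0 \<le> Re w \<and> Re w \<le> c1}"
    have "convex ?L"
    proof -
      have "?L = {w. Im w \<le> y} \<inter> {w. Im w \<ge> y} \<inter> {w. c0 \<le> Re w} \<inter> {w. Re w \<le> c1}" by auto
      then show ?thesis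
        by (simp add: convex_Int convex_halfspace_Re_ge convex_halfspace_Re_le convex_halfspace_Im_ge convex_halfspace_Im_le)
    qed
    have "cmod (\<Psi> (Complex c1 y) - \<Psi> (Complex c0 y)) \<le> B * cmod (Complex c1 y - Complex c0 y)"
    proof (rule field_differentiable_bound[OF \<open>convex ?L\<close>])
      fix w assume "w \<in> ?L"
      then show "(\<Psi> has_field_derivative Q w) (at w within ?L)" "cmod (Q w) \<le> B"
        using c y by (auto intro!: DERIV_subset[OF \<Psi>] bd)
    qed (use c in auto)
    also have "Complex c1 y - Complex c0 y = of_real (c1 - c0)" by (simp add: complex_eq_iff)
    finally show ?thesis using c by (simp add: norm_of_real del: of_real_diff)
  qed
  have "integral {-real n..real n} (\<lambda>v. Q (Complex c1 v)) - integral {-real n..real n} (\<lambda>v. Q (Complex c0 v))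
     = -\<i> * ((\<Psi> (Complex c1 (real n)) - \<Psi> (Complex c0 (real n))) - (\<Psi> (Complex c1 (-real n)) - \<Psi> (Complex c0 (-real n))))"
    using c by (simp add: ftc algebra_simps)
  then have "cmod (integral {-real n..real n} (\<lambda>v. Q (Complex c1 v)) - integral {-real n..real n} (\<lambda>v. Q (Complex c0 v)))
     = cmod ((\<Psi> (Complex c1 (real n)) - \<Psi> (Complex c0 (real n))) - (\<Psi> (Complex c1 (-real n)) - \<Psi> (Complex c0 (-real n))))"
    by (simp add: norm_mult)
  also have "\<dots> \<le> B * (c1 - c0) + B * (c1 - c0)"
    by (intro order_trans[OF norm_triangle_ineq4] add_mono side) auto
  finally show ?thesis by simp
qed

lemma vertical_shift: "(LINT v|lborel. H (Complex c0 v)) = (LINT v|lborel. H (Complex c1 v))"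
proof -
  have "(\<lambda>n. integral {-real n..real n} (\<lambda>v. H (Complex c1 v)) - integral {-real n..real n} (\<lambda>v. H (Complex c0 v)))
    \<longlonglongrightarrow> (LINT v|lborel. H (Complex c1 v)) - (LINT v|lborel. H (Complex c0 v))"
    using c by (intro tendsto_diff symmetric_integral_limit integrable_vertical) auto
  moreover have "(\<lambda>n. integral {-real n..real n} (\<lambda>v. H (Complex c1 v)) - integral {-real n..real n} (\<lambda>v. H (Complex c0 v))) \<longlonglongrightarrow> 0"
  proof (rule Lim_null_comparison)
    show "(\<lambda>n. 2 * (M * inv_sq (real n)) * (c1 - c0)) \<longlonglongrightarrow> 0"
      using tendsto_mult[OF tendsto_mult[OF tendsto_const tendsto_mult[OF tendsto_const inv_sq_tendsto]] tendsto_const, of 2 M "c1 - c0"] by simp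
    show "\<forall>\<^sub>F n in sequentially. norm (integral {-real n..real n} (\<lambda>v. H (Complex c1 v)) - integral {-real n..real n} (\<lambda>v. H (Complex c0 v))) \<le> 2 * (M * inv_sq (real n)) * (c1 - c0)"
    proof (intro always_eventually allI shift_limit hol)
      fix n w assume w: "c0 \<le> Re w" "Re w \<le> c1" "\<bar>Im w\<bar> = real n"
      have "inv_sq (Im w) = inv_sq (real n)" unfolding inv_sq_def using w(3) by (metis power2_abs)
      then show "cmod (H w) \<le> M * inv_sq (real n)" using decay[of w] w by simp
    qed
  qed
  ultimately show ?thesis using LIMSEQ_unique by fastforce
qed

lemma integrable_vertical_div:
  assumes "c0 \<le> a" "a \<le> c1" "a \<noteq> 0"
  shows "integrable lborel (\<lambda>v. H (Complex a v) / Complex a v)"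
proof (rule Bochner_Integration.integrable_bound)
  show "integrable lborel (\<lambda>v. M / \<bar>a\<bar> * inv_sq v)" by (intro integrable_mult_right inv_sq_integrable)
  have "continuous_on UNIV (\<lambda>v. H (Complex a v) / Complex a v)"
    using cont_vertical[OF assms(1)] assms(3) unfolding Complex_eq
    by (intro continuous_intros) (auto simp: complex_eq_iff)
  then show "(\<lambda>v. H (Complex a v) / Complex a v) \<in> borel_measurable lborel"
    using borel_measurable_continuous_onI by force
  show "AE v in lborel. norm (H (Complex a v) / Complex a v) \<le> norm (M / \<bar>a\<bar> * inv_sq v)"
  proof (intro AE_I2)
    fix v
    have "norm (H (Complex a v) / Complex a v) \<le> M * inv_sq v / \<bar>a\<bar>"
      unfolding norm_divide using decay[of "Complex a v"] assms abs_Re_le_cmod[of "Complex a v"] M_nonneg inv_sq_pos[of v]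
      by (intro frac_le mult_nonneg_nonneg) auto
    then show "norm (H (Complex a v) / Complex a v) \<le> norm (M / \<bar>a\<bar> * inv_sq v)"
      using M_nonneg inv_sq_pos[of v] by (simp add: abs_mult)
  qed
qed

text \<open>The imaginary part of the primitive is a logarithm even in v, so only the arctangent
  survives over a symmetric segment.\<close>

lemma integral_inverse_line:
  assumes "a \<noteq> 0"
  shows "((\<lambda>v. 1 / Complex a v) has_integral of_real (2 * arctan (real n / a))) {-real n..real n}"
proof -
  define F where "F v = Complex (arctan (v / a)) (- ln (a\<^sup>2 + v\<^sup>2) / 2)" for v
  have pos: "a\<^sup>2 + v\<^sup>2 > 0" for v using assms by (simp add: add_pos_nonneg)
  have "((\<lambda>v. 1 / Complex a v) has_integral F (real n) - F (- real n)) {-real n..real n}"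
  proof (rule fundamental_theorem_of_calculus)
    fix v assume "v \<in> {-real n..real n}"
    have 1: "((\<lambda>v. arctan (v / a)) has_real_derivative (a / (a\<^sup>2 + v\<^sup>2))) (at v within {-real n..real n})"
      using assms pos[of v] by (auto intro!: derivative_eq_intros simp: field_simps power2_eq_square)
    have 2: "((\<lambda>v. - ln (a\<^sup>2 + v\<^sup>2) / 2) has_real_derivative (- v / (a\<^sup>2 + v\<^sup>2))) (at v within {-real n..real n})"
    proof -
      have "a\<^sup>2 * 4 + v\<^sup>2 * 4 = 4 * (a\<^sup>2 + v\<^sup>2)" by simp
      then show ?thesis using pos[of v] by (auto intro!: derivative_eq_intros simp del: distrib_left_numeral)
    qed
    have "(F has_vector_derivative Complex (a / (a\<^sup>2 + v\<^sup>2)) (- v / (a\<^sup>2 + v\<^sup>2))) (at v within {-real n..real n})"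
      unfolding F_def using 1 2
      by (intro has_vector_derivative_complex_iff[THEN iffD2]) (auto simp: has_real_derivative_iff_has_vector_derivative)
    moreover have "Complex (a / (a\<^sup>2 + v\<^sup>2)) (- v / (a\<^sup>2 + v\<^sup>2)) = 1 / Complex a v"
      by (simp add: complex_eq_iff Re_divide Im_divide)
    ultimately show "(F has_vector_derivative 1 / Complex a v) (at v within {-real n..real n})" by simp
  qed simp
  moreover have "F (real n) - F (- real n) = of_real (2 * arctan (real n / a))"
    by (simp add: F_def complex_eq_iff arctan_minus)
  ultimately show ?thesis by simp
qed

text \<open>Subtracting H(0)/w removes the singularity at 0, and 1/w is integrated explicitly: its
  arctangents tend to \<pi>/2 on the right and -\<pi>/2 on the left, whence 2\<pi> H(0).\<close>

lemma vertical_residue: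
  assumes z: "c0 < 0" "0 < c1"
  shows "(LINT v|lborel. H (Complex c1 v) / Complex c1 v) = 2 * pi * H 0 + (LINT v|lborel. H (Complex c0 v) / Complex c0 v)"
proof -
  define Q where "Q w = (if w = 0 then deriv H 0 else (H w - H 0) / (w - 0))" for w
  have Qh: "Q holomorphic_on {w. Re w > \<alpha>}"
    unfolding Q_def[abs_def] using c z by (intro pole_lemma_open hol open_halfspace_Re_gt)
  let ?K = "\<lambda>a v. H (Complex a v) / Complex a v"
  have eqn: "integral {-real n..real n} (\<lambda>v. Q (Complex a v)) = integral {-real n..real n} (?K a) - H 0 * of_real (2 * arctan (real n / a))"
    if a: "c0 \<le> a" "a \<le> c1" "a \<noteq> 0" for a n
  proof -
    have nz: "Complex a v \<noteq> 0" for v using a by (simp add: complex_eq_iff)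
    have "continuous_on {-real n..real n} (?K a)"
      using continuous_on_subset[OF cont_vertical[OF a(1)], of "{-real n..real n}"] nz
      unfolding Complex_eq by (intro continuous_intros) auto
    then have "?K a integrable_on {-real n..real n}" by (rule integrable_continuous_real)
    then have "(?K a has_integral integral {-real n..real n} (?K a)) {-real n..real n}" by (rule integrable_integral)
    from has_integral_diff[OF this has_integral_mult_right[OF integral_inverse_line[OF a(3)], of "H 0"]]
    have "((\<lambda>v. ?K a v - H 0 * (1 / Complex a v)) has_integral (integral {-real n..real n} (?K a) - H 0 * of_real (2 * arctan (real n / a)))) {-real n..real n}" .
    moreover have "?K a v - H 0 * (1 / Complex a v) = Q (Complex a v)" for v
      using nz[of v] by (simp add: Q_def diff_divide_distrib)
    ultimately show ?thesis by (simp add: integral_unique)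
  qed
  have l0: "(\<lambda>n. integral {-real n..real n} (\<lambda>v. Q (Complex c1 v)) - integral {-real n..real n} (\<lambda>v. Q (Complex c0 v))) \<longlonglongrightarrow> 0"
  proof (rule Lim_null_comparison)
    show "(\<lambda>n. 2 * ((M + cmod (H 0)) / real n) * (c1 - c0)) \<longlonglongrightarrow> 0" by real_asymp
    show "\<forall>\<^sub>F n in sequentially. norm (integral {-real n..real n} (\<lambda>v. Q (Complex c1 v)) - integral {-real n..real n} (\<lambda>v. Q (Complex c0 v))) \<le> 2 * ((M + cmod (H 0)) / real n) * (c1 - c0)"
      using eventually_gt_at_top[of 0]
    proof eventually_elim
      case (elim n)
      show ?case
      proof (rule shift_limit[OF Qh])
        fix w assume w: "c0 \<le> Re w" "Re w \<le> c1" "\<bar>Im w\<bar> = real n"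
        have nz: "w \<noteq> 0" using w elim by auto
        have "inv_sq (Im w) \<le> 1" unfolding inv_sq_def by (intro inverse_le_1_iff[THEN iffD2]) simp
        then have "cmod (H w) \<le> M" using decay[OF w(1,2)] mult_left_mono[OF _ M_nonneg, of "inv_sq (Im w)" 1] by simp
        then have "cmod (H w - H 0) \<le> M + cmod (H 0)" using norm_triangle_ineq4[of "H w" "H 0"] by linarith
        then have "cmod (H w - H 0) / cmod w \<le> (M + cmod (H 0)) / real n"
          using abs_Im_le_cmod[of w] w elim M_nonneg by (intro frac_le) auto
        then show "cmod (Q w) \<le> (M + cmod (H 0)) / real n" using nz by (simp add: Q_def norm_divide)
      qed
    qed
  qed
  have at: "(\<lambda>n. 2 * arctan (real n / c1) - 2 * arctan (real n / c0)) \<longlonglongrightarrow> 2 * (pi/2) - 2 * (- (pi/2))"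
  proof (intro tendsto_intros)
    show "(\<lambda>n. arctan (real n / c1)) \<longlonglongrightarrow> pi/2"
      by (rule filterlim_compose[OF tendsto_arctan_at_top]) (use z in real_asymp)
    show "(\<lambda>n. arctan (real n / c0)) \<longlonglongrightarrow> -(pi/2)"
      by (rule filterlim_compose[OF tendsto_arctan_at_bot]) (use z in real_asymp)
  qed
  have lim: "(\<lambda>n. integral {-real n..real n} (?K c1) - integral {-real n..real n} (?K c0) - H 0 * of_real (2 * arctan (real n / c1) - 2 * arctan (real n / c0)))
     \<longlonglongrightarrow> (LINT v|lborel. ?K c1 v) - (LINT v|lborel. ?K c0 v) - H 0 * of_real (2 * (pi/2) - 2 * (- (pi/2)))"
    using c z by (intro tendsto_diff tendsto_mult tendsto_const tendsto_of_real at symmetric_integral_limit integrable_vertical_div) auto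
  have E: "integral {-real n..real n} (?K c1) - integral {-real n..real n} (?K c0) - H 0 * of_real (2 * arctan (real n / c1) - 2 * arctan (real n / c0)) =
      integral {-real n..real n} (\<lambda>v. Q (Complex c1 v)) - integral {-real n..real n} (\<lambda>v. Q (Complex c0 v))" for n
    using eqn[of c1 n] eqn[of c0 n] c z by (simp only: of_real_diff) (simp add: right_diff_distrib)
  have "(LINT v|lborel. ?K c1 v) - (LINT v|lborel. ?K c0 v) - H 0 * of_real (2 * (pi/2) - 2 * (- (pi/2))) = 0"
    by (rule LIMSEQ_unique[OF lim[unfolded E] l0])
  then show ?thesis by (simp add: algebra_simps)
qed

end

subsection \<open>Gaussian contour shifting\<close>

definition gauss_kernel :: "real \<Rightarrow> complex \<Rightarrow> complex" where
  "gauss_kernel \<mu> w = exp (w\<^sup>2 / 2 + of_real \<mu> * w)"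

lemma gauss_kernel_norm:
  "cmod (gauss_kernel \<mu> w) = exp ((Re w)\<^sup>2 / 2 + \<mu> * Re w) * exp (- (Im w)\<^sup>2 / 2)"
  unfolding gauss_kernel_def norm_exp_eq_Re by (simp add: power2_eq_square diff_divide_distrib flip: exp_add)

lemma gauss_kernel_holomorphic [holomorphic_intros]: "gauss_kernel \<mu> holomorphic_on A"
  unfolding gauss_kernel_def[abs_def] by (intro holomorphic_intros) auto

lemma gauss_kernel_continuous: "continuous_on UNIV (\<lambda>v. gauss_kernel \<mu> (Complex a v))"
  unfolding gauss_kernel_def Complex_eq by (intro continuous_intros) auto

text \<open>Completing the square trades the growth exp(k|v|) for a constant and half of the
  Gaussian exponent.\<close>

lemma exp_gauss_le_inv_sq:
  fixes v k :: real
  shows "exp (k * \<bar>v\<bar>) * exp (- v\<^sup>2 / 2) \<le> 4 * exp (k\<^sup>2) * inv_sq v"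
proof -
  have "(k - \<bar>v\<bar> / 2)\<^sup>2 \<ge> 0" by simp
  then have "k * \<bar>v\<bar> - v\<^sup>2 / 2 \<le> k\<^sup>2 - v\<^sup>2 / 4" by (simp add: power2_eq_square algebra_simps)
  then have "exp (k * \<bar>v\<bar> - v\<^sup>2 / 2) \<le> exp (k\<^sup>2 - v\<^sup>2 / 4)" by simp
  also have "\<dots> = exp (k\<^sup>2) / exp (v\<^sup>2 / 4)" by (simp add: exp_diff)
  also have "\<dots> \<le> exp (k\<^sup>2) / ((1 + v\<^sup>2) / 4)"
  proof (rule divide_left_mono)
    show "(1 + v\<^sup>2) / 4 \<le> exp (v\<^sup>2 / 4)"
    proof -
      have "1 + v\<^sup>2 / 4 \<le> exp (v\<^sup>2 / 4)" by (rule exp_ge_add_one_self)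
      moreover have "(1 + v\<^sup>2) / 4 \<le> 1 + v\<^sup>2 / 4" by (simp add: add_divide_distrib)
      ultimately show ?thesis by (rule order_trans[rotated])
    qed
  qed (auto intro!: mult_pos_pos simp: add_pos_nonneg)
  also have "\<dots> = 4 * exp (k\<^sup>2) * inv_sq v" by (simp add: inv_sq_def field_simps)
  also have "exp (k * \<bar>v\<bar> - v\<^sup>2 / 2) = exp (k * \<bar>v\<bar>) * exp (- v\<^sup>2 / 2)" by (simp flip: exp_add)
  finally show ?thesis .
qed

lemma kernel_product_bound:
  assumes "cmod h \<le> B * exp (k * \<bar>Im w\<bar>)"
  shows "cmod (h * gauss_kernel \<mu> w) \<le> 4 * B * exp (k\<^sup>2) * exp ((Re w)\<^sup>2 / 2 + \<mu> * Re w) * inv_sq (Im w)"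
proof -
  have B: "B \<ge> 0" using assms by (meson exp_gt_zero norm_ge_zero order_trans zero_le_mult_iff less_le_not_le)
  have "cmod (h * gauss_kernel \<mu> w) \<le> (B * exp (k * \<bar>Im w\<bar>)) * (exp ((Re w)\<^sup>2 / 2 + \<mu> * Re w) * exp (- (Im w)\<^sup>2 / 2))"
    unfolding norm_mult gauss_kernel_norm using assms by (intro mult_right_mono) auto
  also have "\<dots> = (B * exp ((Re w)\<^sup>2 / 2 + \<mu> * Re w)) * (exp (k * \<bar>Im w\<bar>) * exp (- (Im w)\<^sup>2 / 2))"
    by (simp only: mult_ac)
  also have "\<dots> \<le> (B * exp ((Re w)\<^sup>2 / 2 + \<mu> * Re w)) * (4 * exp (k\<^sup>2) * inv_sq (Im w))"
    using B by (intro mult_left_mono exp_gauss_le_inv_sq) auto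
  finally show ?thesis by (simp only: mult_ac)
qed

lemma strip_decay_kernel:
  assumes "h holomorphic_on {w. Re w > \<alpha>}" "\<alpha> < c0" "c0 < c1"
    and b: "\<And>w. c0 \<le> Re w \<Longrightarrow> Re w \<le> c1 \<Longrightarrow> cmod (h w) \<le> B * exp (k * \<bar>Im w\<bar>)"
  shows "\<exists>M. strip_decay (\<lambda>w. h w * gauss_kernel \<mu> w) \<alpha> c0 c1 M"
proof -
  have B: "B \<ge> 0" using b[of "Complex c0 0"] assms(3) by (auto intro: order_trans[OF norm_ge_zero])
  define R where "R = max \<bar>c0\<bar> \<bar>c1\<bar>"
  have "strip_decay (\<lambda>w. h w * gauss_kernel \<mu> w) \<alpha> c0 c1 (4 * B * exp (k\<^sup>2) * exp (R\<^sup>2 / 2 + \<bar>\<mu>\<bar> * R))"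
  proof
    show "(\<lambda>w. h w * gauss_kernel \<mu> w) holomorphic_on {w. Re w > \<alpha>}" by (intro holomorphic_intros assms)
    fix w assume w: "c0 \<le> Re w" "Re w \<le> c1"
    have r: "\<bar>Re w\<bar> \<le> R" using w unfolding R_def by linarith
    then have "(Re w)\<^sup>2 \<le> R\<^sup>2" by (metis abs_ge_zero power2_abs power_mono)
    moreover have "\<mu> * Re w \<le> \<bar>\<mu>\<bar> * R" using mult_mono[OF order.refl[of "\<bar>\<mu>\<bar>"] r] abs_ge_self[of "\<mu> * Re w"] by (simp add: abs_mult)
    ultimately have "exp ((Re w)\<^sup>2 / 2 + \<mu> * Re w) \<le> exp (R\<^sup>2 / 2 + \<bar>\<mu>\<bar> * R)" by simp
    then have "4 * B * exp (k\<^sup>2) * exp ((Re w)\<^sup>2 / 2 + \<mu> * Re w) * inv_sq (Im w) \<le> 4 * B * exp (k\<^sup>2) * exp (R\<^sup>2 / 2 + \<bar>\<mu>\<bar> * R) * inv_sq (Im w)"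
      using B inv_sq_pos[of "Im w"] by (intro mult_right_mono mult_left_mono) auto
    then show "cmod (h w * gauss_kernel \<mu> w) \<le> 4 * B * exp (k\<^sup>2) * exp (R\<^sup>2 / 2 + \<bar>\<mu>\<bar> * R) * inv_sq (Im w)"
      using kernel_product_bound[OF b[OF w], of \<mu>] by linarith
  qed (use assms in auto)
  then show ?thesis by blast
qed

lemma gauss_shift:
  assumes "h holomorphic_on {w. Re w > \<alpha>}" "\<alpha> < c0" "c0 < c1"
    and b: "\<And>w. c0 \<le> Re w \<Longrightarrow> Re w \<le> c1 \<Longrightarrow> cmod (h w) \<le> B * exp (k * \<bar>Im w\<bar>)"
  shows "(LINT v|lborel. h (Complex c0 v) * gauss_kernel \<mu> (Complex c0 v)) = (LINT v|lborel. h (Complex c1 v) * gauss_kernel \<mu> (Complex c1 v))"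
  using strip_decay_kernel[OF assms, of \<mu>] strip_decay.vertical_shift by blast

lemma gauss_residue:
  fixes h :: "complex \<Rightarrow> complex"
  assumes "h holomorphic_on {w. Re w > \<alpha>}" "\<alpha> < c0" "c0 < 0" "0 < c1"
    and b: "\<And>w. c0 \<le> Re w \<Longrightarrow> Re w \<le> c1 \<Longrightarrow> cmod (h w) \<le> B * exp (k * \<bar>Im w\<bar>)"
  shows "(LINT v|lborel. h (Complex c1 v) * gauss_kernel \<mu> (Complex c1 v) / Complex c1 v) =
    2 * pi * h 0 + (LINT v|lborel. h (Complex c0 v) * gauss_kernel \<mu> (Complex c0 v) / Complex c0 v)"
proof -
  have "c0 < c1" using assms by simp
  then obtain M where "strip_decay (\<lambda>w. h w * gauss_kernel \<mu> w) \<alpha> c0 c1 M"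
    using strip_decay_kernel[of h \<alpha> c0 c1 B k \<mu>] assms(1,2) b by blast
  from strip_decay.vertical_residue[OF this assms(3,4)] show ?thesis by (simp add: gauss_kernel_def)
qed

lemma vertical_integral_bound:
  fixes h :: "real \<Rightarrow> complex"
  assumes "\<And>v. cmod (h v) \<le> M * inv_sq v"
  shows "cmod (LINT v|lborel. h v) \<le> M * integral\<^sup>L lborel inv_sq"
proof (cases "integrable lborel h")
  case True
  have "cmod (LINT v|lborel. h v) \<le> (LINT v|lborel. M * inv_sq v)"
    by (rule Bochner_Integration.integral_norm_bound_integral[OF True])
       (auto intro!: integrable_mult_right inv_sq_integrable assms)
  then show ?thesis by simp
next
  \<comment> \<open>A function that is not integrable has integral 0 by convention, so the bound
    still holds.\<close>
  case False
  have "0 \<le> M * inv_sq 0" using assms[of 0] norm_ge_zero order_trans by blast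
  then have "M \<ge> 0" by (simp add: inv_sq_def)
  moreover have "integral\<^sup>L lborel inv_sq \<ge> 0" using inv_sq_pos by (intro Bochner_Integration.integral_nonneg) (simp add: less_imp_le)
  ultimately show ?thesis using False by (simp add: not_integrable_integral_eq)
qed

lemma gauss_kernel_integrable: "integrable lborel (\<lambda>v. gauss_kernel \<mu> (Complex a v))"
proof (rule Bochner_Integration.integrable_bound)
  define M where "M = 4 * 1 * exp (0\<^sup>2) * exp (a\<^sup>2 / 2 + \<mu> * a)"
  show "integrable lborel (\<lambda>v. M * inv_sq v)" by (intro integrable_mult_right inv_sq_integrable)
  show "(\<lambda>v. gauss_kernel \<mu> (Complex a v)) \<in> borel_measurable lborel"
    using borel_measurable_continuous_onI[OF gauss_kernel_continuous] by simp
  show "AE v in lborel. norm (gauss_kernel \<mu> (Complex a v)) \<le> norm (M * inv_sq v)"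
  proof (intro AE_I2)
    fix v
    have "cmod (1 * gauss_kernel \<mu> (Complex a v)) \<le> M * inv_sq v"
      using kernel_product_bound[of 1 1 0 "Complex a v" \<mu>] unfolding M_def by simp
    then show "norm (gauss_kernel \<mu> (Complex a v)) \<le> norm (M * inv_sq v)" unfolding real_norm_def mult_1 by linarith
  qed
qed

lemma gauss_kernel_div_integrable:
  assumes "a \<noteq> 0"
  shows "integrable lborel (\<lambda>v. gauss_kernel \<mu> (Complex a v) / Complex a v)"
proof (rule Bochner_Integration.integrable_bound)
  show "integrable lborel (\<lambda>v. gauss_kernel \<mu> (Complex a v) / of_real a)"
    by (intro integrable_divide gauss_kernel_integrable)
  have "continuous_on UNIV (\<lambda>v. gauss_kernel \<mu> (Complex a v) / Complex a v)"
    using gauss_kernel_continuous assms unfolding Complex_eq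
    by (intro continuous_intros) (auto simp: complex_eq_iff)
  then show "(\<lambda>v. gauss_kernel \<mu> (Complex a v) / Complex a v) \<in> borel_measurable lborel"
    using borel_measurable_continuous_onI by force
  show "AE v in lborel. norm (gauss_kernel \<mu> (Complex a v) / Complex a v) \<le> norm (gauss_kernel \<mu> (Complex a v) / of_real a)"
    unfolding norm_divide norm_of_real
    using abs_Re_le_cmod[of "Complex a v" for v] assms by (intro AE_I2 divide_left_mono) (auto simp: complex_eq_iff)
qed

text \<open>Up to normalisation this is the characteristic function of the standard normal law at a
  + \<mu>. The factors in a cancel, so the result does not depend on the line.\<close>

lemma gauss_kernel_integral:
  "(LINT v|lborel. gauss_kernel \<mu> (Complex a v)) = of_real (sqrt (2 * pi) * exp (- \<mu>\<^sup>2 / 2))"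
proof -
  define t where "t = a + \<mu>"
  have "of_real (exp (- (t\<^sup>2) / 2)) = (CLINT v|std_normal_distribution. iexp (t * v))"
    using char_std_normal_distribution unfolding char_def by (metis (no_types))
  also have "\<dots> = (LINT v|lborel. std_normal_density v *\<^sub>R iexp (t * v))"
    by (subst integral_density) (auto simp: normal_density_nonneg)
  also have "\<dots> = (LINT v|lborel. of_real (exp (- a\<^sup>2 / 2 - \<mu> * a) / sqrt (2 * pi)) * gauss_kernel \<mu> (Complex a v))"
  proof (intro Bochner_Integration.integral_cong refl)
    fix v :: real
    have "(Complex a v)\<^sup>2 / 2 + of_real \<mu> * Complex a v = of_real (a\<^sup>2 / 2 + \<mu> * a) + of_real (- v\<^sup>2 / 2) + \<i> * of_real (t * v)"
      by (simp add: complex_eq_iff power2_eq_square t_def algebra_simps diff_divide_distrib)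
    then have "gauss_kernel \<mu> (Complex a v) = of_real (exp (a\<^sup>2 / 2 + \<mu> * a)) * of_real (exp (- v\<^sup>2 / 2)) * iexp (t * v)"
      unfolding gauss_kernel_def by (simp only: exp_add exp_of_real)
    then have "of_real (exp (- a\<^sup>2 / 2 - \<mu> * a) / sqrt (2 * pi)) * gauss_kernel \<mu> (Complex a v)
      = of_real (exp (- a\<^sup>2 / 2 - \<mu> * a) * exp (a\<^sup>2 / 2 + \<mu> * a) / sqrt (2 * pi) * exp (- v\<^sup>2 / 2)) * iexp (t * v)"
      by (simp only: of_real_mult of_real_divide) (simp only: times_divide_eq_left times_divide_eq_right mult_ac)
    also have "exp (- a\<^sup>2 / 2 - \<mu> * a) * exp (a\<^sup>2 / 2 + \<mu> * a) = 1" by (simp flip: exp_add)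
    finally show "std_normal_density v *\<^sub>R iexp (t * v) = of_real (exp (- a\<^sup>2 / 2 - \<mu> * a) / sqrt (2 * pi)) * gauss_kernel \<mu> (Complex a v)"
      by (simp only: std_normal_density_def scaleR_conv_of_real)
  qed
  also have "\<dots> = of_real (exp (- a\<^sup>2 / 2 - \<mu> * a) / sqrt (2 * pi)) * (LINT v|lborel. gauss_kernel \<mu> (Complex a v))"
    by simp
  finally have e: "of_real (exp (- (t\<^sup>2) / 2)) = of_real (exp (- a\<^sup>2 / 2 - \<mu> * a) / sqrt (2 * pi)) * (LINT v|lborel. gauss_kernel \<mu> (Complex a v))" .
  define I where "I = (LINT v|lborel. gauss_kernel \<mu> (Complex a v))"
  have "sqrt (2 * pi) * exp (a\<^sup>2 / 2 + \<mu> * a) * (exp (- a\<^sup>2 / 2 - \<mu> * a) / sqrt (2 * pi)) = 1"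
    by (simp flip: exp_add)
  then have "I = of_real (sqrt (2 * pi) * exp (a\<^sup>2 / 2 + \<mu> * a)) * (of_real (exp (- a\<^sup>2 / 2 - \<mu> * a) / sqrt (2 * pi)) * I)"
    by (metis mult.assoc mult_1 of_real_1 of_real_mult)
  also have "\<dots> = of_real (sqrt (2 * pi) * exp (a\<^sup>2 / 2 + \<mu> * a)) * of_real (exp (- (t\<^sup>2) / 2))"
    unfolding I_def using e by simp
  also have "\<dots> = of_real (sqrt (2 * pi) * exp (- \<mu>\<^sup>2 / 2))"
  proof -
    have "exp (a\<^sup>2 / 2 + \<mu> * a) * exp (- (t\<^sup>2) / 2) = exp (- \<mu>\<^sup>2 / 2)"
      unfolding t_def by (simp add: power2_eq_square algebra_simps add_divide_distrib diff_divide_distrib flip: exp_add)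
    then show ?thesis by (simp only: of_real_mult[symmetric] mult.assoc)
  qed
  finally show ?thesis unfolding I_def .
qed

lemma dseries_integral:
  assumes b: "summable (\<lambda>n. cmod (b n) * real n powr (-a))" and W: "integrable lborel W"
  shows "(\<lambda>n. LINT v|lborel. b n * of_nat n powr (- Complex a v) * W v) sums
    (LINT v|lborel. (\<Sum>n. b n * of_nat n powr (- Complex a v)) * W v)"
proof -
  let ?f = "\<lambda>n v. b n * of_nat n powr (- Complex a v) * W v"
  have nf: "norm (?f n v) = cmod (b n) * real n powr (-a) * norm (W v)" for n v
    by (simp add: norm_mult cmod_nat_powr)
  have cont: "continuous_on UNIV (\<lambda>v. of_nat n powr (- Complex a v) :: complex)" for n
  proof (cases "n = 0")
    case False then show ?thesis unfolding Complex_eq by (intro continuous_intros) auto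
  qed simp
  have meas: "?f n \<in> borel_measurable lborel" for n
    using borel_measurable_continuous_onI[OF cont[of n]] borel_measurable_integrable[OF W] by measurable
  have int: "integrable lborel (?f n)" for n
  proof (rule Bochner_Integration.integrable_bound[OF _ meas])
    show "integrable lborel (\<lambda>v. cmod (b n) * real n powr (-a) * norm (W v))"
      using W by (intro integrable_mult_right integrable_norm)
    show "AE v in lborel. norm (?f n v) \<le> norm (cmod (b n) * real n powr (-a) * norm (W v))"
      unfolding nf by (intro AE_I2) simp
  qed
  have s1: "summable (\<lambda>n. norm (?f n v))" for v unfolding nf by (rule summable_mult2[OF b])
  have s2: "summable (\<lambda>n. LINT v|lborel. norm (?f n v))"
    unfolding nf by simp (rule summable_mult2[OF b])
  have eq: "(\<Sum>n. ?f n v) = (\<Sum>n. b n * of_nat n powr (- Complex a v)) * W v" for v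
  proof (rule suminf_mult2[symmetric])
    show "summable (\<lambda>n. b n * of_nat n powr (- Complex a v))"
      by (rule summable_norm_cancel) (use b in \<open>simp add: norm_mult cmod_nat_powr\<close>)
  qed
  show ?thesis using sums_integral[OF int AE_I2[OF s1] s2] unfolding eq .
qed

lemma nat_powr_gauss_kernel:
  assumes "n > 0"
  shows "of_nat n powr (-w) * gauss_kernel \<mu> w = gauss_kernel (\<mu> - ln (real n)) w"
  using assms unfolding gauss_kernel_def by (simp add: powr_def Ln_of_nat algebra_simps flip: exp_add)

section \<open>Smooth weights on Dirichlet series\<close>

definition smooth_cut :: "real \<Rightarrow> complex" where
  "smooth_cut \<mu> = (LINT v|lborel. gauss_kernel \<mu> (Complex 3 v) / Complex 3 v) / of_real (2 * pi)"

text \<open>A factor n^(-w) only replaces \<mu> by \<mu> - ln n in the kernel, so each term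
  integrates to a Gaussian in ln n.\<close>

lemma gauss_dseries:
  assumes b: "summable (\<lambda>n. cmod (b n) * real n powr (-a))" "b 0 = 0"
  shows "(\<lambda>n. b n * of_real (sqrt (2 * pi) * exp (- (\<mu> - ln (real n))\<^sup>2 / 2))) sums
    (LINT v|lborel. (\<Sum>n. b n * of_nat n powr (- Complex a v)) * gauss_kernel \<mu> (Complex a v))"
proof -
  have "(LINT v|lborel. b n * of_nat n powr (- Complex a v) * gauss_kernel \<mu> (Complex a v))
     = b n * of_real (sqrt (2 * pi) * exp (- (\<mu> - ln (real n))\<^sup>2 / 2))" for n
  proof (cases "n = 0")
    case False
    have "b n * of_nat n powr (- Complex a v) * gauss_kernel \<mu> (Complex a v) = b n * gauss_kernel (\<mu> - ln (real n)) (Complex a v)" for v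
      using nat_powr_gauss_kernel[of n "Complex a v" \<mu>] False by (simp add: mult.assoc)
    then have "(LINT v|lborel. b n * of_nat n powr (- Complex a v) * gauss_kernel \<mu> (Complex a v))
       = (LINT v|lborel. b n * gauss_kernel (\<mu> - ln (real n)) (Complex a v))" by (simp only:)
    then show ?thesis using gauss_kernel_integral[of "\<mu> - ln (real n)" a] by (simp only: integral_mult_right_zero)
  qed (use b in simp)
  then show ?thesis using dseries_integral[OF b(1) gauss_kernel_integrable, of \<mu> a] by simp
qed

lemma gauss_div_dseries:
  assumes b: "summable (\<lambda>n. cmod (b n) * real n powr (-3))" "b 0 = 0"
  shows "(\<lambda>n. b n * (2 * pi * smooth_cut (\<mu> - ln (real n)))) sums
    (LINT v|lborel. (\<Sum>n. b n * of_nat n powr (- Complex 3 v)) * (gauss_kernel \<mu> (Complex 3 v) / Complex 3 v))"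
proof -
  have "(LINT v|lborel. b n * of_nat n powr (- Complex 3 v) * (gauss_kernel \<mu> (Complex 3 v) / Complex 3 v))
     = b n * (2 * pi * smooth_cut (\<mu> - ln (real n)))" for n
  proof (cases "n = 0")
    case False
    have "b n * of_nat n powr (- Complex 3 v) * (gauss_kernel \<mu> (Complex 3 v) / Complex 3 v) = b n * (gauss_kernel (\<mu> - ln (real n)) (Complex 3 v) / Complex 3 v)" for v
      using nat_powr_gauss_kernel[of n "Complex 3 v" \<mu>] False by (simp add: mult.assoc)
    then have "(LINT v|lborel. b n * of_nat n powr (- Complex 3 v) * (gauss_kernel \<mu> (Complex 3 v) / Complex 3 v))
       = (LINT v|lborel. b n * (gauss_kernel (\<mu> - ln (real n)) (Complex 3 v) / Complex 3 v))" by (simp only:)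
    then show ?thesis by (simp only: integral_mult_right_zero) (simp add: smooth_cut_def)
  qed (use b in simp)
  then show ?thesis using dseries_integral[OF b(1) gauss_kernel_div_integrable[of 3], of \<mu>] by simp
qed

lemma kernel_div_integral_bound:
  assumes "a \<noteq> 0" "\<And>v. cmod (h v) \<le> B * exp (k * \<bar>v\<bar>)"
  shows "cmod (LINT v|lborel. h v * gauss_kernel \<mu> (Complex a v) / Complex a v)
    \<le> 4 * B * exp (k\<^sup>2) * exp (a\<^sup>2 / 2 + \<mu> * a) / \<bar>a\<bar> * integral\<^sup>L lborel inv_sq"
proof (rule vertical_integral_bound)
  fix v
  have B: "B \<ge> 0" using assms(2)[of 0] by (auto intro: order_trans[OF norm_ge_zero])
  have "cmod (h v * gauss_kernel \<mu> (Complex a v)) \<le> 4 * B * exp (k\<^sup>2) * exp (a\<^sup>2 / 2 + \<mu> * a) * inv_sq v"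
    using kernel_product_bound[of "h v" B k "Complex a v" \<mu>] assms(2)[of v] by simp
  then have "cmod (h v * gauss_kernel \<mu> (Complex a v) / Complex a v) \<le> (4 * B * exp (k\<^sup>2) * exp (a\<^sup>2 / 2 + \<mu> * a) * inv_sq v) / \<bar>a\<bar>"
    unfolding norm_divide using abs_Re_le_cmod[of "Complex a v"] assms(1) B inv_sq_pos[of v] by (intro frac_le) auto
  then show "cmod (h v * gauss_kernel \<mu> (Complex a v) / Complex a v) \<le> 4 * B * exp (k\<^sup>2) * exp (a\<^sup>2 / 2 + \<mu> * a) / \<bar>a\<bar> * inv_sq v"
    by (simp only: times_divide_eq_left)
qed

lemma kernel_integral_bound:
  assumes "\<And>v. cmod (h v) \<le> B * exp (k * \<bar>v\<bar>)"
  shows "cmod (LINT v|lborel. h v * gauss_kernel \<mu> (Complex a v))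
    \<le> 4 * B * exp (k\<^sup>2) * exp (a\<^sup>2 / 2 + \<mu> * a) * integral\<^sup>L lborel inv_sq"
  by (rule vertical_integral_bound) (use kernel_product_bound[of "h v" B k "Complex a v" \<mu> for v] assms in simp)

lemma inv_sq_integral_nonneg: "integral\<^sup>L lborel inv_sq \<ge> 0"
  using inv_sq_pos by (intro Bochner_Integration.integral_nonneg) (simp add: less_imp_le)

text \<open>A smooth substitute for the indicator of \<mu> > 0: the line Re w = 3 shows decay to the
  left, and moving to Re w = -3 picks up the residue 1 and shows rapid approach to 1 on the
  right.\<close>

lemma smooth_cut_bounds:
  "\<exists>C\<ge>1. \<forall>\<mu>. cmod (smooth_cut \<mu>) \<le> C * exp (3 * \<mu>) \<and> cmod (smooth_cut \<mu> - 1) \<le> C * exp (- 3 * \<mu>)"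
proof -
  define J where "J = integral\<^sup>L lborel inv_sq"
  define C where "C = 4 * exp (9/2) / 3 * J / (2 * pi) + 1"
  have J: "J \<ge> 0" unfolding J_def by (rule inv_sq_integral_nonneg)
  have up: "cmod (smooth_cut \<mu>) \<le> C * exp (3 * \<mu>)" for \<mu>
  proof -
    have "cmod (LINT v|lborel. 1 * gauss_kernel \<mu> (Complex 3 v) / Complex 3 v) \<le> 4 * 1 * exp (0\<^sup>2) * exp (3\<^sup>2 / 2 + \<mu> * 3) / \<bar>3\<bar> * J"
      unfolding J_def by (rule kernel_div_integral_bound) auto
    also have "\<dots> = (4 * exp (9/2) / 3 * J) * exp (3 * \<mu>)" by (simp add: exp_add mult_ac)
    finally have i: "cmod (LINT v|lborel. 1 * gauss_kernel \<mu> (Complex 3 v) / Complex 3 v) \<le> (4 * exp (9/2) / 3 * J) * exp (3 * \<mu>)" .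
    have "cmod (smooth_cut \<mu>) = cmod (LINT v|lborel. 1 * gauss_kernel \<mu> (Complex 3 v) / Complex 3 v) / (2 * pi)"
      by (simp add: smooth_cut_def norm_divide norm_mult)
    also have "\<dots> \<le> (4 * exp (9/2) / 3 * J) * exp (3 * \<mu>) / (2 * pi)"
      by (intro divide_right_mono i) simp
    also have "\<dots> = (4 * exp (9/2) / 3 * J / (2 * pi)) * exp (3 * \<mu>)" by (simp only: times_divide_eq_left)
    also have "\<dots> \<le> C * exp (3 * \<mu>)" unfolding C_def by (intro mult_right_mono) auto
    finally show ?thesis .
  qed
  have lo: "cmod (smooth_cut \<mu> - 1) \<le> C * exp (- 3 * \<mu>)" for \<mu>
  proof -
    have "(LINT v|lborel. 1 * gauss_kernel \<mu> (Complex 3 v) / Complex 3 v) = complex_of_real (2 * pi) * 1 + (LINT v|lborel. 1 * gauss_kernel \<mu> (Complex (-3) v) / Complex (-3) v)"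
      using gauss_residue[where h="\<lambda>_. 1" and \<alpha>="-4" and ?c0.0="-3" and ?c1.0=3 and B=1 and k=0 and \<mu>=\<mu>] by simp
    then have e: "smooth_cut \<mu> - 1 = (LINT v|lborel. 1 * gauss_kernel \<mu> (Complex (-3) v) / Complex (-3) v) / of_real (2 * pi)"
      unfolding smooth_cut_def by (simp add: field_simps)
    have "cmod (LINT v|lborel. 1 * gauss_kernel \<mu> (Complex (-3) v) / Complex (-3) v) \<le> 4 * 1 * exp (0\<^sup>2) * exp ((-3)\<^sup>2 / 2 + \<mu> * (-3)) / \<bar>-3\<bar> * J"
      unfolding J_def by (rule kernel_div_integral_bound) auto
    also have "exp ((-3)\<^sup>2 / 2 + \<mu> * (-3)) = exp (9/2) * exp (- 3 * \<mu>)" by (simp flip: exp_add)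
    also have "4 * 1 * exp (0\<^sup>2) * (exp (9/2) * exp (- 3 * \<mu>)) / \<bar>-3\<bar> * J = (4 * exp (9/2) / 3 * J) * exp (- 3 * \<mu>)" by simp
    finally have i: "cmod (LINT v|lborel. 1 * gauss_kernel \<mu> (Complex (-3) v) / Complex (-3) v) \<le> (4 * exp (9/2) / 3 * J) * exp (- 3 * \<mu>)" .
    have "cmod (smooth_cut \<mu> - 1) = cmod (LINT v|lborel. 1 * gauss_kernel \<mu> (Complex (-3) v) / Complex (-3) v) / (2 * pi)"
      unfolding e by (simp add: norm_divide norm_mult)
    also have "\<dots> \<le> (4 * exp (9/2) / 3 * J) * exp (- 3 * \<mu>) / (2 * pi)"
      by (intro divide_right_mono i) simp
    also have "\<dots> = (4 * exp (9/2) / 3 * J / (2 * pi)) * exp (- 3 * \<mu>)" by (simp only: times_divide_eq_left)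
    also have "\<dots> \<le> C * exp (- 3 * \<mu>)" unfolding C_def by (intro mult_right_mono) auto
    finally show ?thesis .
  qed
  have "C \<ge> 1" unfolding C_def using J by simp
  then show ?thesis using up lo by blast
qed

definition gauss_weight :: "real \<Rightarrow> nat \<Rightarrow> real" where
  "gauss_weight \<mu> n = exp (- (\<mu> - ln (real n))\<^sup>2 / 2)"

lemma gauss_weight_pos: "gauss_weight \<mu> n > 0" and gauss_weight_le_1: "gauss_weight \<mu> n \<le> 1"
  by (simp_all add: gauss_weight_def)

lemma gauss_weight_summable: "summable (gauss_weight \<mu>)"
proof -
  \<comment> \<open>Since \<open>ln 0 = 0\<close>, the weight at 0 is not zero; the coefficient is
    switched off there to fit the series lemma.\<close>
  let ?b = "\<lambda>n::nat. if n = 0 then 0 else 1 :: complex"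
  have "summable (\<lambda>n. cmod (?b n) * real n powr (-2))"
  proof (rule summable_cong[THEN iffD2])
    show "\<forall>\<^sub>F n in sequentially. cmod (?b n) * real n powr (-2) = real n powr (-2)"
      using eventually_gt_at_top[of 0] by eventually_elim auto
  qed (simp add: summable_real_powr_iff)
  from sums_summable[OF gauss_dseries[OF this]]
  have "summable (\<lambda>n. ?b n * of_real (sqrt (2 * pi) * gauss_weight \<mu> n))" unfolding gauss_weight_def by simp
  moreover have "\<forall>\<^sub>F n in sequentially. ?b n * of_real (sqrt (2 * pi) * gauss_weight \<mu> n) = complex_of_real (sqrt (2 * pi) * gauss_weight \<mu> n)"
    using eventually_gt_at_top[of 0] by eventually_elim auto
  ultimately have "summable (\<lambda>n. complex_of_real (sqrt (2 * pi) * gauss_weight \<mu> n))"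
    using summable_cong by fast
  then have "summable (\<lambda>n. sqrt (2 * pi) * gauss_weight \<mu> n)" by (simp only: summable_complex_of_real)
  then show ?thesis by (simp add: summable_cmult_iff)
qed

abbreviation on_primes :: "(nat \<Rightarrow> 'a) \<Rightarrow> nat \<Rightarrow> 'a::zero" where
  "on_primes f \<equiv> \<lambda>p. if prime p then f p else 0"

lemma prime_sum_alt: "prime_sum chi w = (\<Sum>n. on_primes chi n * of_nat n powr (-w))"
  unfolding prime_sum_def dterm_def by (intro suminf_cong) auto

section \<open>Square-root cancellation and truncation of log L\<close>

lemma char_prime_gauss_sum:
  assumes "GRH" "e > 0"
  shows "\<exists>K>0. \<forall>q chi \<mu>. dirichlet_char q chi \<and> \<not> principal_char q chi \<longrightarrow>
    cmod (\<Sum>p. on_primes chi p * of_real (gauss_weight \<mu> p)) \<le> K * ln (real q) * exp ((1/2 + e) * \<mu>)"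
proof -
  define c0 where "c0 = 1/2 + e"
  define c1 where "c1 = 2 + e"
  have c: "1/2 < c0" "c0 < c1" "c1 > 1" using assms by (auto simp: c0_def c1_def)
  obtain K where K: "K > 0" "\<And>q chi G w. dirichlet_char q chi \<Longrightarrow> \<not> principal_char q chi \<Longrightarrow> log_branch chi G \<Longrightarrow> Re w \<ge> c0
     \<Longrightarrow> cmod (G w) \<le> K * ln (real q) * (1 + \<bar>Im w\<bar>)"
    using log_branch_bound[OF c(1)] by metis
  define J where "J = integral\<^sup>L lborel inv_sq"
  have J: "J \<ge> 0" unfolding J_def by (rule inv_sq_integral_nonneg)
  define K' where "K' = 4 * K * exp 1 * exp (c0\<^sup>2 / 2) * J / sqrt (2 * pi) + 1"
  have "K' > 0" unfolding K'_def using K(1) J by (simp add: add_nonneg_pos)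
  moreover have "cmod (\<Sum>p. on_primes chi p * of_real (gauss_weight \<mu> p)) \<le> K' * ln (real q) * exp ((1/2 + e) * \<mu>)"
    if ch: "dirichlet_char q chi" "\<not> principal_char q chi" for q chi \<mu>
  proof -
    obtain G where G: "log_branch chi G" using log_branch_exists[OF assms(1) ch] by blast
    have lq: "ln (real q) \<ge> 1" by (rule ln_modulus_ge_1[OF ch])
    note cm = dirichlet_char_comp_mult[OF ch(1)]
    define B where "B = K * ln (real q)"
    have bd: "cmod (G w) \<le> B * exp (1 * \<bar>Im w\<bar>)" if "Re w \<ge> c0" for w
    proof -
      have "B * (1 + \<bar>Im w\<bar>) \<le> B * exp (1 * \<bar>Im w\<bar>)"
        using K(1) lq exp_ge_add_one_self[of "\<bar>Im w\<bar>"] unfolding B_def by (intro mult_left_mono) auto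
      then show ?thesis using K(2)[OF ch G that] unfolding B_def by linarith
    qed
    have shift: "(LINT v|lborel. G (Complex c0 v) * gauss_kernel \<mu> (Complex c0 v)) = (LINT v|lborel. G (Complex c1 v) * gauss_kernel \<mu> (Complex c1 v))"
      by (rule gauss_shift[of G "1/2" c0 c1 B 1]) (use G c bd in \<open>auto simp: log_branch_def\<close>)
    have Gc1: "G (Complex c1 v) = (\<Sum>n. on_primes chi n * of_nat n powr (- Complex c1 v))" for v
      using G c unfolding log_branch_def by (simp flip: prime_sum_alt)
    have sm: "summable (\<lambda>n. cmod (on_primes chi n) * real n powr (-c1))"
    proof (rule summable_comparison_test')
      show "summable (\<lambda>n. real n powr (-c1))" using c by (simp add: summable_real_powr_iff)
      show "norm (cmod (on_primes chi n) * real n powr (-c1)) \<le> real n powr (-c1)" if "n \<ge> 0" for n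
        using cm by (simp add: comp_mult_def mult_left_le_one_le)
    qed
    have "(\<lambda>n. on_primes chi n * of_real (sqrt (2 * pi) * gauss_weight \<mu> n)) sums (LINT v|lborel. G (Complex c0 v) * gauss_kernel \<mu> (Complex c0 v))"
      using gauss_dseries[OF sm, of \<mu>] unfolding shift Gc1 gauss_weight_def by simp
    then have "(\<lambda>n. of_real (sqrt (2 * pi)) * (on_primes chi n * of_real (gauss_weight \<mu> n))) sums (LINT v|lborel. G (Complex c0 v) * gauss_kernel \<mu> (Complex c0 v))"
      by (simp add: mult_ac)
    then have "(\<lambda>n. (of_real (sqrt (2 * pi)) * (on_primes chi n * of_real (gauss_weight \<mu> n))) / of_real (sqrt (2 * pi))) sums ((LINT v|lborel. G (Complex c0 v) * gauss_kernel \<mu> (Complex c0 v)) / of_real (sqrt (2 * pi)))"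
      by (rule sums_divide)
    then have "(\<lambda>n. on_primes chi n * of_real (gauss_weight \<mu> n)) sums ((LINT v|lborel. G (Complex c0 v) * gauss_kernel \<mu> (Complex c0 v)) / of_real (sqrt (2 * pi)))"
      by simp
    then have "(\<Sum>n. on_primes chi n * of_real (gauss_weight \<mu> n)) = (LINT v|lborel. G (Complex c0 v) * gauss_kernel \<mu> (Complex c0 v)) / of_real (sqrt (2 * pi))"
      by (rule sums_unique[symmetric])
    then have "cmod (\<Sum>n. on_primes chi n * of_real (gauss_weight \<mu> n)) = cmod (LINT v|lborel. G (Complex c0 v) * gauss_kernel \<mu> (Complex c0 v)) / sqrt (2 * pi)"
      by (simp only: norm_divide norm_of_real abs_of_nonneg real_sqrt_ge_zero pi_ge_zero mult_nonneg_nonneg zero_le_numeral)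
    also have "\<dots> \<le> (4 * B * exp (1\<^sup>2) * exp (c0\<^sup>2 / 2 + \<mu> * c0) * J) / sqrt (2 * pi)"
      unfolding J_def by (intro divide_right_mono kernel_integral_bound bd) (use bd[of "Complex c0 v" for v] in auto)
    also have "\<dots> = (4 * K * exp 1 * exp (c0\<^sup>2 / 2) * J / sqrt (2 * pi)) * (ln (real q) * exp (c0 * \<mu>))"
      unfolding B_def exp_add by (simp add: mult_ac)
    also have "\<dots> \<le> K' * (ln (real q) * exp (c0 * \<mu>))"
      unfolding K'_def using lq by (intro mult_right_mono) auto
    finally show ?thesis unfolding c0_def by (simp add: mult.assoc)
  qed
  ultimately show ?thesis by blast
qed

text \<open>Shifting from Re w = 3 to Re w = -a crosses the pole of 1/w, whose residue is the
  logarithm at s without prime powers. The remainder log q e^(-a\<mu>) is O(1) as soon as e^\<mu> is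
  a suitable power of log q.\<close>

lemma log_L_approx:
  assumes "GRH" "Re s > 1/2"
  shows "\<exists>K>0. \<exists>a>0. \<forall>q chi \<mu>. dirichlet_char q chi \<and> \<not> principal_char q chi \<longrightarrow>
    summable (\<lambda>p. on_primes (dterm chi s) p * smooth_cut (\<mu> - ln (real p))) \<and>
    \<bar>ln (cmod (Lfun chi s)) - Re (\<Sum>p. on_primes (dterm chi s) p * smooth_cut (\<mu> - ln (real p)))\<bar>
      \<le> K * (1 + ln (real q) * exp (- a * \<mu>))"
proof -
  \<comment> \<open>The shifted point s + w then has real part halfway between 1/2 and Re s.\<close>
  define a where "a = (Re s - 1/2) / 2"
  define c0 where "c0 = Re s - a"
  have a: "a > 0" and c0: "c0 > 1/2" "c0 \<le> Re s" using assms by (auto simp: a_def c0_def field_simps)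
  obtain K where K: "K > 0" "\<And>q chi G w. dirichlet_char q chi \<Longrightarrow> \<not> principal_char q chi \<Longrightarrow> log_branch chi G \<Longrightarrow> Re w \<ge> c0
     \<Longrightarrow> cmod (G w) \<le> K * ln (real q) * (1 + \<bar>Im w\<bar>)"
    using log_branch_bound[OF c0(1)] by metis
  define J where "J = integral\<^sup>L lborel inv_sq"
  have J: "J \<ge> 0" unfolding J_def by (rule inv_sq_integral_nonneg)
  define K1 where "K1 = 4 * K * (1 + \<bar>Im s\<bar>) * exp 1 * exp (a\<^sup>2 / 2) / a * J / (2 * pi)"
  define C2 where "C2 = 4 * (\<Sum>n. real n powr (-2*c0))"
  have K1: "K1 \<ge> 0" unfolding K1_def using K(1) J a by (intro divide_nonneg_nonneg mult_nonneg_nonneg) auto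
  have C2: "C2 \<ge> 0" unfolding C2_def using c0 by (intro mult_nonneg_nonneg suminf_nonneg) (auto simp: summable_real_powr_iff)
  define K' where "K' = K1 + C2 + 1"
  have "K' > 0" unfolding K'_def using K1 C2 by linarith
  moreover have "summable (\<lambda>p. on_primes (dterm chi s) p * smooth_cut (\<mu> - ln (real p))) \<and>
    \<bar>ln (cmod (Lfun chi s)) - Re (\<Sum>p. on_primes (dterm chi s) p * smooth_cut (\<mu> - ln (real p)))\<bar>
      \<le> K' * (1 + ln (real q) * exp (- a * \<mu>))"
    if ch: "dirichlet_char q chi" "\<not> principal_char q chi" for q chi \<mu>
  proof -
    obtain G where G: "log_branch chi G" using log_branch_exists[OF assms(1) ch] by blast
    have lq: "ln (real q) \<ge> 1" by (rule ln_modulus_ge_1[OF ch])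
    note cm = dirichlet_char_comp_mult[OF ch(1)]
    define B where "B = K * ln (real q) * (1 + \<bar>Im s\<bar>)"
    define h where "h w = G (s + w)" for w
    have hol: "h holomorphic_on {w. Re w > 1/2 - Re s}"
    proof -
      have "G \<circ> (\<lambda>w. s + w) holomorphic_on {w. Re w > 1/2 - Re s}"
        by (rule holomorphic_on_compose_gen[where t="{w. Re w > 1/2}"])
           (use G in \<open>auto simp: log_branch_def intro!: holomorphic_intros\<close>)
      then show ?thesis by (simp add: h_def[abs_def] o_def)
    qed
    have bd: "cmod (h w) \<le> B * exp (1 * \<bar>Im w\<bar>)" if "Re w \<ge> -a" for w
    proof -
      have "cmod (h w) \<le> K * ln (real q) * (1 + \<bar>Im (s + w)\<bar>)"
        unfolding h_def by (rule K(2)[OF ch G]) (use that in \<open>simp add: c0_def\<close>)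
      also have "\<dots> \<le> K * ln (real q) * ((1 + \<bar>Im s\<bar>) * (1 + \<bar>Im w\<bar>))"
      proof (intro mult_left_mono)
        have "(1 + \<bar>Im s\<bar>) * (1 + \<bar>Im w\<bar>) = 1 + (\<bar>Im s\<bar> + \<bar>Im w\<bar>) + \<bar>Im s\<bar> * \<bar>Im w\<bar>" by (simp only: algebra_simps mult_1)
        moreover have "\<bar>Im s\<bar> * \<bar>Im w\<bar> \<ge> 0" by (intro mult_nonneg_nonneg) auto
        moreover have "\<bar>Im (s + w)\<bar> \<le> \<bar>Im s\<bar> + \<bar>Im w\<bar>" by simp
        ultimately show "1 + \<bar>Im (s + w)\<bar> \<le> (1 + \<bar>Im s\<bar>) * (1 + \<bar>Im w\<bar>)" by linarith
      qed (use K(1) lq in auto)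
      also have "\<dots> = B * (1 + \<bar>Im w\<bar>)" by (simp add: B_def mult_ac)
      also have "\<dots> \<le> B * exp (1 * \<bar>Im w\<bar>)"
        using K(1) lq exp_ge_add_one_self[of "\<bar>Im w\<bar>"] unfolding B_def by (intro mult_left_mono) auto
      finally show ?thesis .
    qed
    let ?R = "LINT v|lborel. h (Complex (-a) v) * gauss_kernel \<mu> (Complex (-a) v) / Complex (-a) v"
    have res: "(LINT v|lborel. h (Complex 3 v) * gauss_kernel \<mu> (Complex 3 v) / Complex 3 v) = 2 * pi * h 0 + ?R"
    proof (rule gauss_residue[OF hol, of _ _ B 1])
      show "1/2 - Re s < -a" using assms by (simp add: a_def field_simps)
    qed (use a bd in auto)
    let ?b = "on_primes (dterm chi s)"
    have hc: "h (Complex 3 v) = (\<Sum>n. ?b n * of_nat n powr (- Complex 3 v))" for v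
    proof -
      have "h (Complex 3 v) = prime_sum chi (s + Complex 3 v)"
        using G c0 unfolding log_branch_def h_def by simp
      also have "\<dots> = (\<Sum>n. ?b n * of_nat n powr (- Complex 3 v))"
      proof -
        have "of_nat n powr (- (s + Complex 3 v)) = (of_nat n powr (-s) * of_nat n powr (- Complex 3 v) :: complex)" for n
          unfolding powr_add[symmetric] by simp
        then show ?thesis unfolding prime_sum_alt by (intro suminf_cong) (simp add: dterm_def)
      qed
      finally show ?thesis .
    qed
    have sm: "summable (\<lambda>n. cmod (?b n) * real n powr (-3))"
    proof (rule summable_comparison_test')
      show "summable (\<lambda>n. real n powr (-3))" by (simp add: summable_real_powr_iff)
      fix n :: nat
      have "cmod (?b n) \<le> 1"
      proof (cases "prime n")
        case True
        have "real n powr (-Re s) \<le> real n powr 0" using prime_ge_2_nat[OF True] assms by (intro powr_mono) auto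
        then show ?thesis using True dterm_norm[OF cm, of s n] prime_gt_0_nat[OF True] by simp
      qed simp
      then show "norm (cmod (?b n) * real n powr (-3)) \<le> real n powr (-3)" by (simp add: mult_left_le_one_le)
    qed
    let ?I = "LINT v|lborel. h (Complex 3 v) * gauss_kernel \<mu> (Complex 3 v) / Complex 3 v"
    have "(\<lambda>n. ?b n * (2 * pi * smooth_cut (\<mu> - ln (real n)))) sums ?I"
      using gauss_div_dseries[OF sm, of \<mu>] unfolding hc by simp
    then have "(\<lambda>n. ?b n * (2 * pi * smooth_cut (\<mu> - ln (real n))) / of_real (2 * pi)) sums (?I / of_real (2 * pi))"
      by (rule sums_divide)
    moreover have "?b n * (2 * pi * smooth_cut (\<mu> - ln (real n))) / of_real (2 * pi) = ?b n * smooth_cut (\<mu> - ln (real n))" for n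
      by simp
    ultimately have su: "(\<lambda>n. ?b n * smooth_cut (\<mu> - ln (real n))) sums (?I / of_real (2 * pi))" by simp
    have I: "?I / of_real (2 * pi) = G s + ?R / of_real (2 * pi)"
      unfolding res by (simp add: h_def add_divide_distrib)
    have "cmod ?R \<le> 4 * B * exp (1\<^sup>2) * exp ((-a)\<^sup>2 / 2 + \<mu> * (-a)) / \<bar>-a\<bar> * J"
      unfolding J_def by (rule kernel_div_integral_bound) (use a bd[of "Complex (-a) v" for v] in auto)
    then have "cmod ?R / (2 * pi) \<le> (4 * B * exp (1\<^sup>2) * exp ((-a)\<^sup>2 / 2 + \<mu> * (-a)) / \<bar>-a\<bar> * J) / (2 * pi)"
      by (rule divide_right_mono) simp
    also have "\<dots> = K1 * (ln (real q) * exp (- a * \<mu>))"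
      unfolding K1_def B_def exp_add using a by (simp add: mult_ac)
    finally have R: "cmod (?R / of_real (2 * pi)) \<le> K1 * (ln (real q) * exp (- a * \<mu>))"
      by (simp add: norm_divide norm_mult)
    have "Lfun chi s = exp (G s + prime_power_sum chi s)" using G assms(2) unfolding log_branch_def by blast
    then have L: "ln (cmod (Lfun chi s)) = Re (G s) + Re (prime_power_sum chi s)" by simp
    have H: "\<bar>Re (prime_power_sum chi s)\<bar> \<le> C2"
      using abs_Re_le_cmod[of "prime_power_sum chi s"] prime_power_sum_bound(2)[OF cm c0(2,1)] unfolding C2_def by linarith
    have "(\<Sum>p. ?b p * smooth_cut (\<mu> - ln (real p))) = G s + ?R / of_real (2 * pi)"
      using sums_unique[OF su] I by simp
    then have "ln (cmod (Lfun chi s)) - Re (\<Sum>p. ?b p * smooth_cut (\<mu> - ln (real p))) = Re (prime_power_sum chi s) - Re (?R / of_real (2 * pi))"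
      unfolding L by (simp only: plus_complex.sel)
    then have "\<bar>ln (cmod (Lfun chi s)) - Re (\<Sum>p. ?b p * smooth_cut (\<mu> - ln (real p)))\<bar> \<le> C2 + K1 * (ln (real q) * exp (- a * \<mu>))"
      using H abs_Re_le_cmod[of "?R / of_real (2 * pi)"] R by linarith
    also have "\<dots> \<le> K' * 1 + K' * (ln (real q) * exp (- a * \<mu>))"
      unfolding K'_def using K1 C2 lq by (intro add_mono mult_right_mono) auto
    finally show ?thesis using sums_summable[OF su] by (simp add: distrib_left)
  qed
  ultimately show ?thesis using a by blast
qed

subsection \<open>Prime numbers in short multiplicative blocks\<close>

definition log_gauss :: "real \<Rightarrow> nat \<Rightarrow> real" where
  "log_gauss \<mu> = on_primes (\<lambda>p. ln (real p) * gauss_weight \<mu> p)"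

lemma log_gauss_nonneg: "log_gauss \<mu> n \<ge> 0"
  unfolding log_gauss_def using prime_gt_0_nat[of n] gauss_weight_pos[of \<mu> n]
  by (auto intro!: mult_nonneg_nonneg simp: less_imp_le Suc_le_eq)

lemma log_primes_summable: "summable (\<lambda>n. on_primes (\<lambda>p. ln (real p)) n * real n powr (-2))"
proof -
  have s: "(\<lambda>p. if prime p then of_real (ln (real p)) * dterm one 2 p else 0) sums (- deriv (prime_sum one) 2)"
    by (rule deriv_prime_sum_one) simp
  have E: "(if prime p then of_real (ln (real p)) * dterm one 2 p else 0) = complex_of_real (on_primes (\<lambda>p. ln (real p)) p * real p powr (-2))" for p
    using powr_of_real[of "real p" "-2"] by (simp add: dterm_def)
  show ?thesis using sums_summable[OF s[unfolded E]] by (simp only: summable_complex_of_real)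
qed

text \<open>The twist by exp(i\<xi> ln p) moves the pole of the logarithmic derivative to 1 +
  i\<xi>, and its residue dominates. With density e^u du for the primes at ln p = u, the Gaussian
  weight centred at \<mu> peaks at \<mu> + 1, which explains the centring. The limit is a multiple
  of a normal characteristic function.\<close>

lemma log_gauss_sums:
  assumes "GRH"
  shows "summable (log_gauss \<mu>)"
    and "((\<lambda>\<mu>. (\<Sum>p. of_real (log_gauss \<mu> p) * cis (\<xi> * (ln (real p) - \<mu> - 1))) / of_real (exp \<mu>))
      \<longlongrightarrow> of_real (sqrt (2 * pi) * exp ((1 - \<xi>\<^sup>2) / 2))) at_top"
proof -
  obtain F M where F: "F holomorphic_on {w. Re w > 1/2}"
    and Feq: "\<And>w. Re w > 1 \<Longrightarrow> F w = 1 / (w - 1) + deriv (prime_sum one) w"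
    and FM: "\<And>w. 3/4 \<le> Re w \<Longrightarrow> Re w \<le> 2 \<Longrightarrow> cmod (F w) \<le> M * exp \<bar>Im w\<bar>"
    using zeta_log_derivative[OF assms, of "3/4"] by auto
  define J where "J = integral\<^sup>L lborel inv_sq"
  define b where "b \<xi> p = (if prime p then of_real (ln (real p)) * cis (\<xi> * ln (real p)) else 0)" for \<xi> p
  have bnorm: "cmod (b \<xi> n) = on_primes (\<lambda>p. ln (real p)) n" for \<xi> n
    using prime_gt_0_nat[of n] by (auto simp: b_def norm_mult)
  have bs: "summable (\<lambda>n. cmod (b \<xi> n) * real n powr (-2))" for \<xi>
    unfolding bnorm by (rule log_primes_summable)
  have b0: "b \<xi> 0 = 0" for \<xi> by (simp add: b_def)
  have bl: "b \<xi> n * of_real (sqrt (2 * pi) * gauss_weight \<mu> n) = of_real (sqrt (2 * pi)) * (of_real (log_gauss \<mu> n) * cis (\<xi> * ln (real n)))" for \<xi> \<mu> n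
    by (simp add: b_def log_gauss_def mult_ac)
  define U where "U \<xi> \<mu> = (LINT v|lborel. (\<Sum>n. b \<xi> n * of_nat n powr (- Complex 2 v)) * gauss_kernel \<mu> (Complex 2 v))" for \<xi> \<mu>
  have Us: "(\<lambda>n. of_real (sqrt (2 * pi)) * (of_real (log_gauss \<mu> n) * cis (\<xi> * ln (real n)))) sums U \<xi> \<mu>" for \<xi> \<mu>
    using gauss_dseries[OF bs[of \<xi>] b0[of \<xi>], of \<mu>]
    unfolding U_def gauss_weight_def[symmetric] bl .
  show "summable (log_gauss \<mu>)"
  proof -
    have "summable (\<lambda>n. complex_of_real (sqrt (2 * pi) * log_gauss \<mu> n))"
      using sums_summable[OF Us[of \<mu> 0]] by simp
    then have "summable (\<lambda>n. sqrt (2 * pi) * log_gauss \<mu> n)" by (simp only: summable_complex_of_real)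
    then show ?thesis by (simp add: summable_cmult_iff)
  qed
  have M: "M \<ge> 0" using FM[of 1] by (auto intro: order_trans[OF norm_ge_zero])
  define h1 where "h1 w = F (w - \<i> * of_real \<xi>)" for w
  define h2 where "h2 w = exp (\<i> * of_real \<xi> * w)" for w :: complex
  have h1hol: "h1 holomorphic_on {w. Re w > 1/2}"
  proof -
    have "F \<circ> (\<lambda>w. w - \<i> * of_real \<xi>) holomorphic_on {w. Re w > 1/2}"
      by (rule holomorphic_on_compose_gen[OF _ F]) (auto intro!: holomorphic_intros)
    then show ?thesis by (simp add: h1_def[abs_def] o_def)
  qed
  have h1b: "cmod (h1 w) \<le> (M * exp \<bar>\<xi>\<bar>) * exp (1 * \<bar>Im w\<bar>)" if "3/4 \<le> Re w" "Re w \<le> 2" for w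
  proof -
    have "cmod (h1 w) \<le> M * exp \<bar>Im (w - \<i> * of_real \<xi>)\<bar>" unfolding h1_def by (rule FM) (use that in auto)
    also have "\<dots> \<le> M * exp (\<bar>\<xi>\<bar> + \<bar>Im w\<bar>)" using M by (intro mult_left_mono) auto
    finally show ?thesis by (simp add: exp_add mult_ac)
  qed
  have h2b: "cmod (h2 w) \<le> 1 * exp (\<bar>\<xi>\<bar> * \<bar>Im w\<bar>)" for w
    unfolding h2_def norm_exp_eq_Re by (simp add: abs_mult[symmetric] flip: minus_mult_left)
  have h2hol: "h2 holomorphic_on A" for A unfolding h2_def[abs_def] by (intro holomorphic_intros)
  define R1 where "R1 \<mu> = (LINT v|lborel. h1 (Complex (3/4) v) * gauss_kernel \<mu> (Complex (3/4) v))" for \<mu>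
  define R2 where "R2 \<mu> = (LINT v|lborel. h2 (Complex (-1) v) * gauss_kernel \<mu> (Complex (-1) v) / Complex (-1) v)" for \<mu>
  have main: "U \<xi> \<mu> = gauss_kernel \<mu> (Complex 1 \<xi>) * (2 * pi + R2 (\<mu> + 1)) - R1 \<mu>" for \<mu>
  proof -
    have D: "(\<Sum>n. b \<xi> n * of_nat n powr (- Complex 2 v)) = 1 / Complex 1 (v - \<xi>) - h1 (Complex 2 v)" for v
    proof -
      have e: "Complex 2 v - \<i> * of_real \<xi> = Complex 2 (v - \<xi>)" by (simp add: complex_eq_iff)
      have "(\<lambda>p. if prime p then of_real (ln (real p)) * dterm one (Complex 2 (v - \<xi>)) p else 0) sums (- deriv (prime_sum one) (Complex 2 (v - \<xi>)))"
        by (rule deriv_prime_sum_one) simp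
      moreover have "(if prime p then of_real (ln (real p)) * dterm one (Complex 2 (v - \<xi>)) p else 0) = b \<xi> p * of_nat p powr (- Complex 2 v)" for p
      proof (cases "prime p")
        case True
        have "of_nat p powr (- Complex 2 (v - \<xi>)) = (of_nat p powr (- Complex 2 v + \<i> * of_real \<xi>) :: complex)"
          unfolding e[symmetric] by simp
        also have "\<dots> = of_nat p powr (- Complex 2 v) * of_nat p powr (\<i> * of_real \<xi>)" by (rule powr_add)
        also have "(of_nat p powr (\<i> * of_real \<xi>) :: complex) = cis (\<xi> * ln (real p))"
          using prime_gt_0_nat[OF True] by (simp add: powr_def Ln_of_nat cis_conv_exp mult_ac)
        finally show ?thesis using True by (simp add: b_def dterm_def mult_ac)
      qed (simp add: b_def)
      ultimately have "(\<lambda>p. b \<xi> p * of_nat p powr (- Complex 2 v)) sums (- deriv (prime_sum one) (Complex 2 (v - \<xi>)))" by simp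
      then have "(\<Sum>n. b \<xi> n * of_nat n powr (- Complex 2 v)) = - deriv (prime_sum one) (Complex 2 (v - \<xi>))"
        by (rule sums_unique[symmetric])
      also have "\<dots> = 1 / (Complex 2 (v - \<xi>) - 1) - F (Complex 2 (v - \<xi>))" using Feq[of "Complex 2 (v - \<xi>)"] by simp
      also have "Complex 2 (v - \<xi>) - 1 = Complex 1 (v - \<xi>)" by (simp add: complex_eq_iff)
      finally show ?thesis unfolding h1_def e .
    qed
    \<comment> \<open>Expanding the exponent at (1 + i\<xi>) + w with w = 1 + iv: the cross term (1
      + i\<xi>) w raises \<mu> by 1 and creates \<open>h2\<close>.\<close>
    have k: "gauss_kernel \<mu> (Complex 2 (v + \<xi>)) = gauss_kernel \<mu> (Complex 1 \<xi>) * (h2 (Complex 1 v) * gauss_kernel (\<mu> + 1) (Complex 1 v))" for v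
      unfolding gauss_kernel_def h2_def exp_add[symmetric]
      by (rule arg_cong[of _ _ exp]) (simp add: complex_eq_iff power2_eq_square field_simps)
    let ?A = "\<lambda>v. h2 (Complex 1 v) * gauss_kernel (\<mu> + 1) (Complex 1 v) / Complex 1 v"
    let ?B = "\<lambda>v. gauss_kernel \<mu> (Complex 2 v) / Complex 1 (v - \<xi>)"
    have BA: "?B (\<xi> + 1 * v) = gauss_kernel \<mu> (Complex 1 \<xi>) * ?A v" for v using k[of v] by (simp add: add.commute)
    obtain M2 where s2: "strip_decay (\<lambda>w. h2 w * gauss_kernel (\<mu> + 1) w) (-2) (-1) 1 M2"
      using strip_decay_kernel[of h2 "-2" "-1" 1 1 "\<bar>\<xi>\<bar>" "\<mu> + 1"] h2hol h2b by auto
    have iA: "integrable lborel ?A" using strip_decay.integrable_vertical_div[OF s2, of 1] by simp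
    have "integrable lborel (\<lambda>v. ?B (\<xi> + 1 * v))" unfolding BA by (intro integrable_mult_right iA)
    then have iB: "integrable lborel ?B" by (subst (asm) lborel_integrable_real_affine_iff) auto
    obtain M1 where s1: "strip_decay (\<lambda>w. h1 w * gauss_kernel \<mu> w) (1/2) (3/4) 2 M1"
      using strip_decay_kernel[of h1 "1/2" "3/4" 2 "M * exp \<bar>\<xi>\<bar>" 1 \<mu>] h1hol h1b by auto
    have i1: "integrable lborel (\<lambda>v. h1 (Complex 2 v) * gauss_kernel \<mu> (Complex 2 v))"
      using strip_decay.integrable_vertical[OF s1, of 2] by simp
    have "U \<xi> \<mu> = (LINT v|lborel. ?B v - h1 (Complex 2 v) * gauss_kernel \<mu> (Complex 2 v))"
      unfolding U_def D by (simp add: left_diff_distrib)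
    also have "\<dots> = (LINT v|lborel. ?B v) - (LINT v|lborel. h1 (Complex 2 v) * gauss_kernel \<mu> (Complex 2 v))"
      by (rule Bochner_Integration.integral_diff[OF iB i1])
    also have "(LINT v|lborel. h1 (Complex 2 v) * gauss_kernel \<mu> (Complex 2 v)) = R1 \<mu>"
      unfolding R1_def using strip_decay.vertical_shift[OF s1] by simp
    also have "(LINT v|lborel. ?B v) = (LINT v|lborel. ?B (\<xi> + 1 * v))"
      by (subst lborel_integral_real_affine[of 1 _ \<xi>]) auto
    also have "\<dots> = gauss_kernel \<mu> (Complex 1 \<xi>) * (LINT v|lborel. ?A v)" unfolding BA by (rule integral_mult_right_zero)
    also have "(LINT v|lborel. ?A v) = 2 * pi * h2 0 + R2 (\<mu> + 1)"
      unfolding R2_def by (rule gauss_residue[of h2 "-2" "-1" 1 1 "\<bar>\<xi>\<bar>"]) (use h2hol h2b in auto)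
    finally show ?thesis by (simp add: h2_def)
  qed
  have R1l: "((\<lambda>\<mu>. R1 \<mu> / of_real (exp \<mu>) * cis (- \<xi> * (\<mu> + 1))) \<longlongrightarrow> 0) at_top"
  proof (rule Lim_null_comparison)
    define K where "K = 4 * (M * exp \<bar>\<xi>\<bar>) * exp (1\<^sup>2) * exp ((3/4)\<^sup>2 / 2) * J"
    show "((\<lambda>\<mu>. K * exp (3/4 * \<mu>) / exp \<mu>) \<longlongrightarrow> 0) at_top" by real_asymp
    show "\<forall>\<^sub>F \<mu> in at_top. norm (R1 \<mu> / of_real (exp \<mu>) * cis (- \<xi> * (\<mu> + 1))) \<le> K * exp (3/4 * \<mu>) / exp \<mu>"
    proof (intro always_eventually allI)
      fix \<mu>
      have "cmod (R1 \<mu>) \<le> 4 * (M * exp \<bar>\<xi>\<bar>) * exp (1\<^sup>2) * exp ((3/4)\<^sup>2 / 2 + \<mu> * (3/4)) * J"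
        unfolding R1_def J_def by (rule kernel_integral_bound) (use h1b[of "Complex (3/4) v" for v] in auto)
      also have "\<dots> = K * exp (3/4 * \<mu>)" unfolding K_def exp_add by (simp only: mult_ac)
      finally show "norm (R1 \<mu> / of_real (exp \<mu>) * cis (- \<xi> * (\<mu> + 1))) \<le> K * exp (3/4 * \<mu>) / exp \<mu>"
        by (simp add: norm_mult norm_divide divide_right_mono)
    qed
  qed
  have R2l: "((\<lambda>\<mu>. R2 (\<mu> + 1)) \<longlongrightarrow> 0) at_top"
  proof (rule Lim_null_comparison)
    define K where "K = 4 * 1 * exp (\<bar>\<xi>\<bar>\<^sup>2) * exp ((-1)\<^sup>2 / 2) / \<bar>-1\<bar> * J"
    show "((\<lambda>\<mu>. K * exp (- (\<mu> + 1))) \<longlongrightarrow> 0) at_top" by real_asymp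
    show "\<forall>\<^sub>F \<mu> in at_top. norm (R2 (\<mu> + 1)) \<le> K * exp (- (\<mu> + 1))"
    proof (intro always_eventually allI)
      fix \<mu>
      have "cmod (R2 (\<mu> + 1)) \<le> 4 * 1 * exp (\<bar>\<xi>\<bar>\<^sup>2) * exp ((-1)\<^sup>2 / 2 + (\<mu> + 1) * (-1)) / \<bar>-1\<bar> * J"
        unfolding R2_def J_def by (rule kernel_div_integral_bound) (use h2b[of "Complex (-1) v" for v] in auto)
      also have "\<dots> = K * exp (- (\<mu> + 1))" unfolding K_def exp_add by simp
      finally show "norm (R2 (\<mu> + 1)) \<le> K * exp (- (\<mu> + 1))" .
    qed
  qed
  have eq: "(\<Sum>p. of_real (log_gauss \<mu> p) * cis (\<xi> * (ln (real p) - \<mu> - 1))) / of_real (exp \<mu>)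
     = (of_real (exp ((1 - \<xi>\<^sup>2) / 2)) * (2 * pi + R2 (\<mu> + 1)) - R1 \<mu> / of_real (exp \<mu>) * cis (- \<xi> * (\<mu> + 1))) / of_real (sqrt (2 * pi))" for \<mu>
  proof -
    have c: "cis (\<xi> * (ln (real p) - \<mu> - 1)) = cis (\<xi> * ln (real p)) * cis (- \<xi> * (\<mu> + 1))" for p
      unfolding cis_mult by (simp add: algebra_simps)
    have "(\<lambda>n. of_real (sqrt (2 * pi)) * (of_real (log_gauss \<mu> n) * cis (\<xi> * ln (real n))) * (cis (- \<xi> * (\<mu> + 1)) / of_real (sqrt (2 * pi))))
       sums (U \<xi> \<mu> * (cis (- \<xi> * (\<mu> + 1)) / of_real (sqrt (2 * pi))))"
      by (rule sums_mult2[OF Us])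
    then have "(\<lambda>n. of_real (log_gauss \<mu> n) * cis (\<xi> * (ln (real n) - \<mu> - 1))) sums (U \<xi> \<mu> * (cis (- \<xi> * (\<mu> + 1)) / of_real (sqrt (2 * pi))))"
      unfolding c by (simp add: mult_ac)
    then have s: "(\<Sum>p. of_real (log_gauss \<mu> p) * cis (\<xi> * (ln (real p) - \<mu> - 1))) = U \<xi> \<mu> * cis (- \<xi> * (\<mu> + 1)) / of_real (sqrt (2 * pi))"
      by (simp add: sums_unique[symmetric])
    have g: "gauss_kernel \<mu> (Complex 1 \<xi>) * cis (- \<xi> * (\<mu> + 1)) = of_real (exp ((1 - \<xi>\<^sup>2) / 2)) * of_real (exp \<mu>)"
    proof -
      have "gauss_kernel \<mu> (Complex 1 \<xi>) * cis (- \<xi> * (\<mu> + 1)) = exp (of_real ((1 - \<xi>\<^sup>2) / 2 + \<mu>))"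
        unfolding gauss_kernel_def cis_conv_exp exp_add[symmetric]
        by (rule arg_cong[of _ _ exp]) (simp add: complex_eq_iff power2_eq_square field_simps)
      also have "\<dots> = of_real (exp ((1 - \<xi>\<^sup>2) / 2) * exp \<mu>)" by (simp only: exp_of_real exp_add)
      finally show ?thesis by simp
    qed
    have "U \<xi> \<mu> * cis (- \<xi> * (\<mu> + 1)) = (gauss_kernel \<mu> (Complex 1 \<xi>) * cis (- \<xi> * (\<mu> + 1))) * (2 * pi + R2 (\<mu> + 1)) - R1 \<mu> * cis (- \<xi> * (\<mu> + 1))"
      unfolding main by (simp only: left_diff_distrib) (simp only: mult_ac)
    moreover have "(A * e * X - r * c) / S / e = (A * X - r / e * c) / S" if "e \<noteq> 0" for A e X r c S :: complex
      using that by (simp add: diff_divide_distrib)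
    ultimately show ?thesis unfolding s g by simp
  qed
  have "((\<lambda>\<mu>. (of_real (exp ((1 - \<xi>\<^sup>2) / 2)) * (2 * pi + R2 (\<mu> + 1)) - R1 \<mu> / of_real (exp \<mu>) * cis (- \<xi> * (\<mu> + 1))) / of_real (sqrt (2 * pi)))
     \<longlongrightarrow> (complex_of_real (exp ((1 - \<xi>\<^sup>2) / 2)) * (complex_of_real (2 * pi) + 0) - 0) / complex_of_real (sqrt (2 * pi))) at_top"
    by (intro tendsto_intros R1l R2l) auto
  moreover have "(complex_of_real (exp ((1 - \<xi>\<^sup>2) / 2)) * (complex_of_real (2 * pi) + 0) - 0) / complex_of_real (sqrt (2 * pi)) = complex_of_real (sqrt (2 * pi) * exp ((1 - \<xi>\<^sup>2) / 2))"
  proof -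
    have "2 * pi / sqrt (2 * pi) = sqrt (2 * pi)" by (rule real_div_sqrt) simp
    then have "exp ((1 - \<xi>\<^sup>2) / 2) * (2 * pi) / sqrt (2 * pi) = sqrt (2 * pi) * exp ((1 - \<xi>\<^sup>2) / 2)"
      by (metis mult.commute times_divide_eq_right)
    then show ?thesis by (metis add_0_right diff_zero of_real_divide of_real_mult)
  qed
  ultimately show "((\<lambda>\<mu>. (\<Sum>p. of_real (log_gauss \<mu> p) * cis (\<xi> * (ln (real p) - \<mu> - 1))) / of_real (exp \<mu>))
      \<longlongrightarrow> of_real (sqrt (2 * pi) * exp ((1 - \<xi>\<^sup>2) / 2))) at_top"
    unfolding eq by simp
qed

section \<open>Weak convergence and sums over blocks of primes\<close>

definition discrete_dist :: "(nat \<Rightarrow> real) \<Rightarrow> (nat \<Rightarrow> real) \<Rightarrow> real measure" where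
  "discrete_dist m r = distr (density (count_space UNIV) (\<lambda>n. ennreal (m n))) borel r"

lemma discrete_dist_real_distribution:
  assumes "\<And>n. m n \<ge> 0" "m sums 1"
  shows "real_distribution (discrete_dist m r)"
proof -
  have "prob_space (density (count_space UNIV) (\<lambda>n. ennreal (m n)))"
  proof
    have "emeasure (density (count_space UNIV) (\<lambda>n. ennreal (m n))) UNIV = (\<Sum>n. ennreal (m n))"
      by (simp add: emeasure_density nn_integral_count_space_nat)
    also have "\<dots> = 1" using suminf_ennreal_eq[OF assms] by simp
    finally show "emeasure (density (count_space UNIV) (\<lambda>n. ennreal (m n))) (space (density (count_space UNIV) (\<lambda>n. ennreal (m n)))) = 1"
      by simp
  qed
  then show ?thesis unfolding discrete_dist_def by (rule prob_space.real_distribution_distr) simp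
qed

lemma discrete_dist_integral:
  fixes f :: "real \<Rightarrow> complex"
  assumes "\<And>n. m n \<ge> 0" "m sums 1" and f: "f \<in> borel_measurable borel" "\<And>x. cmod (f x) \<le> C"
  shows "integral\<^sup>L (discrete_dist m r) f = (\<Sum>n. m n *\<^sub>R f (r n))"
proof -
  have "integral\<^sup>L (discrete_dist m r) f = integral\<^sup>L (density (count_space UNIV) (\<lambda>n. ennreal (m n))) (\<lambda>n. f (r n))"
    unfolding discrete_dist_def using f by (intro integral_distr) auto
  also have "\<dots> = integral\<^sup>L (count_space UNIV) (\<lambda>n. m n *\<^sub>R f (r n))"
    using assms by (intro integral_density) auto
  also have "\<dots> = (\<Sum>n. m n *\<^sub>R f (r n))"
  proof (rule integral_count_space_nat)
    have "summable (\<lambda>n. norm (m n *\<^sub>R f (r n)))"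
    proof (rule summable_comparison_test')
      show "summable (\<lambda>n. m n * C)" using assms by (intro summable_mult2 sums_summable)
      show "norm (norm (m n *\<^sub>R f (r n))) \<le> m n * C" for n using assms by (simp add: mult_left_mono)
    qed
    then show "integrable (count_space UNIV) (\<lambda>n. m n *\<^sub>R f (r n))" by (simp add: integrable_count_space_nat_iff)
  qed
  finally show ?thesis .
qed

text \<open>A window of bounded ratio e^B, on which ln p is \<mu> + O(1), so the weight ln p can
  later be traded for \<mu>.\<close>

definition block :: "real \<Rightarrow> real \<Rightarrow> nat set" where
  "block B \<mu> = {p. prime p \<and> \<mu> - B \<le> ln (real p) \<and> ln (real p) \<le> \<mu>}"

lemma finite_block: "finite (block B \<mu>)"
proof (rule finite_subset)
  show "block B \<mu> \<subseteq> {..nat \<lceil>exp \<mu>\<rceil>}"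
  proof
    fix p assume "p \<in> block B \<mu>"
    then have "p > 0" "ln (real p) \<le> \<mu>" by (auto simp: block_def prime_gt_0_nat)
    then have "real p \<le> exp \<mu>" by (metis exp_le_cancel_iff exp_ln of_nat_0_less_iff)
    then show "p \<in> {..nat \<lceil>exp \<mu>\<rceil>}" by (simp; linarith)
  qed
qed simp

text \<open>After tilting by a Gaussian, the primes near \<open>e\<^sup>\<mu>\<close> become a probability measure whose characteristic
  functions converge by contour shifting. Levy's continuity theorem then plays the role of a Tauberian theorem.\<close>

lemma prime_block_sum:
  fixes z :: complex
  assumes "GRH" "B > 0" "z \<noteq> 0"
  shows "((\<lambda>\<mu>. (\<Sum>p\<in>block B \<mu>. of_real (ln (real p)) * of_nat p powr (z - 1)) / exp (z * of_real \<mu>))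
    \<longlongrightarrow> (1 - exp (- z * of_real B)) / z) at_top"
\<comment> \<open>The continuity theorem concerns sequences of measures, hence the passage to an
  arbitrary sequence tending to infinity.\<close>
proof (rule tendsto_at_topI_sequentially)
  fix X :: "nat \<Rightarrow> real" assume X: "filterlim X at_top sequentially"
  \<comment> \<open>In the centred variable r = ln p - X - 1 the block is the interval from
    \<open>a\<close> to -1.\<close>
  define a where "a = - B - 1"
  \<comment> \<open>Divides out the Gaussian weight and inserts p^(z-1), normalised by exp(z
    X).\<close>
  define g where "g r = exp (of_real ((r + 1)\<^sup>2 / 2) + (z - 1) * of_real (r + 1))" for r :: real
  define f where "f r = indicator {a..-1} r *\<^sub>R g r" for r :: real
  define T where "T k = (\<Sum>p. log_gauss (X k) p)" for k
  define r where "r k n = ln (real n) - X k - 1" for k n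
  define m where "m k n = log_gauss (X k) n / T k" for k n
  define M where "M k = discrete_dist (m k) (r k)" for k
  note lgs = log_gauss_sums(1)[OF assms(1)]
  have T0: "T k > 0" for k
    unfolding T_def
  proof (rule suminf_pos2[OF lgs, where i=2])
    show "log_gauss (X k) 2 > 0" by (simp add: log_gauss_def gauss_weight_pos two_is_prime_nat)
  qed (rule log_gauss_nonneg)
  have m0: "m k n \<ge> 0" for k n unfolding m_def using T0[of k] log_gauss_nonneg by (simp add: divide_nonneg_pos)
  have m1: "m k sums 1" for k
    using sums_divide[OF summable_sums[OF lgs], of "X k" "T k"] T0[of k] unfolding m_def[abs_def] T_def[symmetric] by simp
  have rd: "real_distribution (M k)" for k unfolding M_def by (rule discrete_dist_real_distribution[OF m0 m1])
  have Ul: "(\<lambda>k. (\<Sum>p. of_real (log_gauss (X k) p) * cis (\<xi> * r k p)) / of_real (exp (X k))) \<longlonglongrightarrow> of_real (sqrt (2 * pi) * exp ((1 - \<xi>\<^sup>2) / 2))" for \<xi>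
    unfolding r_def by (rule filterlim_compose[OF log_gauss_sums(2)[OF assms(1)] X])
  have T_c: "of_real (T k) = (\<Sum>p. of_real (log_gauss (X k) p) * cis (0 * r k p))" for k
    unfolding T_def using suminf_of_real[OF lgs[of "X k"]] by simp
  have Tl: "(\<lambda>k. complex_of_real (T k / exp (X k))) \<longlonglongrightarrow> of_real (sqrt (2 * pi) * exp (1 / 2))"
    using Ul[of 0] unfolding T_c[symmetric] by simp
  have "weak_conv_m M std_normal_distribution"
  proof (rule levy_continuity[OF rd real_dist_normal_dist])
    fix \<xi>
    have c: "char (M k) \<xi> = ((\<Sum>p. of_real (log_gauss (X k) p) * cis (\<xi> * r k p)) / of_real (exp (X k))) / of_real (T k / exp (X k))" for k
    proof -
      have "char (M k) \<xi> = (\<Sum>n. m k n *\<^sub>R iexp (\<xi> * r k n))"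
        unfolding char_def M_def by (rule discrete_dist_integral[OF m0 m1, where C=1]) auto
      also have "\<dots> = (\<Sum>n. (of_real (log_gauss (X k) n) * cis (\<xi> * r k n)) / of_real (T k))"
        by (intro suminf_cong) (simp add: m_def scaleR_conv_of_real cis_conv_exp)
      also have "\<dots> = (\<Sum>n. of_real (log_gauss (X k) n) * cis (\<xi> * r k n)) / of_real (T k)"
      proof (rule suminf_divide)
        have "summable (\<lambda>n. norm (complex_of_real (log_gauss (X k) n) * cis (\<xi> * r k n)))"
          using lgs[of "X k"] log_gauss_nonneg by (simp add: norm_mult)
        then show "summable (\<lambda>n. complex_of_real (log_gauss (X k) n) * cis (\<xi> * r k n))" by (rule summable_norm_cancel)
      qed
      finally show ?thesis by simp
    qed
    have "(\<lambda>k. char (M k) \<xi>) \<longlonglongrightarrow> of_real (sqrt (2 * pi) * exp ((1 - \<xi>\<^sup>2) / 2)) / of_real (sqrt (2 * pi) * exp (1 / 2))"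
      unfolding c by (intro tendsto_divide Ul Tl) auto
    also have "of_real (sqrt (2 * pi) * exp ((1 - \<xi>\<^sup>2) / 2)) / of_real (sqrt (2 * pi) * exp (1 / 2)) = complex_of_real (exp (- (\<xi>\<^sup>2) / 2))"
      unfolding of_real_divide[symmetric] by (rule arg_cong[of _ _ of_real]) (simp add: diff_divide_distrib flip: exp_diff)
    also have "\<dots> = char std_normal_distribution \<xi>" unfolding char_std_normal_distribution ..
    finally show "(\<lambda>k. char (M k) \<xi>) \<longlonglongrightarrow> char std_normal_distribution \<xi>" .
  qed
  note wc = this
  have gc: "continuous_on UNIV g" unfolding g_def by (intro continuous_intros) auto
  have fm: "f \<in> borel_measurable borel"
    unfolding f_def using borel_measurable_continuous_onI[OF gc] by measurable
  define C where "C = exp (B\<^sup>2 / 2 + \<bar>Re (z - 1)\<bar> * B)"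
  have fb: "cmod (f x) \<le> C" for x
  proof (cases "x \<in> {a..-1}")
    case True
    then have x: "\<bar>x + 1\<bar> \<le> B" by (auto simp: a_def)
    have "(x + 1)\<^sup>2 \<le> B\<^sup>2" using power_mono[OF x, of 2] by simp
    moreover have "Re (z - 1) * (x + 1) \<le> \<bar>Re (z - 1)\<bar> * B"
      using mult_mono[OF order.refl[of "\<bar>Re (z - 1)\<bar>"] x] abs_ge_self[of "Re (z - 1) * (x + 1)"] by (simp add: abs_mult)
    ultimately have "(x + 1)\<^sup>2 / 2 + Re (z - 1) * (x + 1) \<le> B\<^sup>2 / 2 + \<bar>Re (z - 1)\<bar> * B"
      by (intro add_mono divide_right_mono) auto
    then have "cmod (g x) \<le> C"
      unfolding g_def C_def norm_exp_eq_Re by (simp del: minus_complex.sel of_real_add of_real_power)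
    then show ?thesis using True by (simp add: f_def)
  next
    case False then show ?thesis by (simp add: f_def C_def)
  qed
  \<comment> \<open>The sharp window is a legitimate test function: it jumps only at its two ends, a
    null set for the normal law.\<close>
  have "{x. \<not> isCont f x} \<subseteq> {a, -1}"
  proof
    fix x assume x: "x \<in> {x. \<not> isCont f x}"
    show "x \<in> {a, -1}"
    proof (rule ccontr)
      assume nx: "x \<notin> {a, -1}"
      have "frontier {a..-1} \<subseteq> {a, -1}" by (auto simp: frontier_def)
      then have "isCont (indicator {a..-1} :: real \<Rightarrow> real) x" using nx by (auto simp: isCont_indicator)
      moreover have "isCont g x" using gc by (simp add: continuous_on_eq_continuous_at)
      ultimately have "isCont f x" unfolding f_def by (intro isCont_scaleR)
      then show False using x by simp
    qed
  qed
  moreover have "emeasure std_normal_distribution {a, -1} = 0"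
  proof -
    have "AE x in lborel. x \<notin> {a, -1}"
      using AE_lborel_singleton[of a] AE_lborel_singleton[of "-1"] by eventually_elim simp
    then have AE0: "AE x in lborel. ennreal (std_normal_density x) * indicator {a, -1} x = 0"
      by eventually_elim simp
    have "emeasure std_normal_distribution {a, -1} = (\<integral>\<^sup>+ x. ennreal (std_normal_density x) * indicator {a, -1} x \<partial>lborel)"
      by (rule emeasure_density) auto
    also have "\<dots> = 0" by (subst nn_integral_0_iff_AE) (use AE0 in auto)
    finally show ?thesis .
  qed
  ultimately have null: "emeasure std_normal_distribution {x. \<not> isCont f x} = 0"
    using emeasure_mono[of "{x. \<not> isCont f x}" "{a, -1}" std_normal_distribution] by simp
  have conv: "(\<lambda>k. integral\<^sup>L (M k) f) \<longlonglongrightarrow> integral\<^sup>L std_normal_distribution f"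
    by (rule weak_conv_imp_bdd_ae_continuous_conv[OF rd real_dist_normal_dist wc null fb fm])
  have eq: "(\<Sum>p\<in>block B (X k). of_real (ln (real p)) * of_nat p powr (z - 1)) / exp (z * of_real (X k)) = of_real (T k / exp (X k)) * integral\<^sup>L (M k) f" for k
  proof -
    have "integral\<^sup>L (M k) f = (\<Sum>n. m k n *\<^sub>R f (r k n))"
      unfolding M_def by (rule discrete_dist_integral[OF m0 m1 fm fb])
    also have "\<dots> = (\<Sum>n\<in>block B (X k). m k n *\<^sub>R f (r k n))"
    proof (rule suminf_finite[OF finite_block])
      fix n assume "n \<notin> block B (X k)"
      then show "m k n *\<^sub>R f (r k n) = 0"
        by (auto simp: m_def log_gauss_def f_def block_def r_def a_def)
    qed
    finally have "of_real (T k / exp (X k)) * integral\<^sup>L (M k) f = (\<Sum>n\<in>block B (X k). of_real (T k / exp (X k)) * (m k n *\<^sub>R f (r k n)))"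
      by (simp add: sum_distrib_left)
    also have "\<dots> = (\<Sum>p\<in>block B (X k). of_real (ln (real p)) * of_nat p powr (z - 1) / exp (z * of_real (X k)))"
    proof (intro sum.cong refl)
      fix p assume p: "p \<in> block B (X k)"
      then have pp: "prime p" "p > 0" by (auto simp: block_def prime_gt_0_nat)
      have rr: "r k p + 1 = ln (real p) - X k" by (simp add: r_def)
      have fr: "f (r k p) = g (r k p)" using p by (auto simp: f_def block_def r_def a_def)
      have "T k / exp (X k) * m k p = ln (real p) * exp (- (X k - ln (real p))\<^sup>2 / 2) / exp (X k)"
        using T0[of k] pp by (simp add: m_def log_gauss_def gauss_weight_def)
      then have "of_real (T k / exp (X k)) * (m k p *\<^sub>R f (r k p)) = of_real (ln (real p)) * (of_real (exp (- (X k - ln (real p))\<^sup>2 / 2)) / of_real (exp (X k)) * g (r k p))"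
        unfolding fr scaleR_conv_of_real by (metis (no_types, lifting) mult.assoc of_real_divide of_real_mult times_divide_eq_right)
      also have "of_real (exp (- (X k - ln (real p))\<^sup>2 / 2)) / of_real (exp (X k)) * g (r k p) = exp ((z - 1) * of_real (ln (real p)) - z * of_real (X k))"
        unfolding g_def rr exp_of_real[symmetric] exp_diff[symmetric] exp_add[symmetric]
        by (rule arg_cong[of _ _ exp]) (simp add: power2_eq_square field_simps)
      also have "\<dots> = of_nat p powr (z - 1) / exp (z * of_real (X k))"
        using pp by (simp add: exp_diff powr_def Ln_of_nat)
      finally show "of_real (T k / exp (X k)) * (m k p *\<^sub>R f (r k p)) = of_real (ln (real p)) * of_nat p powr (z - 1) / exp (z * of_real (X k))"
        by (simp only: times_divide_eq_right)
    qed
    finally show ?thesis by (simp add: sum_divide_distrib)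
  qed
  have "(\<lambda>k. of_real (T k / exp (X k)) * integral\<^sup>L (M k) f) \<longlonglongrightarrow> of_real (sqrt (2 * pi) * exp (1 / 2)) * integral\<^sup>L std_normal_distribution f"
    by (intro tendsto_mult Tl conv)
  \<comment> \<open>The constant sqrt(2\<pi>) e^(1/2) and \<open>g\<close> undo the normal density,
    leaving the integral of exp(z(x + 1)) over the window.\<close>
  moreover have "of_real (sqrt (2 * pi) * exp (1 / 2)) * integral\<^sup>L std_normal_distribution f = (1 - exp (- z * of_real B)) / z"
  proof -
    have sc: "integral\<^sup>L std_normal_distribution f = (LINT x|lborel. std_normal_density x *\<^sub>R f x)"
      using fm by (intro integral_density) auto
    have pt: "of_real (sqrt (2 * pi) * exp (1 / 2)) * (std_normal_density x *\<^sub>R f x) = indicator {a..-1} x *\<^sub>R exp (z * of_real (x + 1))" for x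
    proof -
      have "of_real (sqrt (2 * pi) * exp (1 / 2)) * (std_normal_density x *\<^sub>R f x) = indicator {a..-1} x *\<^sub>R (of_real (sqrt (2 * pi) * exp (1 / 2) * std_normal_density x) * g x)"
        unfolding f_def scaleR_conv_of_real by (simp only: of_real_mult mult_ac)
      also have "sqrt (2 * pi) * exp (1 / 2) * std_normal_density x = exp (1/2) * exp (- x\<^sup>2 / 2)"
        by (simp add: std_normal_density_def)
      also have "of_real (exp (1/2) * exp (- x\<^sup>2 / 2)) * g x = exp (z * of_real (x + 1))"
        unfolding g_def exp_add[symmetric] exp_of_real[symmetric]
        by (rule arg_cong[of _ _ exp]) (simp add: power2_eq_square field_simps)
      finally show ?thesis .
    qed
    have "of_real (sqrt (2 * pi) * exp (1 / 2)) * integral\<^sup>L std_normal_distribution f = (LINT x|lborel. of_real (sqrt (2 * pi) * exp (1 / 2)) * (std_normal_density x *\<^sub>R f x))"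
      unfolding sc by (rule integral_mult_right_zero[symmetric])
    also have "\<dots> = (LINT x:{a..-1}|lborel. exp (z * of_real (x + 1)))"
      unfolding pt set_lebesgue_integral_def ..
    also have "\<dots> = integral {a..-1} (\<lambda>x. exp (z * of_real (x + 1)))"
      by (intro set_borel_integral_eq_integral borel_integrable_atLeastAtMost') (intro continuous_intros)
    also have "\<dots> = exp (z * of_real (-1 + 1)) / z - exp (z * of_real (a + 1)) / z"
    proof (intro integral_unique fundamental_theorem_of_calculus)
      fix x :: real assume "x \<in> {a..-1}"
      have "((\<lambda>x. exp (z * (x + 1)) / z) has_field_derivative exp (z * (of_real x + 1))) (at (of_real x))"
        using assms(3) by (auto intro!: derivative_eq_intros)
      from has_vector_derivative_real_field[OF this, of "{a..-1}"]
      show "((\<lambda>x. exp (z * of_real (x + 1)) / z) has_vector_derivative exp (z * of_real (x + 1))) (at x within {a..-1})"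
        by simp
    qed (use assms in \<open>simp add: a_def\<close>)
    also have "\<dots> = (1 - exp (- z * of_real B)) / z" by (simp add: a_def diff_divide_distrib)
    finally show ?thesis .
  qed
  ultimately show "(\<lambda>k. (\<Sum>p\<in>block B (X k). of_real (ln (real p)) * of_nat p powr (z - 1)) / exp (z * of_real (X k))) \<longlonglongrightarrow> (1 - exp (- z * of_real B)) / z"
    unfolding eq by simp
qed

subsection \<open>Quadratic characters and reciprocity\<close>

lemma coprime_4_iff_odd: "coprime n (4::nat) \<longleftrightarrow> odd n"
proof -
  have "coprime n ((2::nat) ^ 2) \<longleftrightarrow> odd n" by (simp only: coprime_power_right_iff coprime_right_2_iff_odd) simp
  moreover have "(2::nat) ^ 2 = 4" by simp
  ultimately show ?thesis by (simp only:)
qed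

lemma Legendre_values: "Legendre a p \<in> {-1, 0, 1}"
  by (simp add: Legendre_def)

lemma Legendre_cong:
  assumes "[a = b] (mod p)"
  shows "Legendre a p = Legendre b p"
proof -
  have "[a = 0] (mod p) \<longleftrightarrow> [b = 0] (mod p)" using assms by (metis cong_sym cong_trans)
  moreover have "QuadRes p a \<longleftrightarrow> QuadRes p b" unfolding QuadRes_def using assms by (metis cong_sym cong_trans)
  ultimately show ?thesis unfolding Legendre_def by simp
qed

lemma Legendre_eq_0_iff:
  assumes "prime p"
  shows "Legendre (int n) (int p) = 0 \<longleftrightarrow> \<not> coprime n p"
proof -
  have "Legendre (int n) (int p) = 0 \<longleftrightarrow> p dvd n"
    by (auto simp: Legendre_def cong_0_iff)
  also have "\<dots> \<longleftrightarrow> \<not> coprime n p"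
    using assms by (metis coprime_commute coprime_absorb_right not_prime_unit prime_imp_coprime)
  finally show ?thesis .
qed

lemma Legendre_one: "prime p \<Longrightarrow> Legendre 1 (int p) = 1"
proof -
  assume p: "prime p"
  have "QuadRes (int p) 1" unfolding QuadRes_def by (intro exI[of _ 1]) simp
  moreover have "\<not> [1 = 0] (mod int p)" using p prime_gt_1_nat[OF p] by (simp add: cong_0_iff)
  ultimately show ?thesis by (simp add: Legendre_def)
qed

text \<open>Euler's criterion gives the congruence mod p, and both sides lie in {-1, 0, 1}, hence
  differ by at most 2 < p.\<close>

lemma Legendre_mult:
  assumes "prime p" "p > 2"
  shows "Legendre (a * b) (int p) = Legendre a (int p) * Legendre b (int p)"
proof -
  let ?k = "(p - 1) div 2"
  have "[Legendre (a * b) (int p) = (a * b) ^ ?k] (mod int p)" by (rule euler_criterion[OF assms])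
  also have "(a * b) ^ ?k = a ^ ?k * b ^ ?k" by (rule power_mult_distrib)
  also have "[a ^ ?k * b ^ ?k = Legendre a (int p) * Legendre b (int p)] (mod int p)"
    by (intro cong_mult cong_sym[OF euler_criterion[OF assms]])
  finally have "int p dvd Legendre (a * b) (int p) - Legendre a (int p) * Legendre b (int p)" by (simp add: cong_iff_dvd_diff)
  moreover have "\<bar>Legendre (a * b) (int p) - Legendre a (int p) * Legendre b (int p)\<bar> \<le> 2"
    using Legendre_values[of "a * b" "int p"] Legendre_values[of a "int p"] Legendre_values[of b "int p"] by auto
  ultimately show ?thesis
    using assms(2) dvd_imp_le_int[of "Legendre (a * b) (int p) - Legendre a (int p) * Legendre b (int p)" "int p"] by force
qed

text \<open>If every nonzero class were a square, squaring would be onto and thus injective on the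
  nonzero classes, but 1 and p - 1 have the same square.\<close>

lemma ex_nonresidue:
  assumes "prime p" "p > 2"
  shows "\<exists>n::nat. Legendre (int n) (int p) = -1"
proof (rule ccontr)
  assume no: "\<not> ?thesis"
  let ?A = "{1..<p}"
  have sq: "\<exists>y\<in>?A. (y * y) mod p = n" if n: "n \<in> ?A" for n
  proof -
    have n0: "\<not> [int n = 0] (mod int p)" using n by (auto simp: cong_0_iff dest: dvd_imp_le)
    have "Legendre (int n) (int p) \<noteq> -1" using no by blast
    then have "QuadRes (int p) (int n)" using n0 by (auto simp: Legendre_def split: if_splits)
    then obtain y where y: "[y ^ 2 = int n] (mod int p)" by (auto simp: QuadRes_def)
    define m where "m = nat (y mod int p)"
    have m: "int m = y mod int p" "m < p" using assms by (auto simp: m_def nat_less_iff)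
    have "[int m * int m = int n] (mod int p)"
      unfolding m using y by (simp add: cong_def power2_eq_square mod_mult_eq)
    then have c: "[m * m = n] (mod p)" by (metis cong_int_iff of_nat_mult)
    then have "(m * m) mod p = n" using n by (simp add: cong_def)
    moreover from this have "m \<noteq> 0" using n by (intro notI) auto
    ultimately show ?thesis using m by (intro bexI[of _ m]) auto
  qed
  have "?A \<subseteq> (\<lambda>y. (y * y) mod p) ` ?A"
  proof
    fix n assume "n \<in> ?A"
    then show "n \<in> (\<lambda>y. (y * y) mod p) ` ?A" using sq[of n] by blast
  qed
  then have "card ?A \<le> card ((\<lambda>y. (y * y) mod p) ` ?A)" by (intro card_mono) auto
  then have "inj_on (\<lambda>y. (y * y) mod p) ?A"
    by (intro eq_card_imp_inj_on antisym card_image_le) auto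
  moreover have "1 \<in> ?A" "p - 1 \<in> ?A" "1 \<noteq> p - 1" using assms by auto
  moreover have "((p - 1) * (p - 1)) mod p = (1 * 1) mod p"
  proof -
    define k where "k = p - 2"
    have "p = k + 2" using assms(2) by (simp add: k_def)
    then have "(p - 1) * (p - 1) = 1 * 1 + p * k" by (simp add: algebra_simps)
    then show ?thesis by (simp only: mod_mult_self2)
  qed
  ultimately show False using inj_onD[of "\<lambda>y. (y * y) mod p" ?A "p - 1" 1] by simp
qed

lemma legendre_char_dirichlet:
  assumes "prime p" "p > 2"
  shows "dirichlet_char p (legendre_char p)" "\<not> principal_char p (legendre_char p)"
proof -
  show "dirichlet_char p (legendre_char p)"
    unfolding dirichlet_char_def
  proof (intro conjI allI)
    show "p > 0" using assms by simp
    show "legendre_char p 1 = 1" using Legendre_one[OF assms(1)] by (simp add: legendre_char_def)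
    show "legendre_char p (m * n) = legendre_char p m * legendre_char p n" for m n
      by (simp add: legendre_char_def Legendre_mult[OF assms])
    show "legendre_char p (n + p) = legendre_char p n" for n
      unfolding legendre_char_def by (subst Legendre_cong[of "int (n + p)" "int n"]) (auto simp: cong_def)
    show "legendre_char p n = 0 \<longleftrightarrow> \<not> coprime n p" for n
      unfolding legendre_char_def using Legendre_eq_0_iff[OF assms(1)] by simp
  qed
  obtain n :: nat where n: "Legendre (int n) (int p) = -1" using ex_nonresidue[OF assms] by blast
  then have "coprime n p" using Legendre_eq_0_iff[OF assms(1), of n] by auto
  moreover have "legendre_char p n \<noteq> 1" by (simp add: legendre_char_def n)
  ultimately show "\<not> principal_char p (legendre_char p)" unfolding principal_char_def by blast
qed

text \<open>For odd primes \<open>q\<close> the twist below is the sign in quadratic reciprocity: it makes \<open>p \<mapsto> (q/p)\<close> the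
  restriction to odd primes of a character of modulus \<open>4q\<close>.\<close>

definition qr_sign :: "nat \<Rightarrow> nat \<Rightarrow> int" where
  "qr_sign q n = (if even n then 0 else if q mod 4 = 3 \<and> n mod 4 = 3 then -1 else 1)"

definition recip_char :: "nat \<Rightarrow> nat \<Rightarrow> int" where
  "recip_char q n = qr_sign q n * Legendre (int n) (int q)"

lemma qr_sign_mult: "qr_sign q (m * n) = qr_sign q m * qr_sign q n"
proof -
  have o: "odd m \<Longrightarrow> m mod 4 = 1 \<or> m mod 4 = 3" for m :: nat by presburger
  show ?thesis
  proof (cases "even m \<or> even n")
    case False
    have "(m * n) mod 4 = ((m mod 4) * (n mod 4)) mod 4" by (simp add: mod_mult_eq)
    then show ?thesis using False o[of m] o[of n] by (auto simp: qr_sign_def)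
  qed (auto simp: qr_sign_def)
qed

lemma qr_sign_add: "qr_sign q (n + 4 * k) = qr_sign q n"
  by (simp add: qr_sign_def)

lemma recip_char_values: "\<bar>recip_char q n\<bar> \<le> 1"
  using Legendre_values[of "int n" "int q"] by (auto simp: recip_char_def qr_sign_def abs_mult)

lemma recip_char_eq_Legendre:
  assumes "prime q" "q > 2" "prime p" "p > 2"
  shows "recip_char q p = Legendre (int q) (int p)"
proof (cases "p = q")
  case True
  then show ?thesis by (simp add: recip_char_def Legendre_def cong_0_iff)
next
  case False
  have odd: "odd p" "odd q" using assms prime_odd_nat by auto
  have QR: "Legendre (int p) (int q) * Legendre (int q) (int p) = (-1) ^ ((p - 1) div 2 * ((q - 1) div 2))"
    using Quadratic_Reciprocity[OF assms(3,4,1,2) False] .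
  have par: "even ((n - 1) div 2) \<longleftrightarrow> n mod 4 = 1" "n mod 4 = 1 \<or> n mod 4 = 3" if "odd n" for n :: nat
    using that by presburger+
  have "(-1) ^ ((p - 1) div 2 * ((q - 1) div 2)) = qr_sign q p"
    using par[OF odd(1)] par[OF odd(2)] odd by (auto simp: qr_sign_def)
  then have e: "Legendre (int p) (int q) * Legendre (int q) (int p) = qr_sign q p" using QR by simp
  then have "Legendre (int p) (int q) \<noteq> 0" using odd by (auto simp: qr_sign_def split: if_splits)
  \<comment> \<open>Multiplying the reciprocity law by (p/q), whose square is 1, solves it for
    (q/p).\<close>
  then have "Legendre (int p) (int q) * Legendre (int p) (int q) = 1" using Legendre_values[of "int p" "int q"] by auto
  then have "Legendre (int p) (int q) * (Legendre (int p) (int q) * Legendre (int q) (int p)) = Legendre (int q) (int p)"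
    by (metis mult.assoc mult_1)
  then show ?thesis unfolding recip_char_def e by (simp add: mult.commute)
qed

lemma recip_char_dirichlet:
  assumes "prime q" "q > 2"
  shows "dirichlet_char (4 * q) (\<lambda>n. of_int (recip_char q n))"
  unfolding dirichlet_char_def
proof (intro conjI allI)
  show "4 * q > 0" using assms by simp
  show "of_int (recip_char q 1) = (1::complex)" using Legendre_one[OF assms(1)] by (simp add: recip_char_def qr_sign_def)
  show "complex_of_int (recip_char q (m * n)) = of_int (recip_char q m) * of_int (recip_char q n)" for m n
    by (simp add: recip_char_def qr_sign_mult Legendre_mult[OF assms])
  show "complex_of_int (recip_char q (n + 4 * q)) = of_int (recip_char q n)" for n
    unfolding recip_char_def qr_sign_add by (subst Legendre_cong[of "int (n + 4 * q)" "int n"]) (auto simp: cong_def)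
  show "complex_of_int (recip_char q n) = 0 \<longleftrightarrow> \<not> coprime n (4 * q)" for n
  proof -
    have "coprime n 4 \<longleftrightarrow> odd n" by (rule coprime_4_iff_odd)
    then show ?thesis using Legendre_eq_0_iff[OF assms(1), of n] by (auto simp: recip_char_def qr_sign_def coprime_mult_right_iff)
  qed
qed

section \<open>Products of reciprocity characters\<close>

lemma dirichlet_char_prod2:
  assumes "dirichlet_char a f" "dirichlet_char b g"
  shows "dirichlet_char (a * b) (\<lambda>n. f n * g n)"
  unfolding dirichlet_char_def
proof (intro conjI allI)
  show "a * b > 0" using assms by (simp add: dirichlet_char_def)
  show "f (n + a * b) * g (n + a * b) = f n * g n" for n
    using dirichlet_char_periodic[OF assms(1), of n b] dirichlet_char_periodic[OF assms(2), of n a] by (simp add: mult.commute)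
  show "f n * g n = 0 \<longleftrightarrow> \<not> coprime n (a * b)" for n
    using assms unfolding dirichlet_char_def by (simp add: coprime_mult_right_iff)
qed (use assms in \<open>auto simp: dirichlet_char_def\<close>)

lemma dirichlet_char_prod:
  assumes "finite D" "\<And>q. q \<in> D \<Longrightarrow> dirichlet_char (m q) (f q)"
  shows "dirichlet_char (\<Prod>q\<in>D. m q) (\<lambda>n. \<Prod>q\<in>D. f q n)"
  using assms
proof (induction D rule: finite_induct)
  case empty
  then show ?case by (simp add: dirichlet_char_def)
next
  case (insert q D)
  then show ?case using dirichlet_char_prod2[of "m q" "f q" "\<Prod>q\<in>D. m q" "\<lambda>n. \<Prod>q\<in>D. f q n"] by simp
qed

text \<open>The Chinese remainder theorem provides a residue at which exactly one factor is -1 and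
  the others are 1. The product of the moduli, not the least one, is used, since only its logarithm
  matters.\<close>

lemma recip_prod_nonprincipal:
  assumes "finite D" "D \<noteq> {}" and D: "\<And>q. q \<in> D \<Longrightarrow> prime q \<and> q > 2"
  shows "dirichlet_char (\<Prod>q\<in>D. 4 * q) (\<lambda>n. of_int (\<Prod>q\<in>D. recip_char q n))"
    and "\<not> principal_char (\<Prod>q\<in>D. 4 * q) (\<lambda>n. of_int (\<Prod>q\<in>D. recip_char q n))"
proof -
  show ch: "dirichlet_char (\<Prod>q\<in>D. 4 * q) (\<lambda>n. of_int (\<Prod>q\<in>D. recip_char q n))"
    using dirichlet_char_prod[OF assms(1), of "\<lambda>q. 4 * q" "\<lambda>q n. of_int (recip_char q n)"] recip_char_dirichlet D
    by simp
  obtain r where r: "r \<in> D" using assms(2) by blast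
  obtain n0 :: nat where n0: "Legendre (int n0) (int r) = -1" using ex_nonresidue D[OF r] by blast
  \<comment> \<open>Being 1 modulo 4 makes every reciprocity sign 1, and being 1 modulo the other
    primes makes their symbols 1.\<close>
  define m where "m = 4 * (\<Prod>q\<in>D - {r}. q)"
  have "coprime r 4" using D[OF r] prime_odd_nat[of r] coprime_4_iff_odd by blast
  moreover have "coprime r (\<Prod>q\<in>D - {r}. q)"
    using D r by (intro prod_coprime_right) (auto intro: primes_coprime)
  ultimately have "coprime m r" unfolding m_def by (simp add: coprime_commute)
  then obtain n where n: "[n = 1] (mod m)" "[n = n0] (mod r)" using binary_chinese_remainder_nat by blast
  have n4: "n mod 4 = 1"
  proof -
    have "[n = 1] (mod 4)" using n(1) by (rule cong_dvd_modulus_nat) (simp add: m_def)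
    then show ?thesis by (simp add: cong_def)
  qed
  then have "odd n" by presburger
  have sg: "qr_sign q n = 1" for q using n4 \<open>odd n\<close> by (simp add: qr_sign_def)
  have "recip_char q n = (if q = r then -1 else 1)" if q: "q \<in> D" for q
  proof (cases "q = r")
    case True
    have "[int n = int n0] (mod int r)" using n(2) by (simp add: cong_int_iff)
    then show ?thesis using True n0 sg Legendre_cong by (simp add: recip_char_def)
  next
    case False
    then have "q dvd m" unfolding m_def using q assms(1) by (intro dvd_mult dvd_prodI) auto
    then have "[n = 1] (mod q)" using n(1) cong_dvd_modulus_nat by blast
    then have "[int n = 1] (mod int q)" by (metis cong_int_iff of_nat_1)
    then show ?thesis using False sg Legendre_cong[of "int n" 1 "int q"] Legendre_one[of q] D[OF q] by (simp add: recip_char_def)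
  qed
  then have "(\<Prod>q\<in>D. recip_char q n) = (\<Prod>q\<in>D. if q = r then -1 else 1)" by (intro prod.cong) auto
  also have "\<dots> = -1" using assms(1) r by (simp add: prod.delta)
  finally have v: "(\<Prod>q\<in>D. recip_char q n) = -1" .
  have "complex_of_int (\<Prod>q\<in>D. recip_char q n) \<noteq> 0" unfolding v by simp
  then have "coprime n (\<Prod>q\<in>D. 4 * q)" using ch unfolding dirichlet_char_def by blast
  moreover have "complex_of_int (\<Prod>q\<in>D. recip_char q n) \<noteq> 1" unfolding v by simp
  ultimately show "\<not> principal_char (\<Prod>q\<in>D. 4 * q) (\<lambda>n. of_int (\<Prod>q\<in>D. recip_char q n))"
    unfolding principal_char_def by blast
qed

text \<open>The input for the detector: every nontrivial product of symbols is almost uncorrelated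
  with the Gaussian weight on primes.\<close>

lemma recip_prod_gauss_sum:
  assumes "GRH" "e > 0"
  shows "\<exists>K>0. \<forall>D \<mu>. finite D \<and> D \<noteq> {} \<and> (\<forall>q\<in>D. prime q \<and> q > 2) \<longrightarrow>
    \<bar>\<Sum>p. on_primes (gauss_weight \<mu>) p * real_of_int (\<Prod>q\<in>D. recip_char q p)\<bar> \<le> K * ln (\<Prod>q\<in>D. 4 * real q) * exp ((1/2 + e) * \<mu>)"
proof -
  obtain K where K: "K > 0" "\<And>q chi \<mu>. dirichlet_char q chi \<Longrightarrow> \<not> principal_char q chi \<Longrightarrow>
    cmod (\<Sum>p. on_primes chi p * of_real (gauss_weight \<mu> p)) \<le> K * ln (real q) * exp ((1/2 + e) * \<mu>)"
    using char_prime_gauss_sum[OF assms] by blast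
  have "\<bar>\<Sum>p. on_primes (gauss_weight \<mu>) p * real_of_int (\<Prod>q\<in>D. recip_char q p)\<bar> \<le> K * ln (\<Prod>q\<in>D. 4 * real q) * exp ((1/2 + e) * \<mu>)"
    if D: "finite D" "D \<noteq> {}" "\<forall>q\<in>D. prime q \<and> q > 2" for D \<mu>
  proof -
    let ?f = "\<lambda>n. real_of_int (\<Prod>q\<in>D. recip_char q n)"
    have fb: "\<bar>?f n\<bar> \<le> 1" for n
    proof -
      have "\<bar>\<Prod>q\<in>D. recip_char q n\<bar> \<le> 1" unfolding abs_prod using recip_char_values by (intro prod_le_1) auto
      then show ?thesis by linarith
    qed
    have "summable (\<lambda>p. on_primes (gauss_weight \<mu>) p * ?f p)"
    proof (rule summable_comparison_test'[OF gauss_weight_summable[of \<mu>]])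
      fix p :: nat
      show "norm (on_primes (gauss_weight \<mu>) p * ?f p) \<le> gauss_weight \<mu> p"
        using fb[of p] gauss_weight_pos[of \<mu> p] by (auto simp: abs_mult mult_left_le)
    qed
    then have "complex_of_real (\<Sum>p. on_primes (gauss_weight \<mu>) p * ?f p) = (\<Sum>p. of_real (on_primes (gauss_weight \<mu>) p * ?f p))"
      by (rule suminf_of_real)
    also have "\<dots> = (\<Sum>p. on_primes (\<lambda>n. of_int (\<Prod>q\<in>D. recip_char q n)) p * of_real (gauss_weight \<mu> p))"
      by (intro suminf_cong) (simp add: mult.commute)
    finally have eq: "complex_of_real (\<Sum>p. on_primes (gauss_weight \<mu>) p * ?f p) = (\<Sum>p. on_primes (\<lambda>n. of_int (\<Prod>q\<in>D. recip_char q n)) p * of_real (gauss_weight \<mu> p))" .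
    have "\<bar>\<Sum>p. on_primes (gauss_weight \<mu>) p * ?f p\<bar> = cmod (\<Sum>p. on_primes (\<lambda>n. of_int (\<Prod>q\<in>D. recip_char q n)) p * of_real (gauss_weight \<mu> p))"
      unfolding eq[symmetric] by (rule norm_of_real[symmetric])
    also have "\<dots> \<le> K * ln (real (\<Prod>q\<in>D. 4 * q)) * exp ((1/2 + e) * \<mu>)"
      using recip_prod_nonprincipal[OF D(1,2)] D(3) by (intro K(2)) auto
    finally show ?thesis by simp
  qed
  then show ?thesis using K(1) by blast
qed

subsection \<open>Detecting prescribed signs\<close>

text \<open>The combinatorial core, free of number theory: \<open>g\<close> weights the points p,
  signs are prescribed on \<open>S\<close>, the indices in \<open>R\<close> form the part to be
  averaged, and \<open>E\<close> bounds every nonempty product correlation.\<close>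

locale sign_detector =
  fixes g :: "nat \<Rightarrow> real" and J :: "nat \<Rightarrow> nat \<Rightarrow> real" and S R :: "nat set"
    and \<epsilon> :: "nat \<Rightarrow> real" and c :: "nat \<Rightarrow> complex" and E :: real
  assumes g_nonneg: "\<And>p. g p \<ge> 0" and g_summable: "summable g"
    and J_bound: "\<And>q p. \<bar>J q p\<bar> \<le> 1"
    and finite_S: "finite S" and finite_R: "finite R" and disjoint: "S \<inter> R = {}"
    and sign: "\<And>q. q \<in> S \<Longrightarrow> \<bar>\<epsilon> q\<bar> = 1"
    and E_nonneg: "E \<ge> 0"
    and correlation: "\<And>D. D \<subseteq> S \<union> R \<Longrightarrow> D \<noteq> {} \<Longrightarrow> \<bar>\<Sum>p. g p * (\<Prod>q\<in>D. J q p)\<bar> \<le> E"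
begin

text \<open>For symbols with values 1 and -1 this is 2^|S| if all prescribed signs occur at p, and 0
  otherwise.\<close>

definition weight :: "nat \<Rightarrow> real" where "weight p = (\<Prod>q\<in>S. 1 + \<epsilon> q * J q p)"
definition tail :: "nat \<Rightarrow> complex" where "tail p = (\<Sum>q\<in>R. c q * of_real (J q p))"
definition mass :: real where "mass = (\<Sum>p. g p * weight p)"

lemma summable_bounded: "(\<And>p. \<bar>f p\<bar> \<le> C) \<Longrightarrow> summable (\<lambda>p. g p * f p)"
proof (rule summable_comparison_test')
  show "summable (\<lambda>p. g p * C)" using g_summable by (rule summable_mult2)
  show "norm (g p * f p) \<le> g p * C" if "\<And>p. \<bar>f p\<bar> \<le> C" for p
    using that[of p] g_nonneg[of p] by (simp add: abs_mult mult_left_mono)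
qed

lemma factor_bounds: "q \<in> S \<Longrightarrow> 0 \<le> 1 + \<epsilon> q * J q p \<and> 1 + \<epsilon> q * J q p \<le> 2"
proof -
  assume "q \<in> S"
  then have "\<bar>\<epsilon> q * J q p\<bar> \<le> 1" using sign J_bound[of q p] by (simp add: abs_mult)
  then show ?thesis by linarith
qed

lemma weight_nonneg: "weight p \<ge> 0"
  unfolding weight_def using factor_bounds by (intro prod_nonneg) auto

lemma weight_le: "weight p \<le> 2 ^ card S"
proof -
  have "weight p \<le> (\<Prod>q\<in>S. 2)" unfolding weight_def using factor_bounds by (intro prod_mono) auto
  then show ?thesis by simp
qed

lemma J_prod_bound: "\<bar>\<Prod>q\<in>D. J q p\<bar> \<le> 1"
  unfolding abs_prod using J_bound by (intro prod_le_1) auto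

lemma summable_J_prod: "summable (\<lambda>p. g p * (\<Prod>q\<in>D. J q p))"
  by (rule summable_bounded[OF J_prod_bound])

lemma weight_expand: "weight p = (\<Sum>D\<in>Pow S. (\<Prod>q\<in>D. \<epsilon> q) * (\<Prod>q\<in>D. J q p))"
proof -
  have "weight p = (\<Prod>q\<in>S. \<epsilon> q * J q p + 1)" unfolding weight_def by (simp add: add.commute)
  also have "\<dots> = (\<Sum>D\<in>Pow S. (\<Prod>q\<in>D. \<epsilon> q * J q p) * (\<Prod>q\<in>S - D. 1))"
    by (rule prod_add[OF finite_S])
  finally show ?thesis by (simp add: prod.distrib)
qed

lemma abs_sign_prod: "D \<subseteq> S \<Longrightarrow> \<bar>\<Prod>q\<in>D. \<epsilon> q\<bar> = 1"
  unfolding abs_prod using sign by (intro prod.neutral) auto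

text \<open>As \<open>R\<close> and \<open>S\<close> are disjoint, each term of the expanded weight
  times a product over \<open>F\<close> is again a product of distinct symbols, to which
  \<open>correlation\<close> applies.\<close>

lemma weighted_correlation:
  assumes "F \<subseteq> R"
  shows "(\<Sum>p. g p * (weight p * (\<Prod>q\<in>F. J q p))) = (\<Sum>D\<in>Pow S. (\<Prod>q\<in>D. \<epsilon> q) * (\<Sum>p. g p * (\<Prod>q\<in>D \<union> F. J q p)))"
proof -
  have "g p * (weight p * (\<Prod>q\<in>F. J q p)) = (\<Sum>D\<in>Pow S. (\<Prod>q\<in>D. \<epsilon> q) * (g p * (\<Prod>q\<in>D \<union> F. J q p)))" for p
  proof -
    have "(\<Prod>q\<in>D \<union> F. J q p) = (\<Prod>q\<in>D. J q p) * (\<Prod>q\<in>F. J q p)" if "D \<in> Pow S" for D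
      using that assms disjoint finite_S finite_R by (intro prod.union_disjoint) (auto intro: finite_subset)
    then show ?thesis unfolding weight_expand sum_distrib_right sum_distrib_left
      by (intro sum.cong) (simp_all add: mult_ac)
  qed
  then have "(\<Sum>p. g p * (weight p * (\<Prod>q\<in>F. J q p))) = (\<Sum>p. \<Sum>D\<in>Pow S. (\<Prod>q\<in>D. \<epsilon> q) * (g p * (\<Prod>q\<in>D \<union> F. J q p)))"
    by simp
  also have "\<dots> = (\<Sum>D\<in>Pow S. \<Sum>p. (\<Prod>q\<in>D. \<epsilon> q) * (g p * (\<Prod>q\<in>D \<union> F. J q p)))"
    by (intro suminf_sum summable_mult summable_J_prod)
  also have "\<dots> = (\<Sum>D\<in>Pow S. (\<Prod>q\<in>D. \<epsilon> q) * (\<Sum>p. g p * (\<Prod>q\<in>D \<union> F. J q p)))"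
    by (intro sum.cong refl suminf_mult summable_J_prod)
  finally show ?thesis .
qed

text \<open>The empty subset yields the main term, the other at most 2^|S| subsets yield at most
  \<open>E\<close> each.\<close>

lemma mass_lower: "mass \<ge> (\<Sum>p. g p) - 2 ^ card S * E"
proof -
  have "mass = (\<Sum>D\<in>Pow S. (\<Prod>q\<in>D. \<epsilon> q) * (\<Sum>p. g p * (\<Prod>q\<in>D. J q p)))"
    using weighted_correlation[of "{}"] by (simp add: mass_def)
  also have "\<dots> = (\<Sum>p. g p) + (\<Sum>D\<in>Pow S - {{}}. (\<Prod>q\<in>D. \<epsilon> q) * (\<Sum>p. g p * (\<Prod>q\<in>D. J q p)))"
    by (subst sum.remove[of "Pow S" "{}"]) (use finite_S in auto)
  finally have m: "mass = (\<Sum>p. g p) + (\<Sum>D\<in>Pow S - {{}}. (\<Prod>q\<in>D. \<epsilon> q) * (\<Sum>p. g p * (\<Prod>q\<in>D. J q p)))" .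
  have "\<bar>\<Sum>D\<in>Pow S - {{}}. (\<Prod>q\<in>D. \<epsilon> q) * (\<Sum>p. g p * (\<Prod>q\<in>D. J q p))\<bar> \<le> (\<Sum>D\<in>Pow S - {{}}. E)"
  proof (rule order_trans[OF sum_abs], rule sum_mono)
    fix D assume D: "D \<in> Pow S - {{}}"
    then show "\<bar>(\<Prod>q\<in>D. \<epsilon> q) * (\<Sum>p. g p * (\<Prod>q\<in>D. J q p))\<bar> \<le> E"
      using correlation[of D] abs_sign_prod[of D] by (auto simp: abs_mult)
  qed
  also have "\<dots> \<le> (\<Sum>D\<in>Pow S. E)" using finite_S E_nonneg by (intro sum_mono2) auto
  also have "\<dots> = 2 ^ card S * E" using finite_S by (simp add: card_Pow)
  finally show ?thesis unfolding m by linarith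
qed

lemma cross_bound:
  assumes "F \<subseteq> R" "F \<noteq> {}"
  shows "\<bar>\<Sum>p. g p * (weight p * (\<Prod>q\<in>F. J q p))\<bar> \<le> 2 ^ card S * E"
proof -
  have "\<bar>\<Sum>p. g p * (weight p * (\<Prod>q\<in>F. J q p))\<bar> \<le> (\<Sum>D\<in>Pow S. E)"
    unfolding weighted_correlation[OF assms(1)]
  proof (rule order_trans[OF sum_abs], rule sum_mono)
    fix D assume D: "D \<in> Pow S"
    then show "\<bar>(\<Prod>q\<in>D. \<epsilon> q) * (\<Sum>p. g p * (\<Prod>q\<in>D \<union> F. J q p))\<bar> \<le> E"
      using correlation[of "D \<union> F"] abs_sign_prod[of D] assms by (auto simp: abs_mult)
  qed
  also have "\<dots> = 2 ^ card S * E" using finite_S by (simp add: card_Pow)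
  finally show ?thesis .
qed

lemma weight_bounded: "\<bar>weight p\<bar> \<le> 2 ^ card S"
  using weight_nonneg weight_le by simp

lemma mass_nonneg: "mass \<ge> 0"
  unfolding mass_def
  by (intro suminf_nonneg summable_bounded[OF weight_bounded] mult_nonneg_nonneg g_nonneg weight_nonneg)

lemma tail_square: "cmod (tail p) ^ 2 = (\<Sum>q\<in>R. \<Sum>q'\<in>R. Re (c q * cnj (c q')) * (J q p * J q' p))"
proof -
  have "complex_of_real (cmod (tail p) ^ 2) = tail p * cnj (tail p)"
    by (rule complex_norm_square)
  also have "\<dots> = (\<Sum>q\<in>R. \<Sum>q'\<in>R. (c q * cnj (c q')) * of_real (J q p * J q' p))"
    unfolding tail_def cnj_sum sum_product by (intro sum.cong refl) (simp add: mult_ac)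
  finally have "Re (complex_of_real (cmod (tail p) ^ 2)) = Re (\<Sum>q\<in>R. \<Sum>q'\<in>R. (c q * cnj (c q')) * of_real (J q p * J q' p))"
    by (rule arg_cong)
  then show ?thesis by (simp add: Re_sum)
qed

lemma tail_bound: "cmod (tail p) \<le> (\<Sum>q\<in>R. cmod (c q))"
  unfolding tail_def
proof (rule sum_norm_le)
  fix q assume "q \<in> R"
  show "cmod (c q * of_real (J q p)) \<le> cmod (c q)"
    using J_bound[of q p] by (simp add: norm_mult mult_left_le)
qed

lemma wJ_bounded: "\<bar>weight p * (J q p * J q' p)\<bar> \<le> 2 ^ card S"
proof -
  have "\<bar>J q p * J q' p\<bar> \<le> 1" using mult_mono[OF J_bound[of q p] J_bound[of q' p]] by (simp add: abs_mult)
  then have "\<bar>weight p\<bar> * \<bar>J q p * J q' p\<bar> \<le> 2 ^ card S * 1" using weight_bounded by (intro mult_mono) auto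
  then show ?thesis by (simp add: abs_mult)
qed

lemma summable_wJ: "summable (\<lambda>p. g p * (weight p * (J q p * J q' p)))"
  by (rule summable_bounded[OF wJ_bounded])

text \<open>The diagonal gives the mass times the square sum of the coefficients; off the diagonal
  two distinct indices of \<open>R\<close> make the product nonempty, so even the empty subset of
  \<open>S\<close> gives only an error.\<close>

lemma second_moment:
  "(\<Sum>p. g p * (weight p * cmod (tail p) ^ 2)) \<le> mass * (\<Sum>q\<in>R. cmod (c q) ^ 2) + 2 ^ card S * E * (\<Sum>q\<in>R. cmod (c q)) ^ 2"
proof -
  let ?I = "\<lambda>q q'. \<Sum>p. g p * (weight p * (J q p * J q' p))"
  have "(\<Sum>p. g p * (weight p * cmod (tail p) ^ 2)) = (\<Sum>p. \<Sum>q\<in>R. \<Sum>q'\<in>R. Re (c q * cnj (c q')) * (g p * (weight p * (J q p * J q' p))))"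
    unfolding tail_square sum_distrib_left by (intro suminf_cong sum.cong refl) (simp only: mult_ac)
  also have "\<dots> = (\<Sum>q\<in>R. \<Sum>q'\<in>R. \<Sum>p. Re (c q * cnj (c q')) * (g p * (weight p * (J q p * J q' p))))"
    by (simp only: suminf_sum summable_sum summable_mult summable_wJ)
  also have "\<dots> = (\<Sum>q\<in>R. \<Sum>q'\<in>R. Re (c q * cnj (c q')) * ?I q q')"
    by (intro sum.cong refl suminf_mult summable_wJ)
  also have "\<dots> \<le> (\<Sum>q\<in>R. \<Sum>q'\<in>R. (if q' = q then cmod (c q) ^ 2 * mass else 0) + cmod (c q) * cmod (c q') * (2 ^ card S * E))"
  proof (intro sum_mono)
    fix q q' assume q: "q \<in> R" "q' \<in> R"
    show "Re (c q * cnj (c q')) * ?I q q' \<le> (if q' = q then cmod (c q) ^ 2 * mass else 0) + cmod (c q) * cmod (c q') * (2 ^ card S * E)"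
    proof (cases "q' = q")
      case True
      have "?I q q \<le> mass" unfolding mass_def
      proof (rule suminf_le)
        show "g p * (weight p * (J q p * J q p)) \<le> g p * weight p" for p
        proof -
          have "J q p * J q p \<le> 1" using J_bound[of q p] abs_square_le_1[of "J q p"] by (simp add: power2_eq_square)
          then show ?thesis using g_nonneg[of p] weight_nonneg[of p] by (simp add: mult_left_mono mult_left_le)
        qed
      qed (intro summable_bounded[OF wJ_bounded] summable_bounded[OF weight_bounded])+
      moreover have "Re (c q * cnj (c q)) = cmod (c q) ^ 2" by (simp add: complex_mult_cnj cmod_power2)
      moreover have "cmod (c q) * cmod (c q') * (2 ^ card S * E) \<ge> 0" using E_nonneg by simp
      ultimately show ?thesis using True mult_left_mono[of "?I q q" mass "cmod (c q) ^ 2"] by simp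
    next
      case False
      have "(\<Prod>r\<in>{q, q'}. J r p) = J q p * J q' p" for p using False by simp
      then have "\<bar>?I q q'\<bar> \<le> 2 ^ card S * E" using cross_bound[of "{q, q'}"] q by simp
      moreover have "\<bar>Re (c q * cnj (c q'))\<bar> \<le> cmod (c q) * cmod (c q')"
        using abs_Re_le_cmod[of "c q * cnj (c q')"] by (simp add: norm_mult)
      ultimately have "\<bar>Re (c q * cnj (c q')) * ?I q q'\<bar> \<le> cmod (c q) * cmod (c q') * (2 ^ card S * E)"
        unfolding abs_mult by (intro mult_mono) auto
      then show ?thesis using False by simp
    qed
  qed
  also have "\<dots> = mass * (\<Sum>q\<in>R. cmod (c q) ^ 2) + 2 ^ card S * E * (\<Sum>q\<in>R. cmod (c q)) ^ 2"
  proof -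
    have "(\<Sum>q\<in>R. \<Sum>q'\<in>R. if q' = q then cmod (c q) ^ 2 * mass else 0) = mass * (\<Sum>q\<in>R. cmod (c q) ^ 2)"
      using finite_R by (simp add: sum_distrib_left mult.commute)
    moreover have "(\<Sum>q\<in>R. \<Sum>q'\<in>R. cmod (c q) * cmod (c q') * (2 ^ card S * E)) = 2 ^ card S * E * (\<Sum>q\<in>R. cmod (c q)) ^ 2"
      by (simp only: power2_eq_square sum_product sum_distrib_right[symmetric]) (simp only: mult.commute)
    ultimately show ?thesis unfolding sum.distrib by (simp only:)
  qed
  finally show ?thesis .
qed

text \<open>Chebyshev's inequality: points with |tail|^2 > 4A carry at most a quarter of the mass
  plus an error, which leaves 3/4. A remaining point is worth at most 2^|S|, and those outside
  \<open>X\<close> are covered by \<tau>.\<close>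

lemma many_good_points:
  assumes A: "(\<Sum>q\<in>R. cmod (c q) ^ 2) \<le> A" "A > 0" and X: "finite X"
    and g1: "\<And>p. g p \<le> 1" and \<tau>: "(\<Sum>p. if p \<in> X then 0 else g p) \<le> \<tau>"
  shows "3/4 * (\<Sum>p. g p) / 2 ^ card S - E - E * (\<Sum>q\<in>R. cmod (c q)) ^ 2 / (4 * A) - \<tau>
    \<le> real (card {p \<in> X. g p \<noteq> 0 \<and> weight p \<noteq> 0 \<and> cmod (tail p) ^ 2 \<le> 4 * A})"
proof -
  define N where "N = (2::real) ^ card S"
  define B where "B = (\<Sum>q\<in>R. cmod (c q))"
  define G where "G = {p \<in> X. g p \<noteq> 0 \<and> weight p \<noteq> 0 \<and> cmod (tail p) ^ 2 \<le> 4 * A}"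
  have N: "N > 0" by (simp add: N_def)
  have finG: "finite G" using X by (simp add: G_def)
  have tb: "cmod (tail p) ^ 2 \<le> B ^ 2" for p unfolding B_def using tail_bound[of p] by (intro power_mono) auto
  have wt: "\<bar>weight p * cmod (tail p) ^ 2\<bar> \<le> 2 ^ card S * B ^ 2" for p
    unfolding abs_mult using weight_bounded tb by (intro mult_mono) auto
  let ?tau = "\<lambda>p. if p \<in> X then 0 else g p"
  have st: "summable ?tau"
    using summable_bounded[of "\<lambda>p. if p \<in> X then 0 else 1" 1] by (simp add: if_distrib cong: if_cong)
  have sG: "(\<lambda>p. if p \<in> G then 1 else 0 :: real) sums real (card G)"
    using sums_If_finite_set[OF finG, of "\<lambda>_. 1 :: real"] by simp
  \<comment> \<open>Pointwise form of the argument: a point with large tail is paid by the second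
    moment, a good one by the count, one outside \<open>X\<close> by the Gaussian tail.\<close>
  have pw: "g p * weight p \<le> (g p * (weight p * cmod (tail p) ^ 2)) / (4 * A) + (N * (if p \<in> G then 1 else 0) + N * ?tau p)" for p
  proof (cases "cmod (tail p) ^ 2 \<le> 4 * A")
    case False
    then have "(g p * weight p) * (4 * A) \<le> (g p * weight p) * cmod (tail p) ^ 2"
      using g_nonneg weight_nonneg by (intro mult_left_mono) auto
    then have "g p * weight p \<le> (g p * (weight p * cmod (tail p) ^ 2)) / (4 * A)"
      using A(2) by (simp add: pos_le_divide_eq mult.assoc)
    moreover have "0 \<le> N * (if p \<in> G then 1 else 0) + N * ?tau p" using N g_nonneg by simp
    ultimately show ?thesis by linarith
  next
    case True
    have "0 \<le> (g p * (weight p * cmod (tail p) ^ 2)) / (4 * A)"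
      using A(2) g_nonneg weight_nonneg by simp
    moreover have "g p * weight p \<le> N * (if p \<in> G then 1 else 0) + N * ?tau p"
    proof (cases "p \<in> X")
      case False
      then show ?thesis using mult_left_mono[OF weight_le[of p] g_nonneg[of p]] True N by (simp add: N_def G_def mult.commute)
    next
      case pX: True
      show ?thesis
      proof (cases "p \<in> G")
        case pG: True
        have "g p * weight p \<le> 1 * N" unfolding N_def using g1 g_nonneg weight_le weight_nonneg by (intro mult_mono) auto
        then show ?thesis using pG pX by simp
      next
        case False
        then have "g p * weight p = 0" using pX True by (auto simp: G_def)
        then show ?thesis using False pX by auto
      qed
    qed
    ultimately show ?thesis by linarith
  qed
  have s2: "summable (\<lambda>p. g p * (weight p * cmod (tail p) ^ 2))" by (rule summable_bounded[OF wt])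
  have rhs: "(\<lambda>p. (g p * (weight p * cmod (tail p) ^ 2)) / (4 * A) + (N * (if p \<in> G then 1 else 0) + N * ?tau p)) sums
     ((\<Sum>p. g p * (weight p * cmod (tail p) ^ 2)) / (4 * A) + (N * real (card G) + N * (\<Sum>p. ?tau p)))"
    by (intro sums_add sums_divide sums_mult summable_sums s2 sG st)
  have "mass \<le> (\<Sum>p. g p * (weight p * cmod (tail p) ^ 2)) / (4 * A) + (N * real (card G) + N * (\<Sum>p. ?tau p))"
    unfolding mass_def by (rule sums_le[OF pw summable_sums[OF summable_bounded[OF weight_bounded]] rhs])
  also have "\<dots> \<le> (mass * A + N * E * B ^ 2) / (4 * A) + (N * real (card G) + N * \<tau>)"
  proof (intro add_mono divide_right_mono mult_left_mono \<tau> order.refl)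
    show "(\<Sum>p. g p * (weight p * cmod (tail p) ^ 2)) \<le> mass * A + N * E * B ^ 2"
      using second_moment mult_left_mono[OF A(1) mass_nonneg] unfolding N_def B_def by linarith
  qed (use A N in auto)
  finally have "mass \<le> mass / 4 + N * E * B ^ 2 / (4 * A) + N * real (card G) + N * \<tau>"
    using A(2) by (simp add: add_divide_distrib)
  moreover have "N * E * B ^ 2 / (4 * A) = N * (E * B ^ 2 / (4 * A))" by simp
  ultimately have "3/4 * mass \<le> N * (E * B ^ 2 / (4 * A)) + N * real (card G) + N * \<tau>" by linarith
  moreover have "3/4 * ((\<Sum>p. g p) - N * E) \<le> 3/4 * mass" using mass_lower unfolding N_def by simp
  moreover have "N * E \<ge> 0" using N E_nonneg by simp
  ultimately have "3/4 * (\<Sum>p. g p) \<le> N * (E * B ^ 2 / (4 * A)) + N * real (card G) + N * \<tau> + N * E" by argo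
  then have "3/4 * (\<Sum>p. g p) / N \<le> (N * (E * B ^ 2 / (4 * A) + real (card G) + \<tau> + E)) / N"
    using N by (intro divide_right_mono) (auto simp: distrib_left)
  also have "\<dots> = E * B ^ 2 / (4 * A) + real (card G) + \<tau> + E" using N by simp
  finally show ?thesis unfolding N_def B_def G_def by linarith
qed

lemma weight_nonzero_sign:
  assumes "weight p \<noteq> 0" "q \<in> S" "J q p = -1 \<or> J q p = 1"
  shows "J q p = \<epsilon> q"
proof -
  have "1 + \<epsilon> q * J q p \<noteq> 0" using assms finite_S by (auto simp: weight_def)
  moreover have "\<epsilon> q = 1 \<or> \<epsilon> q = -1" using sign[OF assms(2)] by linarith
  ultimately show ?thesis using assms(3) by auto
qed

end

subsection \<open>Primes with prescribed Legendre symbols\<close>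

lemma block_sum_real:
  assumes "GRH" "B > 0" "\<alpha> > 0"
  shows "((\<lambda>\<mu>. (\<Sum>p\<in>block B \<mu>. ln (real p) * real p powr (\<alpha> - 1)) / exp (\<alpha> * \<mu>)) \<longlongrightarrow> (1 - exp (- \<alpha> * B)) / \<alpha>) at_top"
proof -
  have "((\<lambda>\<mu>. Re ((\<Sum>p\<in>block B \<mu>. of_real (ln (real p)) * of_nat p powr (of_real \<alpha> - 1)) / exp (of_real \<alpha> * of_real \<mu>))) \<longlongrightarrow> Re ((1 - exp (- of_real \<alpha> * of_real B)) / of_real \<alpha>)) at_top"
    using assms by (intro tendsto_Re prime_block_sum) auto
  moreover have "Re ((\<Sum>p\<in>block B \<mu>. of_real (ln (real p)) * of_nat p powr (of_real \<alpha> - 1)) / exp (of_real \<alpha> * of_real \<mu>)) = (\<Sum>p\<in>block B \<mu>. ln (real p) * real p powr (\<alpha> - 1)) / exp (\<alpha> * \<mu>)" for \<mu>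
  proof -
    have "(\<Sum>p\<in>block B \<mu>. complex_of_real (ln (real p)) * of_nat p powr (of_real \<alpha> - 1)) = of_real (\<Sum>p\<in>block B \<mu>. ln (real p) * real p powr (\<alpha> - 1))"
    proof -
      have "of_nat p powr (of_real \<alpha> - 1) = complex_of_real (real p powr (\<alpha> - 1))" for p
        using powr_of_real[of "real p" "\<alpha> - 1"] by simp
      then show ?thesis by simp
    qed
    moreover have "exp (complex_of_real \<alpha> * of_real \<mu>) = of_real (exp (\<alpha> * \<mu>))"
      by (simp only: of_real_mult[symmetric] exp_of_real)
    ultimately show ?thesis by (simp only: of_real_divide[symmetric] Re_complex_of_real)
  qed
  moreover have "Re ((1 - exp (- of_real \<alpha> * of_real B)) / of_real \<alpha>) = (1 - exp (- \<alpha> * B)) / \<alpha>"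
  proof -
    have "(1 - exp (- of_real \<alpha> * of_real B)) / of_real \<alpha> = complex_of_real ((1 - exp (- \<alpha> * B)) / \<alpha>)"
      by (simp flip: exp_of_real)
    then show ?thesis by (simp only: Re_complex_of_real)
  qed
  ultimately show ?thesis by (simp only:)
qed

text \<open>Only primes between e^(\<mu>-1) and e^\<mu> are used: their weight is at least e^(-1/2)
  >= 1/2, and their sum of ln p is asymptotically (1 - 1/e) e^\<mu>, with 1 - 1/e > 1/2.\<close>

lemma gauss_mass_lower:
  assumes "GRH"
  shows "\<forall>\<^sub>F \<mu> in at_top. (\<Sum>p. on_primes (gauss_weight \<mu>) p) \<ge> exp \<mu> / (4 * \<mu>)"
proof -
  have "exp (-1) < (1/2 :: real)"
  proof -
    have "(2::real) \<le> exp 1" using exp_ge_add_one_self[of 1] by simp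
    moreover have "exp (1::real) \<noteq> 2" using e_less_272 exp_lower_Taylor_quadratic[of 1] by auto
    ultimately have "exp (1::real) > 2" by simp
    then show ?thesis by (simp add: exp_minus field_simps)
  qed
  then have "1/2 < (1 - exp (- 1 * 1)) / (1::real)" by simp
  from order_tendstoD(1)[OF block_sum_real[OF assms, of 1 1] this]
  have "\<forall>\<^sub>F \<mu> in at_top. 1/2 < (\<Sum>p\<in>block 1 \<mu>. ln (real p) * real p powr (1 - 1)) / exp (1 * \<mu>)" by simp
  then show ?thesis using eventually_gt_at_top[of 1]
  proof eventually_elim
    case (elim \<mu>)
    have "exp \<mu> / 2 \<le> (\<Sum>p\<in>block 1 \<mu>. ln (real p) * real p powr (1 - 1))"
      using elim(1) by (simp add: field_simps)
    also have "\<dots> \<le> (\<Sum>p\<in>block 1 \<mu>. 2 * \<mu> * gauss_weight \<mu> p)"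
    proof (rule sum_mono)
      fix p assume p: "p \<in> block 1 \<mu>"
      then have "p > 0" and l: "\<mu> - 1 \<le> ln (real p)" "ln (real p) \<le> \<mu>" by (auto simp: block_def prime_gt_0_nat)
      have "(\<mu> - ln (real p))\<^sup>2 \<le> 1\<^sup>2" using l by (intro power_mono) auto
      then have "exp (- 1 / 2) \<le> gauss_weight \<mu> p" unfolding gauss_weight_def by simp
      moreover have "exp (- 1 / 2) \<ge> (1/2::real)" using exp_ge_add_one_self[of "-1/2"] by simp
      ultimately have "1/2 \<le> gauss_weight \<mu> p" by linarith
      then have "\<mu> * (1/2) \<le> \<mu> * gauss_weight \<mu> p" using elim(2) by (intro mult_left_mono) auto
      then show "ln (real p) * real p powr (1 - 1) \<le> 2 * \<mu> * gauss_weight \<mu> p" using l \<open>p > 0\<close> by simp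
    qed
    also have "\<dots> = 2 * \<mu> * (\<Sum>p\<in>block 1 \<mu>. on_primes (gauss_weight \<mu>) p)"
      unfolding sum_distrib_left by (intro sum.cong) (auto simp: block_def)
    also have "\<dots> \<le> 2 * \<mu> * (\<Sum>p. on_primes (gauss_weight \<mu>) p)"
    proof (intro mult_left_mono sum_le_suminf finite_block)
      show "summable (on_primes (gauss_weight \<mu>))"
        by (rule summable_comparison_test'[OF gauss_weight_summable[of \<mu>]]) (simp add: gauss_weight_pos less_imp_le)
    qed (use elim(2) gauss_weight_pos[of \<mu>] in \<open>auto simp: less_imp_le\<close>)
    finally show ?case using elim(2) by (simp add: field_simps)
  qed
qed

text \<open>With L = log x, the left side collects the target sqrt x, the room L + 2 for excluded
  primes, the Gaussian tail and the correlation error x^(1/2+\<delta>) with its powers of L; the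
  right side is the main term after division by 2^|S|.\<close>

lemma exp_dominates:
  fixes \<delta> C \<tau> :: real
  assumes "\<delta> > 0"
  shows "\<forall>\<^sub>F L in at_top. exp (L / 2) + L + 2 + \<tau> + C * L ^ n * exp ((1/2 + \<delta>) * L) \<le> 3/16 * exp ((1/2 + 3 * \<delta>) * L) / L"
proof -
  have l: "((\<lambda>L::real. L ^ m * exp (- \<delta> * L)) \<longlongrightarrow> 0) at_top" for m
  proof -
    have "((\<lambda>L::real. L powr real m * exp (- \<delta> * L)) \<longlongrightarrow> 0) at_top" using assms by real_asymp
    moreover have "\<forall>\<^sub>F L::real in at_top. L powr real m * exp (- \<delta> * L) = L ^ m * exp (- \<delta> * L)"
      using eventually_gt_at_top[of 0] by eventually_elim (simp add: powr_realpow)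
    ultimately show ?thesis by (rule Lim_transform_eventually)
  qed
  have "((\<lambda>L. (3 + \<bar>\<tau>\<bar>) * (L ^ 2 * exp (- \<delta> * L)) + \<bar>C\<bar> * (L ^ (n + 1) * exp (- \<delta> * L))) \<longlongrightarrow> (3 + \<bar>\<tau>\<bar>) * 0 + \<bar>C\<bar> * 0) at_top"
    by (intro tendsto_intros l)
  then have "\<forall>\<^sub>F L in at_top. (3 + \<bar>\<tau>\<bar>) * (L ^ 2 * exp (- \<delta> * L)) + \<bar>C\<bar> * (L ^ (n + 1) * exp (- \<delta> * L)) < 3/16"
    by (rule order_tendstoD) simp
  then show ?thesis using eventually_gt_at_top[of 2]
  proof eventually_elim
    case (elim L)
    define X where "X = exp ((1/2 + \<delta>) * L)"
    have X1: "exp (L / 2) \<le> X" "L \<le> X * L" "1 \<le> X" unfolding X_def using assms elim(2) by (auto simp: algebra_simps)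
    have "exp (L / 2) + L + 2 + \<tau> \<le> X * L + X * L + X * L + \<bar>\<tau>\<bar> * (X * L)"
    proof (intro add_mono)
      have "X * 1 \<le> X * L" using X1 elim by (intro mult_left_mono) auto
      then show "exp (L / 2) \<le> X * L" using X1 by linarith
      show "2 \<le> X * L" using X1 elim by linarith
      have "1 \<le> X * L" using X1 elim by linarith
      then have "\<bar>\<tau>\<bar> * 1 \<le> \<bar>\<tau>\<bar> * (X * L)" by (intro mult_left_mono) auto
      then show "\<tau> \<le> \<bar>\<tau>\<bar> * (X * L)" by linarith
    qed (rule X1)
    moreover have "C * L ^ n * X \<le> \<bar>C\<bar> * L ^ n * X" using elim X1 by (intro mult_right_mono) auto
    ultimately have "exp (L / 2) + L + 2 + \<tau> + C * L ^ n * X \<le> (3 + \<bar>\<tau>\<bar>) * (X * L) + \<bar>C\<bar> * L ^ n * X"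
      by (simp add: algebra_simps)
    also have "\<dots> = X * ((3 + \<bar>\<tau>\<bar>) * (L ^ 2 * exp (- \<delta> * L)) + \<bar>C\<bar> * (L ^ (n + 1) * exp (- \<delta> * L))) * exp (\<delta> * L) / L"
      using elim by (simp add: exp_minus field_simps power2_eq_square)
    also have "\<dots> \<le> X * (3/16) * exp (\<delta> * L) / L"
      using elim X1 by (intro divide_right_mono mult_right_mono mult_left_mono) auto
    also have "\<dots> = 3/16 * exp ((1/2 + 2 * \<delta>) * L) / L"
      unfolding X_def by (simp add: algebra_simps flip: exp_add)
    also have "\<dots> \<le> 3/16 * exp ((1/2 + 3 * \<delta>) * L) / L"
      using elim assms by (intro divide_right_mono mult_left_mono) auto
    finally show ?case unfolding X_def .
  qed
qed

text \<open>For p > x the distance ln p - (1-\<delta>) ln x is at least \<delta> ln p, so the weight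
  is at most exp(-\<delta>^2 (ln p)^2 / 2), and \<delta>^2 ln p >= 4 makes this at most
  p^(-2).\<close>

lemma gauss_tail:
  assumes "0 < \<delta>" "\<delta> < 1" "ln x \<ge> 4 / \<delta>\<^sup>2" "x > 1"
  shows "(\<Sum>p. if p \<le> nat \<lfloor>x\<rfloor> then 0 else on_primes (gauss_weight ((1 - \<delta>) * ln x)) p) \<le> (\<Sum>n. real n powr (-2))"
proof (rule suminf_le)
  show s: "summable (\<lambda>n. real n powr (-2))" by (simp add: summable_real_powr_iff)
  show le: "(if p \<le> nat \<lfloor>x\<rfloor> then 0 else on_primes (gauss_weight ((1 - \<delta>) * ln x)) p) \<le> real p powr (-2)" for p
  proof (cases "p \<le> nat \<lfloor>x\<rfloor> \<or> \<not> prime p")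
    case False
    then have px: "real p > x" using assms by linarith
    have lp: "ln x \<le> ln (real p)" using px assms by simp
    have "\<delta> * ln (real p) = ln (real p) - (1 - \<delta>) * ln (real p)" by (simp add: algebra_simps)
    also have "\<dots> \<le> ln (real p) - (1 - \<delta>) * ln x" using lp assms by (intro diff_left_mono mult_left_mono) auto
    finally have d: "\<delta> * ln (real p) \<le> ln (real p) - (1 - \<delta>) * ln x" .
    have lp0: "ln (real p) \<ge> 4 / \<delta>\<^sup>2" using lp assms by linarith
    have lpp: "ln (real p) > 0" using px assms by simp
    have "4 * ln (real p) \<le> (\<delta>\<^sup>2 * ln (real p)) * ln (real p)"
      using lp0 lpp assms by (intro mult_right_mono) (auto simp: field_simps)
    also have "\<dots> = (\<delta> * ln (real p))\<^sup>2" by (simp add: power2_eq_square)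
    also have "\<dots> \<le> (ln (real p) - (1 - \<delta>) * ln x)\<^sup>2" using d lpp assms by (intro power_mono) auto
    also have "\<dots> = ((1 - \<delta>) * ln x - ln (real p))\<^sup>2" by (rule power2_commute)
    finally have "gauss_weight ((1 - \<delta>) * ln x) p \<le> exp (-2 * ln (real p))" unfolding gauss_weight_def by simp
    also have "\<dots> = real p powr (-2)" using px assms by (simp add: powr_def)
    finally show ?thesis using False by simp
  qed auto
  show "summable (\<lambda>p. if p \<le> nat \<lfloor>x\<rfloor> then 0 else on_primes (gauss_weight ((1 - \<delta>) * ln x)) p)"
    by (rule summable_comparison_test'[OF gauss_weight_summable[of "(1 - \<delta>) * ln x"]]) (simp add: gauss_weight_pos less_imp_le)
qed

lemma smooth_cut_bounded:
  "\<exists>C\<ge>1. \<forall>u. cmod (smooth_cut u) \<le> C \<and> cmod (smooth_cut u) \<le> C * exp (3 * u) \<and> cmod (smooth_cut u - 1) \<le> C * exp (- 3 * u)"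
proof -
  obtain C where C: "C \<ge> 1" "\<And>u. cmod (smooth_cut u) \<le> C * exp (3 * u)" "\<And>u. cmod (smooth_cut u - 1) \<le> C * exp (- 3 * u)"
    using smooth_cut_bounds by blast
  have "cmod (smooth_cut u) \<le> C + 1" for u
  proof (cases "u \<le> 0")
    case True
    then have "C * exp (3 * u) \<le> C * 1" using C(1) by (intro mult_left_mono) auto
    then show ?thesis using C(2)[of u] by linarith
  next
    case False
    then have "C * exp (- 3 * u) \<le> C * 1" using C(1) by (intro mult_left_mono) auto
    then have "cmod (smooth_cut u - 1) \<le> C" using C(3)[of u] by linarith
    then show ?thesis using norm_triangle_ineq2[of "smooth_cut u" 1] by simp
  qed
  moreover have "cmod (smooth_cut u) \<le> (C + 1) * exp (3 * u)" "cmod (smooth_cut u - 1) \<le> (C + 1) * exp (- 3 * u)" for u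
    using C(2)[of u] C(3)[of u] by (simp_all add: distrib_right) (smt (verit) exp_gt_zero)+
  ultimately show ?thesis using C(1) by (intro exI[of _ "C + 1"]) auto
qed

lemma split_suminf:
  fixes f :: "nat \<Rightarrow> complex"
  assumes "summable f" "finite F" "summable h" "\<And>n. n \<notin> F \<Longrightarrow> cmod (f n) \<le> h n" "\<And>n. h n \<ge> 0"
  shows "cmod ((\<Sum>n. f n) - (\<Sum>n\<in>F. f n)) \<le> (\<Sum>n. h n)"
proof -
  have F: "(\<lambda>n. if n \<in> F then f n else 0) sums (\<Sum>n\<in>F. f n)" by (rule sums_If_finite_set[OF assms(2)])
  have "(\<lambda>n. f n - (if n \<in> F then f n else 0)) sums ((\<Sum>n. f n) - (\<Sum>n\<in>F. f n))"
    by (intro sums_diff summable_sums assms(1) F)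
  then have "(\<Sum>n. f n) - (\<Sum>n\<in>F. f n) = (\<Sum>n. f n - (if n \<in> F then f n else 0))" by (rule sums_unique)
  also have "cmod \<dots> \<le> (\<Sum>n. h n)"
    by (rule norm_suminf_le[OF _ assms(3)]) (use assms(4,5) in auto)
  finally show ?thesis .
qed

lemma legendre_char_eq_recip:
  assumes "prime q" "q > 2" "prime p" "p > 2"
  shows "legendre_char p q = of_real (real_of_int (recip_char q p))"
  unfolding legendre_char_def recip_char_eq_Legendre[OF assms] by simp

section \<open>Comparing log L with its sum over the sign set\<close>

definition odd_primes_upto :: "nat \<Rightarrow> nat set" where
  "odd_primes_upto W = {q. prime q \<and> q > 2 \<and> q \<le> W}"

lemma finite_odd_primes_upto: "finite (odd_primes_upto W)"
  unfolding odd_primes_upto_def by (rule finite_subset[of _ "{..W}"]) auto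

lemma card_odd_primes_upto: "card (odd_primes_upto W) \<le> W"
proof -
  have "card (odd_primes_upto W) \<le> card {1..W}"
    by (rule card_mono) (auto simp: odd_primes_upto_def)
  then show ?thesis by simp
qed

text \<open>Here the cutoff is \<open>exp v\<close>, and the sum over all odd primes up to its square \<open>W\<close> is split into
  the primes of \<open>S\<close>, on which \<open>\<chi>\<^sub>p\<close> is prescribed, and the others, on which it averages out.\<close>

lemma log_L_on_sign_set:
  assumes "GRH" "1/2 < Re s" "Re s < 1"
  shows "\<exists>K>0. \<exists>a>0. \<forall>p v W S. prime p \<and> p > 2 \<and> v \<ge> 0 \<and> exp (2 * v) \<le> real W + 1 \<and> S \<subseteq> odd_primes_upto W \<longrightarrow>
    \<bar>ln (cmod (Lfun (legendre_char p) s)) - Re (\<Sum>q\<in>S. of_real (real_of_int (recip_char q p)) * of_nat q powr (-s))\<bar>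
    \<le> K * (1 + ln (real p) * exp (- a * v) + (\<Sum>q\<in>S. real q ^ 3 * exp (-3 * v)))
      + cmod (\<Sum>q\<in>odd_primes_upto W - S. of_nat q powr (-s) * smooth_cut (v - ln (real q)) * of_real (real_of_int (recip_char q p)))"
proof -
  from log_L_approx[OF assms(1,2)] obtain K a where K: "K > 0" "a > 0" and KB: "\<forall>q chi v. dirichlet_char q chi \<and> \<not> principal_char q chi \<longrightarrow>
    summable (\<lambda>p. on_primes (dterm chi s) p * smooth_cut (v - ln (real p))) \<and>
    \<bar>ln (cmod (Lfun chi s)) - Re (\<Sum>p. on_primes (dterm chi s) p * smooth_cut (v - ln (real p)))\<bar>
      \<le> K * (1 + ln (real q) * exp (- a * v))"
    by (elim exE conjE) (rule that)
  note Kb = KB[rule_format, OF conjI]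
  obtain C where C: "C \<ge> 1" "\<And>u. cmod (smooth_cut u) \<le> C" "\<And>u. cmod (smooth_cut u) \<le> C * exp (3 * u)" "\<And>u. cmod (smooth_cut u - 1) \<le> C * exp (- 3 * u)"
    using smooth_cut_bounded by blast
  define Z2 where "Z2 = (\<Sum>n. real n powr (-2))"
  have Z2: "Z2 \<ge> 0" unfolding Z2_def by (intro suminf_nonneg) (auto simp: summable_real_powr_iff)
  define K' where "K' = K + C + C * Z2"
  have CZ: "C * Z2 \<ge> 0" using C(1) Z2 by simp
  have "K' > 0" unfolding K'_def using K C(1) CZ by linarith
  moreover have "\<bar>ln (cmod (Lfun (legendre_char p) s)) - Re (\<Sum>q\<in>S. of_real (real_of_int (recip_char q p)) * of_nat q powr (-s))\<bar>
    \<le> K' * (1 + ln (real p) * exp (- a * v) + (\<Sum>q\<in>S. real q ^ 3 * exp (-3 * v)))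
      + cmod (\<Sum>q\<in>odd_primes_upto W - S. of_nat q powr (-s) * smooth_cut (v - ln (real q)) * of_real (real_of_int (recip_char q p)))"
    if p: "prime p" "p > 2" and v: "v \<ge> 0" and W: "exp (2 * v) \<le> real W + 1" and S: "S \<subseteq> odd_primes_upto W" for p v W S
  proof -
    let ?chi = "legendre_char p"
    let ?f = "\<lambda>n. on_primes (dterm ?chi s) n * smooth_cut (v - ln (real n))"
    note ch = legendre_char_dirichlet[OF p]
    note cm = dirichlet_char_comp_mult[OF ch(1)]
    define R where "R = odd_primes_upto W - S"
    \<comment> \<open>Reciprocity is available only for odd q; the prime 2 is kept apart and costs
      O(1).\<close>
    define F where "F = insert 2 (odd_primes_upto W)"
    have finS: "finite S" using S finite_odd_primes_upto finite_subset by blast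
    have finR: "finite R" unfolding R_def using finite_odd_primes_upto by blast
    have finF: "finite F" unfolding F_def using finite_odd_primes_upto by blast
    have d1: "cmod (dterm ?chi s q) \<le> 1" if "prime q" for q
    proof -
      have "real q powr (-Re s) \<le> real q powr 0" using prime_ge_2_nat[OF that] assms by (intro powr_mono) auto
      then show ?thesis using dterm_norm[OF cm, of s q] prime_gt_0_nat[OF that] by simp
    qed
    \<comment> \<open>Beyond the square of the cutoff, the factor (e^v / n)^3 is at most n^(-3/2);
      together with n^(-Re s) <= n^(-1/2) this gives n^(-2).\<close>
    have tailF: "cmod (?f n) \<le> C * real n powr (-2)" if n: "n \<notin> F" for n
    proof (cases "prime n")
      case True
      have "n > 2" using True n prime_ge_2_nat[OF True] by (cases "n = 2") (auto simp: F_def)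
      then have "n > W" using n True by (auto simp: F_def odd_primes_upto_def)
      then have "exp (2 * v) \<le> real n" using W by linarith
      then have "exp (2 * v) * exp (2 * v) \<le> real n * real n" by (intro mult_mono) auto
      then have e4: "exp (4 * v) \<le> real n ^ 2" by (simp add: power2_eq_square flip: exp_add)
      have n0: "real n > 0" using \<open>n > 2\<close> by simp
      have "cmod (?f n) = cmod (dterm ?chi s n) * cmod (smooth_cut (v - ln (real n)))" using True by (simp add: norm_mult)
      also have "\<dots> \<le> real n powr (-1/2) * (C * exp (3 * (v - ln (real n))))"
      proof (intro mult_mono C(3))
        have "cmod (dterm ?chi s n) \<le> real n powr (-Re s)" by (rule dterm_norm[OF cm])
        also have "\<dots> \<le> real n powr (-1/2)" using \<open>n > 2\<close> assms by (intro powr_mono) auto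
        finally show "cmod (dterm ?chi s n) \<le> real n powr (-1/2)" .
      qed auto
      also have "exp (3 * (v - ln (real n))) \<le> real n powr (3/2) * real n powr (-3)"
      proof -
        have "2 * v \<le> ln (real n)" using \<open>exp (2 * v) \<le> real n\<close> n0 by (simp add: ln_ge_iff)
        then have "3 * (v - ln (real n)) \<le> (3/2) * ln (real n) + (-3) * ln (real n)" by simp
        then have "exp (3 * (v - ln (real n))) \<le> exp ((3/2) * ln (real n) + (-3) * ln (real n))" by simp
        also have "\<dots> = real n powr (3/2) * real n powr (-3)" unfolding exp_add using n0 by (simp add: powr_def)
        finally show ?thesis .
      qed
      then have "real n powr (-1/2) * (C * exp (3 * (v - ln (real n)))) \<le> real n powr (-1/2) * (C * (real n powr (3/2) * real n powr (-3)))"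
        using C(1) by (intro mult_left_mono) auto
      also have "\<dots> = C * (real n powr (-1/2) * (real n powr (3/2) * real n powr (-3)))" by (simp only: mult_ac)
      also have "real n powr (-1/2) * (real n powr (3/2) * real n powr (-3)) = real n powr (-2)"
        unfolding powr_add[symmetric] by simp
      finally show ?thesis .
    qed (use C(1) in auto)
    have "cmod ((\<Sum>n. ?f n) - (\<Sum>n\<in>F. ?f n)) \<le> (\<Sum>n. C * real n powr (-2))"
      by (rule split_suminf[OF _ finF _ tailF]) (use Kb[OF ch, of v] C(1) in \<open>auto intro!: summable_mult simp: summable_real_powr_iff\<close>)
    also have "\<dots> = C * Z2" unfolding Z2_def by (rule suminf_mult) (simp add: summable_real_powr_iff)
    finally have t1: "cmod ((\<Sum>n. ?f n) - (\<Sum>n\<in>F. ?f n)) \<le> C * Z2" .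
    have "(\<Sum>n\<in>F. ?f n) = ?f 2 + (\<Sum>n\<in>odd_primes_upto W. ?f n)"
      unfolding F_def by (rule sum.insert) (auto simp: finite_odd_primes_upto odd_primes_upto_def)
    also have "(\<Sum>n\<in>odd_primes_upto W. ?f n) = (\<Sum>n\<in>R. ?f n) + (\<Sum>n\<in>S. ?f n)"
      unfolding R_def by (rule sum.subset_diff[OF S finite_odd_primes_upto])
    finally have t2: "(\<Sum>n\<in>F. ?f n) = ?f 2 + ((\<Sum>n\<in>R. ?f n) + (\<Sum>n\<in>S. ?f n))" .
    have f2: "cmod (?f 2) \<le> C"
      using mult_mono[OF d1[of 2] C(2)] two_is_prime_nat by (simp add: norm_mult)
    have fq: "?f q = of_real (real_of_int (recip_char q p)) * of_nat q powr (-s) * smooth_cut (v - ln (real q))" if "q \<in> odd_primes_upto W" for q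
      using that p legendre_char_eq_recip[of q p] by (simp add: odd_primes_upto_def dterm_def)
    have fR: "(\<Sum>n\<in>R. ?f n) = (\<Sum>q\<in>R. of_nat q powr (-s) * smooth_cut (v - ln (real q)) * of_real (real_of_int (recip_char q p)))"
      by (intro sum.cong refl) (subst fq, auto simp: R_def mult_ac)
    \<comment> \<open>On \<open>S\<close> the smooth cutoff is replaced by 1; the error (q / e^v)^3
      is tiny because S lies far below e^v in the application.\<close>
    have fS: "cmod ((\<Sum>n\<in>S. ?f n) - (\<Sum>q\<in>S. of_real (real_of_int (recip_char q p)) * of_nat q powr (-s))) \<le> (\<Sum>q\<in>S. C * (real q ^ 3 * exp (- 3 * v)))"
      unfolding sum_subtractf[symmetric]
    proof (rule sum_norm_le)
      fix q assume q: "q \<in> S"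
      then have q': "q \<in> odd_primes_upto W" "prime q" "q > 2" using S by (auto simp: odd_primes_upto_def)
      have "?f q - of_real (real_of_int (recip_char q p)) * of_nat q powr (-s) = dterm ?chi s q * (smooth_cut (v - ln (real q)) - 1)"
        unfolding fq[OF q'(1)] using legendre_char_eq_recip[OF q'(2,3) p] by (simp add: dterm_def right_diff_distrib)
      then have "cmod (?f q - of_real (real_of_int (recip_char q p)) * of_nat q powr (-s)) = cmod (dterm ?chi s q) * cmod (smooth_cut (v - ln (real q)) - 1)"
        by (simp only: norm_mult)
      also have "\<dots> \<le> 1 * (C * exp (- 3 * (v - ln (real q))))" by (intro mult_mono d1 q' C(4)) auto
      also have "exp (- 3 * (v - ln (real q))) = real q ^ 3 * exp (- 3 * v)"
      proof -
        have "exp (- 3 * (v - ln (real q))) = exp (real 3 * ln (real q) + (- 3 * v))" by (simp add: algebra_simps)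
        also have "\<dots> = exp (ln (real q)) ^ 3 * exp (- 3 * v)" unfolding exp_add exp_of_nat_mult ..
        finally show ?thesis using q' by simp
      qed
      finally show "cmod (?f q - of_real (real_of_int (recip_char q p)) * of_nat q powr (-s)) \<le> C * (real q ^ 3 * exp (- 3 * v))" by simp
    qed
    define M where "M = (\<Sum>q\<in>S. of_real (real_of_int (recip_char q p)) * of_nat q powr (-s))"
    define T where "T = (\<Sum>q\<in>R. of_nat q powr (-s) * smooth_cut (v - ln (real q)) * of_real (real_of_int (recip_char q p)))"
    define Q where "Q = (\<Sum>q\<in>S. real q ^ 3 * exp (- 3 * v))"
    have Q0: "Q \<ge> 0" unfolding Q_def by (intro sum_nonneg) auto
    have CQ: "(\<Sum>q\<in>S. C * (real q ^ 3 * exp (- 3 * v))) = C * Q" unfolding Q_def by (rule sum_distrib_left[symmetric])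
    define A0 where "A0 = (\<Sum>n. ?f n) - (\<Sum>n\<in>F. ?f n)"
    define A1 where "A1 = (\<Sum>n\<in>S. ?f n) - M"
    have dec: "(\<Sum>n. ?f n) = M + (A0 + (?f 2 + (T + A1)))"
      unfolding A0_def A1_def t2 T_def fR[symmetric] by simp
    have "\<bar>Re A0\<bar> \<le> C * Z2" using abs_Re_le_cmod[of A0] t1 unfolding A0_def by linarith
    moreover have "\<bar>Re (?f 2)\<bar> \<le> C" using abs_Re_le_cmod[of "?f 2"] f2 by linarith
    moreover have "\<bar>Re A1\<bar> \<le> C * Q" using abs_Re_le_cmod[of A1] fS unfolding A1_def M_def CQ by linarith
    moreover have "\<bar>Re T\<bar> \<le> cmod T" by (rule abs_Re_le_cmod)
    moreover have "Re (\<Sum>n. ?f n) = Re M + (Re A0 + (Re (?f 2) + (Re T + Re A1)))" unfolding dec by (simp only: plus_complex.sel)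
    moreover have "\<bar>ln (cmod (Lfun ?chi s)) - Re (\<Sum>n. ?f n)\<bar> \<le> K * (1 + ln (real p) * exp (- a * v))"
      using Kb[OF ch, of v] by blast
    ultimately have "\<bar>ln (cmod (Lfun ?chi s)) - Re M\<bar> \<le> K * (1 + ln (real p) * exp (- a * v)) + (C * Z2 + C + C * Q + cmod T)"
      by linarith
    also have "\<dots> \<le> K' * (1 + ln (real p) * exp (- a * v) + Q) + cmod T"
    proof -
      define Y where "Y = ln (real p) * exp (- a * v)"
      have Y: "Y \<ge> 0" unfolding Y_def using p by simp
      have "K' * (1 + Y + Q) = K * (1 + Y) + K * Q + (C + C * Z2) + (C + C * Z2) * Y + C * Q + C * Z2 * Q"
        unfolding K'_def by (simp add: algebra_simps)
      moreover have "K * Q \<ge> 0" "(C + C * Z2) * Y \<ge> 0" "C * Z2 * Q \<ge> 0" using K Q0 CZ C(1) Y Z2 by auto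
      ultimately have "K * (1 + Y) + (C * Z2 + C + C * Q + cmod T) \<le> K' * (1 + Y + Q) + cmod T" by linarith
      then show ?thesis unfolding Y_def .
    qed
    finally show ?thesis unfolding M_def T_def Q_def R_def .
  qed
  ultimately show ?thesis using K(2) by blast
qed

lemma ln_prod_odd_primes_upto:
  assumes "D \<subseteq> odd_primes_upto W"
  shows "ln (\<Prod>q\<in>D. 4 * real q) \<le> 4 * real W ^ 2"
proof -
  have fin: "finite D" using assms finite_odd_primes_upto finite_subset by blast
  have D: "q \<in> D \<Longrightarrow> q > 2 \<and> q \<le> W" for q using assms by (auto simp: odd_primes_upto_def)
  have "ln (\<Prod>q\<in>D. 4 * real q) = (\<Sum>q\<in>D. ln (4 * real q))"
    using fin D by (intro ln_prod) fastforce+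
  also have "\<dots> \<le> (\<Sum>q\<in>D. 4 * real W)"
  proof (rule sum_mono)
    fix q assume "q \<in> D"
    then have q: "q > 2" "q \<le> W" using D by auto
    have "ln (4 * real q) \<le> 4 * real q" using q ln_bound[of "4 * real q"] by simp
    also have "\<dots> \<le> 4 * real W" using q by simp
    finally show "ln (4 * real q) \<le> 4 * real W" .
  qed
  also have "\<dots> = real (card D) * (4 * real W)" by simp
  also have "\<dots> \<le> real W * (4 * real W)"
  proof (rule mult_right_mono)
    have "card D \<le> W"
      using card_mono[OF finite_odd_primes_upto assms] card_odd_primes_upto[of W] by linarith
    then show "real (card D) \<le> real W" by simp
  qed simp
  finally show ?thesis by (simp add: power2_eq_square)
qed

definition prescribed :: "complex \<Rightarrow> real \<Rightarrow> nat set \<Rightarrow> (nat \<Rightarrow> real) \<Rightarrow> real \<Rightarrow> nat set" where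
  "prescribed s C S \<epsilon> x = {p. prime p \<and> odd p \<and> real p \<le> x \<and>
     \<bar>ln (cmod (Lfun (legendre_char p) s)) - Re (\<Sum>q\<in>S. of_real (\<epsilon> q) * of_nat q powr (-s))\<bar> \<le> C}"

lemma finite_prescribed: "finite (prescribed s C S \<epsilon> x)"
proof (rule finite_subset)
  show "prescribed s C S \<epsilon> x \<subseteq> {..nat \<lfloor>x\<rfloor>}" unfolding prescribed_def by (auto simp: le_nat_floor)
qed simp

text \<open>Parameters: the Gaussian is centred at (1-\<delta>) log x so that its tail beyond x is
  bounded, and the cutoff is the power (log x)^k. Main term x^(1/2+3\<delta>) / log x against error
  x^(1/2+\<delta>) times a power of log x.\<close>

lemma many_prescribed:
  assumes "GRH" "1/2 < Re s" "Re s < 1" and d: "0 < \<delta>" "\<delta> < 1/2"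
  shows "\<exists>C. \<forall>\<^sub>F x in at_top. \<forall>S \<epsilon>. finite S \<and> (\<forall>q\<in>S. prime q \<and> q > 2 \<and> real q \<le> (ln x)\<^sup>2) \<and>
      real (card S) * ln 2 \<le> (1/2 - 4 * \<delta>) * ln x \<and> (\<forall>q\<in>S. \<bar>\<epsilon> q\<bar> = 1) \<longrightarrow>
      sqrt x \<le> real (card (prescribed s C S \<epsilon> x))"
proof -
  from log_L_on_sign_set[OF assms(1-3)] obtain K1 a where K1: "K1 > 0" "a > 0" and KA:
    "\<forall>p v W S. prime p \<and> p > 2 \<and> v \<ge> 0 \<and> exp (2 * v) \<le> real W + 1 \<and> S \<subseteq> odd_primes_upto W \<longrightarrow>
    \<bar>ln (cmod (Lfun (legendre_char p) s)) - Re (\<Sum>q\<in>S. of_real (real_of_int (recip_char q p)) * of_nat q powr (-s))\<bar>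
    \<le> K1 * (1 + ln (real p) * exp (- a * v) + (\<Sum>q\<in>S. real q ^ 3 * exp (-3 * v)))
      + cmod (\<Sum>q\<in>odd_primes_upto W - S. of_nat q powr (-s) * smooth_cut (v - ln (real q)) * of_real (real_of_int (recip_char q p)))"
    by (elim exE conjE) (rule that)
  from recip_prod_gauss_sum[OF assms(1) d(1)] obtain K2 where K2: "K2 > 0" and KB:
    "\<forall>D \<mu>. finite D \<and> D \<noteq> {} \<and> (\<forall>q\<in>D. prime q \<and> q > 2) \<longrightarrow>
    \<bar>\<Sum>p. on_primes (gauss_weight \<mu>) p * real_of_int (\<Prod>q\<in>D. recip_char q p)\<bar> \<le> K2 * ln (\<Prod>q\<in>D. 4 * real q) * exp ((1/2 + \<delta>) * \<mu>)"
    by (elim exE conjE) (rule that)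
  obtain C1 where C1: "C1 \<ge> 1" "\<And>u. cmod (smooth_cut u) \<le> C1" using smooth_cut_bounded by blast
  define Z where "Z = (\<Sum>n. real n powr (-2 * Re s))"
  have Zs: "summable (\<lambda>n. real n powr (-2 * Re s))" using assms by (simp add: summable_real_powr_iff)
  have Z: "Z \<ge> 0" unfolding Z_def by (intro suminf_nonneg Zs) auto
  \<comment> \<open>The sum of q^(-2 Re s) converges as Re s > 1/2, so the averaged part is bounded
    in mean square uniformly in x.\<close>
  define A where "A = C1 ^ 2 * Z + 1"
  have A: "A > 0" unfolding A_def using Z by (simp add: add_nonneg_pos)
  define \<tau> where "\<tau> = (\<Sum>n. real n powr (-2))"
  \<comment> \<open>From k >= 1/a the error ln p e^(-av) is at most 1; from k >= 4 the cutoff lies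
    far enough above (log x)^2 for the cubes over S to sum to at most 1.\<close>
  define k where "k = max 4 (nat \<lceil>1 / a\<rceil>)"
  have k: "k \<ge> 4" "a * real k \<ge> 1"
  proof -
    have "1 / a \<le> real k" unfolding k_def using real_nat_ceiling_ge[of "1 / a"] by linarith
    then show "a * real k \<ge> 1" using K1(2) by (simp add: field_simps)
  qed (simp add: k_def)
  define C3 where "C3 = K2 * 4 * (1 + C1 ^ 2 / (4 * A))"
  define C where "C = 3 * K1 + sqrt (4 * A)"
  have ln_top: "filterlim (\<lambda>x::real. ln x) at_top at_top" by (rule ln_at_top)
  have mu_top: "filterlim (\<lambda>x::real. (1 - \<delta>) * ln x) at_top at_top"
    using d by (intro filterlim_tendsto_pos_mult_at_top[OF tendsto_const _ ln_top]) auto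
  have ev1: "\<forall>\<^sub>F x in at_top. (\<Sum>p. on_primes (gauss_weight ((1 - \<delta>) * ln x)) p) \<ge> exp ((1 - \<delta>) * ln x) / (4 * ((1 - \<delta>) * ln x))"
    using filterlim_iff[THEN iffD1, OF mu_top, rule_format, OF gauss_mass_lower[OF assms(1)]] .
  have ev2: "\<forall>\<^sub>F x in at_top. exp (ln x / 2) + ln x + 2 + \<tau> + C3 * ln x ^ (8 * k) * exp ((1/2 + \<delta>) * ln x) \<le> 3/16 * exp ((1/2 + 3 * \<delta>) * ln x) / ln x"
    using filterlim_iff[THEN iffD1, OF ln_top, rule_format, OF exp_dominates[OF d(1), of \<tau> C3 "8 * k"]] .
  have ev3: "\<forall>\<^sub>F x in at_top. ln x \<ge> 4 / \<delta>\<^sup>2" "\<forall>\<^sub>F x in at_top. ln x > (2::real)"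
    using filterlim_iff[THEN iffD1, OF ln_top, rule_format, OF eventually_ge_at_top[of "4 / \<delta>\<^sup>2"]]
      filterlim_iff[THEN iffD1, OF ln_top, rule_format, OF eventually_gt_at_top[of 2]] .
  have "\<forall>\<^sub>F x in at_top. \<forall>S \<epsilon>. finite S \<and> (\<forall>q\<in>S. prime q \<and> q > 2 \<and> real q \<le> (ln x)\<^sup>2) \<and>
      real (card S) * ln 2 \<le> (1/2 - 4 * \<delta>) * ln x \<and> (\<forall>q\<in>S. \<bar>\<epsilon> q\<bar> = 1) \<longrightarrow>
      sqrt x \<le> real (card (prescribed s C S \<epsilon> x))"
    using ev1 ev2 ev3 eventually_gt_at_top[of 1]
  proof eventually_elim
    case (elim x)
    define L where "L = ln x"
    define \<mu> where "\<mu> = (1 - \<delta>) * L"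
    define v where "v = real k * ln L"
    define W where "W = nat \<lfloor>exp (2 * v)\<rfloor>"
    note el = elim[folded L_def]
    have L: "L > 2" using el by simp
    have lL: "ln L > 0" using L by simp
    have mu: "\<mu> > 0" "\<mu> \<le> L" unfolding \<mu>_def using d L by (auto simp: mult_left_le_one_le)
    have v0: "v \<ge> 0" unfolding v_def using lL by simp
    have e2v: "exp (2 * v) = L ^ (2 * k)"
    proof -
      have "exp (2 * v) = exp (ln L) ^ (2 * k)" unfolding v_def exp_of_nat_mult[symmetric] by (simp add: mult_ac)
      then show ?thesis using L by simp
    qed
    have W1: "exp (2 * v) \<le> real W + 1" unfolding W_def by linarith
    have W2: "real W \<le> L ^ (2 * k)" unfolding W_def e2v[symmetric] by simp
    have W3: "real W \<ge> 1"
    proof -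
      have "1 \<le> exp (2 * v)" using v0 by simp
      then have "1 \<le> \<lfloor>exp (2 * v)\<rfloor>" by linarith
      then show ?thesis unfolding W_def by linarith
    qed
    show ?case
    proof (intro allI impI)
      fix S :: "nat set" and \<epsilon> :: "nat \<Rightarrow> real"
      assume as: "finite S \<and> (\<forall>q\<in>S. prime q \<and> q > 2 \<and> real q \<le> (ln x)\<^sup>2) \<and>
        real (card S) * ln 2 \<le> (1/2 - 4 * \<delta>) * ln x \<and> (\<forall>q\<in>S. \<bar>\<epsilon> q\<bar> = 1)"
      have finS: "finite S" and Sq: "\<And>q. q \<in> S \<Longrightarrow> prime q \<and> q > 2 \<and> real q \<le> L\<^sup>2"
        and Sc: "real (card S) * ln 2 \<le> (1/2 - 4 * \<delta>) * L" and Se: "\<And>q. q \<in> S \<Longrightarrow> \<bar>\<epsilon> q\<bar> = 1"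
        using as unfolding L_def by blast+
      have SW: "S \<subseteq> odd_primes_upto W"
      proof
        fix q assume q: "q \<in> S"
        have "real q \<le> L\<^sup>2" using Sq[OF q] by blast
        also have "\<dots> \<le> L ^ (2 * k)" using L k by (intro power_increasing) auto
        finally have "q \<le> W" unfolding W_def e2v by (simp add: le_nat_floor)
        then show "q \<in> odd_primes_upto W" using Sq[OF q] by (simp add: odd_primes_upto_def)
      qed
      define R where "R = odd_primes_upto W - S"
      define c where "c q = of_nat q powr (-s) * smooth_cut (v - ln (real q))" for q
      define E where "E = K2 * (4 * real W ^ 2) * exp ((1/2 + \<delta>) * \<mu>)"
      have E0: "E \<ge> 0" unfolding E_def using K2 by simp
      interpret sign_detector "on_primes (gauss_weight \<mu>)" "\<lambda>q p. real_of_int (recip_char q p)" S R \<epsilon> c E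
      proof
        show "summable (on_primes (gauss_weight \<mu>))"
          by (rule summable_comparison_test'[OF gauss_weight_summable[of \<mu>]]) (simp add: gauss_weight_pos less_imp_le)
        show "\<bar>real_of_int (recip_char q p)\<bar> \<le> 1" for q p using recip_char_values[of q p] by linarith
        show "finite R" unfolding R_def using finite_odd_primes_upto by blast
        fix D assume D: "D \<subseteq> S \<union> R" "D \<noteq> {}"
        then have DW: "D \<subseteq> odd_primes_upto W" using SW unfolding R_def by blast
        have "\<bar>\<Sum>p. on_primes (gauss_weight \<mu>) p * real_of_int (\<Prod>q\<in>D. recip_char q p)\<bar> \<le> K2 * ln (\<Prod>q\<in>D. 4 * real q) * exp ((1/2 + \<delta>) * \<mu>)"
          using DW D(2) finite_subset[OF DW finite_odd_primes_upto] by (intro KB[rule_format]) (auto simp: odd_primes_upto_def)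
        also have "\<dots> \<le> E" unfolding E_def using K2 ln_prod_odd_primes_upto[OF DW] by (intro mult_right_mono mult_left_mono) auto
        finally show "\<bar>\<Sum>p. on_primes (gauss_weight \<mu>) p * (\<Prod>q\<in>D. real_of_int (recip_char q p))\<bar> \<le> E"
          by (simp only: of_int_prod)
      qed (use finS Se E0 gauss_weight_pos[of \<mu>] in \<open>auto simp: R_def less_imp_le\<close>)
      have cb: "cmod (c q) \<le> C1 * real q powr (-Re s)" for q
        unfolding c_def norm_mult cmod_nat_powr using mult_left_mono[OF C1(2), of "real q powr (-Re s)" "v - ln (real q)"] by (simp add: mult.commute)
      have cA: "(\<Sum>q\<in>R. cmod (c q) ^ 2) \<le> A"
      proof -
        have "(\<Sum>q\<in>R. cmod (c q) ^ 2) \<le> (\<Sum>q\<in>R. C1 ^ 2 * real q powr (-2 * Re s))"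
        proof (rule sum_mono)
          fix q
          have "cmod (c q) ^ 2 \<le> (C1 * real q powr (-Re s)) ^ 2" using cb by (intro power_mono) auto
          also have "\<dots> = C1 ^ 2 * real q powr (-2 * Re s)" by (simp add: power_mult_distrib power2_eq_square flip: powr_add)
          finally show "cmod (c q) ^ 2 \<le> C1 ^ 2 * real q powr (-2 * Re s)" .
        qed
        also have "\<dots> = C1 ^ 2 * (\<Sum>q\<in>R. real q powr (-2 * Re s))" by (rule sum_distrib_left[symmetric])
        also have "\<dots> \<le> C1 ^ 2 * Z" unfolding Z_def by (intro mult_left_mono sum_le_suminf Zs finite_R) auto
        finally show ?thesis unfolding A_def by simp
      qed
      have cB: "(\<Sum>q\<in>R. cmod (c q)) \<le> C1 * real W"
      proof -
        have "(\<Sum>q\<in>R. cmod (c q)) \<le> (\<Sum>q\<in>R. C1)"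
        proof (rule sum_mono)
          fix q assume "q \<in> R"
          then have "q > 2" by (simp add: R_def odd_primes_upto_def)
          then have "real q powr (-Re s) \<le> real q powr 0" using assms by (intro powr_mono) auto
          then have "real q powr (-Re s) \<le> 1" using \<open>q > 2\<close> by simp
          then have "C1 * real q powr (-Re s) \<le> C1 * 1" using C1(1) by (intro mult_left_mono) auto
          then show "cmod (c q) \<le> C1" using cb[of q] by linarith
        qed
        also have "\<dots> = C1 * real (card R)" by simp
        also have "card R \<le> W"
          using card_mono[OF finite_odd_primes_upto, of R W] card_odd_primes_upto[of W] unfolding R_def by force
        then have "C1 * real (card R) \<le> C1 * real W" using C1(1) by (intro mult_left_mono) auto
        finally show ?thesis .
      qed
      define X where "X = {..nat \<lfloor>x\<rfloor>}"
      define G where "G = {p \<in> X. on_primes (gauss_weight \<mu>) p \<noteq> 0 \<and> weight p \<noteq> 0 \<and> cmod (tail p) ^ 2 \<le> 4 * A}"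
      have tau: "(\<Sum>p. if p \<in> X then 0 else on_primes (gauss_weight \<mu>) p) \<le> \<tau>"
        using gauss_tail[OF d(1) _ elim(3)] elim d unfolding X_def \<mu>_def L_def \<tau>_def by simp
      have G1: "3/4 * (\<Sum>p. on_primes (gauss_weight \<mu>) p) / 2 ^ card S - E - E * (\<Sum>q\<in>R. cmod (c q)) ^ 2 / (4 * A) - \<tau> \<le> real (card G)"
        unfolding G_def by (rule many_good_points[OF cA A _ _ tau]) (auto simp: X_def gauss_weight_le_1)
      \<comment> \<open>The exponents combine as (1 - \<delta>) - (1/2 - 4\<delta>) = 1/2 +
        3\<delta>.\<close>
      have m: "3/4 * (\<Sum>p. on_primes (gauss_weight \<mu>) p) / 2 ^ card S \<ge> 3/16 * exp ((1/2 + 3 * \<delta>) * L) / L"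
      proof -
        have "exp \<mu> / (4 * L) \<le> exp \<mu> / (4 * \<mu>)" using mu by (intro divide_left_mono) auto
        also have "\<dots> \<le> (\<Sum>p. on_primes (gauss_weight \<mu>) p)" using el(1) unfolding \<mu>_def .
        finally have m1: "exp \<mu> / (4 * L) \<le> (\<Sum>p. on_primes (gauss_weight \<mu>) p)" .
        have "(2::real) ^ card S = exp (real (card S) * ln 2)" by (simp add: exp_of_nat_mult)
        then have N: "(2::real) ^ card S \<le> exp ((1/2 - 4 * \<delta>) * L)" using Sc by simp
        have "3/16 * exp ((1/2 + 3 * \<delta>) * L) / L = 3/4 * (exp \<mu> / (4 * L)) / exp ((1/2 - 4 * \<delta>) * L)"
        proof -
          have "(1/2 + 3 * \<delta>) * L = \<mu> - (1/2 - 4 * \<delta>) * L" unfolding \<mu>_def by (simp add: left_diff_distrib distrib_right)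
          then have "exp ((1/2 + 3 * \<delta>) * L) = exp \<mu> / exp ((1/2 - 4 * \<delta>) * L)" by (simp add: exp_diff)
          then show ?thesis by simp
        qed
        also have "\<dots> \<le> 3/4 * (\<Sum>p. on_primes (gauss_weight \<mu>) p) / 2 ^ card S"
          using m1 N L by (intro frac_le mult_left_mono) (auto intro: order_trans[OF _ m1])
        finally show ?thesis .
      qed
      have Eb: "E + E * (\<Sum>q\<in>R. cmod (c q)) ^ 2 / (4 * A) \<le> C3 * L ^ (8 * k) * exp ((1/2 + \<delta>) * L)"
      proof -
        have W4: "real W ^ 4 \<le> L ^ (8 * k)"
        proof -
          have "real W ^ 4 \<le> (L ^ (2 * k)) ^ 4" using W2 by (intro power_mono) auto
          then show ?thesis by (simp flip: power_mult)
        qed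
        have "(\<Sum>q\<in>R. cmod (c q)) ^ 2 \<le> (C1 * real W) ^ 2" using cB by (intro power_mono sum_nonneg) auto
        then have "E * (\<Sum>q\<in>R. cmod (c q)) ^ 2 / (4 * A) \<le> E * (C1 * real W) ^ 2 / (4 * A)"
          using E0 A by (intro divide_right_mono mult_left_mono) auto
        also have "\<dots> = E * real W ^ 2 * (C1 ^ 2 / (4 * A))" by (simp add: power_mult_distrib)
        finally have 1: "E * (\<Sum>q\<in>R. cmod (c q)) ^ 2 / (4 * A) \<le> E * real W ^ 2 * (C1 ^ 2 / (4 * A))" .
        have "1 \<le> real W ^ 2" using W3 by (rule one_le_power)
        then have 2: "E \<le> E * real W ^ 2" using E0 mult_left_mono[of 1 "real W ^ 2" E] by simp
        have "E + E * (\<Sum>q\<in>R. cmod (c q)) ^ 2 / (4 * A) \<le> E * real W ^ 2 + E * real W ^ 2 * (C1 ^ 2 / (4 * A))"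
          by (rule add_mono[OF 2 1])
        also have "\<dots> = (E * real W ^ 2) * (1 + C1 ^ 2 / (4 * A))" by (simp only: distrib_left mult_1_right)
        also have "\<dots> = C3 * real W ^ 4 * exp ((1/2 + \<delta>) * \<mu>)"
          unfolding E_def C3_def by (simp add: power2_eq_square power4_eq_xxxx mult_ac)
        also have "\<dots> \<le> C3 * L ^ (8 * k) * exp ((1/2 + \<delta>) * L)"
        proof (intro mult_mono mult_left_mono W4)
          show "exp ((1/2 + \<delta>) * \<mu>) \<le> exp ((1/2 + \<delta>) * L)" using mu d by simp
          show "0 \<le> C3" "0 \<le> C3 * L ^ (8 * k)" unfolding C3_def using K2 A L by auto
        qed auto
        finally show ?thesis .
      qed
      \<comment> \<open>The surplus L + 2 over sqrt x pays for discarding 2 and the elements of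
        \<open>S\<close> below.\<close>
      have cardG: "exp (L / 2) + L + 2 \<le> real (card G)"
        using G1 m Eb el(2) by linarith
      have cS: "real (card S) \<le> L"
      proof -
        have "real (card S) * (1/2) \<le> real (card S) * ln 2" using ln2_ge_two_thirds by (intro mult_left_mono) auto
        also have "\<dots> \<le> (1/2) * L" using Sc d L by (intro order_trans[OF Sc] mult_right_mono) auto
        finally show ?thesis by simp
      qed
      \<comment> \<open>For p in \<open>S\<close> the symbol at q = p vanishes and the weight does
        not force its sign; p = 2 is outside the reach of reciprocity.\<close>
      have sub: "G - insert 2 S \<subseteq> prescribed s C S \<epsilon> x"
      proof
        fix p assume p: "p \<in> G - insert 2 S"
        have pp: "prime p" using p unfolding G_def by (auto split: if_splits)
        have p2: "p > 2" using p prime_ge_2_nat[OF pp] by (cases "p = 2") auto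
        have px: "real p \<le> x" using p elim(5) unfolding G_def X_def by (auto simp: le_nat_iff) linarith
        have sg: "real_of_int (recip_char q p) = \<epsilon> q" if q: "q \<in> S" for q
        proof (rule weight_nonzero_sign[OF _ q])
          show "weight p \<noteq> 0" using p unfolding G_def by blast
          have "q \<noteq> p" using q p by auto
          then have "coprime q p" using Sq[OF q] pp primes_coprime by blast
          then have "Legendre (int q) (int p) \<noteq> 0" using Legendre_eq_0_iff[OF pp, of q] by simp
          then show "real_of_int (recip_char q p) = -1 \<or> real_of_int (recip_char q p) = 1"
            using recip_char_eq_Legendre[of q p] Sq[OF q] pp p2 Legendre_values[of "int q" "int p"] by auto
        qed
        have tl: "cmod (tail p) \<le> sqrt (4 * A)" using p unfolding G_def by (intro real_le_rsqrt) auto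
        have t_eq: "(\<Sum>q\<in>odd_primes_upto W - S. of_nat q powr (-s) * smooth_cut (v - ln (real q)) * of_real (real_of_int (recip_char q p))) = tail p"
          unfolding tail_def by (rule sum.cong) (simp_all add: R_def c_def)
        have b1: "ln (real p) * exp (- a * v) \<le> 1"
        proof -
          have "ln (real p) \<le> L" unfolding L_def using px p2 by simp
          moreover have "exp (- a * v) \<le> 1 / L"
          proof -
            have "1 * ln L \<le> (a * real k) * ln L" using k lL by (intro mult_right_mono) auto
            then have "exp (- a * v) \<le> exp (- ln L)" unfolding v_def by (simp add: mult.assoc)
            then show ?thesis using L by (simp add: exp_minus inverse_eq_divide)
          qed
          ultimately have "ln (real p) * exp (- a * v) \<le> L * (1 / L)" using L by (intro mult_mono) auto
          then show ?thesis using L by simp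
        qed
        have b2: "(\<Sum>q\<in>S. real q ^ 3 * exp (-3 * v)) \<le> 1"
        proof -
          have e3: "exp (-3 * v) \<le> 1 / L ^ 12"
          proof -
            have "12 * ln L \<le> 3 * v" unfolding v_def using k lL by simp
            then have "exp (-3 * v) \<le> exp (- (real 12 * ln L))" by simp
            also have "\<dots> = 1 / exp (ln L) ^ 12" unfolding exp_minus exp_of_nat_mult by (simp add: inverse_eq_divide)
            finally show ?thesis using L by simp
          qed
          have "(\<Sum>q\<in>S. real q ^ 3 * exp (-3 * v)) \<le> (\<Sum>q\<in>S. L ^ 6 * (1 / L ^ 12))"
          proof (intro sum_mono mult_mono e3)
            fix q assume "q \<in> S"
            then have "real q ^ 3 \<le> (L\<^sup>2) ^ 3" using Sq by (intro power_mono) auto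
            then show "real q ^ 3 \<le> L ^ 6" by (simp flip: power_mult)
          qed (use L in auto)
          also have "\<dots> = real (card S) * (1 / L ^ 6)" using L by (simp add: field_simps flip: power_add)
          also have "\<dots> \<le> L * (1 / L ^ 1)"
            using cS L by (intro mult_mono divide_left_mono power_increasing) auto
          finally show ?thesis using L by simp
        qed
        have "\<bar>ln (cmod (Lfun (legendre_char p) s)) - Re (\<Sum>q\<in>S. of_real (real_of_int (recip_char q p)) * of_nat q powr (-s))\<bar>
           \<le> K1 * (1 + ln (real p) * exp (- a * v) + (\<Sum>q\<in>S. real q ^ 3 * exp (-3 * v))) + cmod (tail p)"
          using KA[rule_format, of p v W S] pp p2 v0 W1 SW unfolding t_eq by blast
        also have "\<dots> \<le> K1 * 3 + sqrt (4 * A)" using K1(1) b1 b2 by (intro add_mono mult_left_mono tl) auto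
        finally have fin: "\<bar>ln (cmod (Lfun (legendre_char p) s)) - Re (\<Sum>q\<in>S. of_real (real_of_int (recip_char q p)) * of_nat q powr (-s))\<bar> \<le> C"
          unfolding C_def by simp
        have "(\<Sum>q\<in>S. of_real (real_of_int (recip_char q p)) * of_nat q powr (-s)) = (\<Sum>q\<in>S. complex_of_real (\<epsilon> q) * of_nat q powr (-s))"
          by (intro sum.cong refl) (simp only: sg)
        then show "p \<in> prescribed s C S \<epsilon> x"
          using fin pp px prime_odd_nat[OF pp p2] unfolding prescribed_def by simp
      qed
      have "card G - card (insert 2 S) \<le> card (G - insert 2 S)" by (rule diff_card_le_card_Diff) (use finS in simp)
      also have "\<dots> \<le> card (prescribed s C S \<epsilon> x)" by (rule card_mono[OF finite_prescribed sub])
      finally have "card G \<le> card (prescribed s C S \<epsilon> x) + card (insert 2 S)" by linarith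
      also have "card (insert 2 S) \<le> card S + 1" using finS by (simp add: card_insert_if)
      finally have "card G \<le> card (prescribed s C S \<epsilon> x) + (card S + 1)" by simp
      then have "real (card G) \<le> real (card (prescribed s C S \<epsilon> x)) + (real (card S) + 1)"
        by (metis of_nat_1 of_nat_add of_nat_le_iff)
      moreover have "exp (L / 2) = sqrt x"
      proof -
        have "exp (L / 2) = x powr (1/2)" unfolding L_def using elim(5) by (simp add: powr_def)
        then show ?thesis using elim(5) by (simp add: powr_half_sqrt)
      qed
      ultimately show "sqrt x \<le> real (card (prescribed s C S \<epsilon> x))" using cardG cS by linarith
    qed
  qed
  then show ?thesis by blast
qed

subsection \<open>Extreme values\<close>

lemma card_block:
  assumes "GRH" "B > 0"
  shows "\<forall>\<^sub>F \<mu> in at_top. real (card (block B \<mu>)) * (\<mu> - B) \<le> exp \<mu>"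
proof -
  have "(1 - exp (- 1 * B)) / (1::real) < 1" by simp
  from order_tendstoD(2)[OF block_sum_real[OF assms, of 1] this]
  have "\<forall>\<^sub>F \<mu> in at_top. (\<Sum>p\<in>block B \<mu>. ln (real p) * real p powr (1 - 1)) / exp (1 * \<mu>) < 1" by simp
  then show ?thesis
  proof eventually_elim
    case (elim \<mu>)
    have "real (card (block B \<mu>)) * (\<mu> - B) = (\<Sum>p\<in>block B \<mu>. \<mu> - B)" by simp
    also have "\<dots> \<le> (\<Sum>p\<in>block B \<mu>. ln (real p) * real p powr (1 - 1))"
      by (intro sum_mono) (auto simp: block_def prime_gt_0_nat)
    also have "\<dots> \<le> exp \<mu>" using elim by (simp add: divide_less_eq)
    finally show ?case .
  qed
qed

text \<open>The constant \<open>beta_fun\<close> without its power of 2 log 2, in terms of \<alpha>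
  = 1 - Re s.\<close>

definition shape :: "real \<Rightarrow> real \<Rightarrow> real" where
  "shape \<alpha> t = (if t = 0 then 1 / \<alpha> else t\<^sup>2 / (\<alpha> * (\<alpha>\<^sup>2 + 4 * t\<^sup>2)))"

text \<open>With r = |\<alpha> + 2it| one has t^2 = (r - \<alpha>)(r + \<alpha>)/4; replacing r +
  \<alpha> by 2r gives the right side, which is what the cosine sum naturally produces.\<close>

lemma shape_le:
  assumes "\<alpha> > 0" "t \<noteq> 0"
  shows "shape \<alpha> t \<le> (1 / \<alpha> - 1 / cmod (Complex \<alpha> (2 * t))) / 2"
proof -
  define r where "r = cmod (Complex \<alpha> (2 * t))"
  have r2: "r\<^sup>2 = \<alpha>\<^sup>2 + 4 * t\<^sup>2" unfolding r_def cmod_power2 by (simp add: power2_eq_square)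
  have ra: "r \<ge> \<alpha>" unfolding r_def using abs_Re_le_cmod[of "Complex \<alpha> (2 * t)"] assms by simp
  have r0: "r > 0" using ra assms by linarith
  have t2: "t\<^sup>2 = (r - \<alpha>) * (r + \<alpha>) / 4" using r2 by (simp add: power2_eq_square algebra_simps)
  have "shape \<alpha> t = t\<^sup>2 / (\<alpha> * r\<^sup>2)" unfolding shape_def r2 using assms by simp
  also have "\<dots> = (r - \<alpha>) * (r + \<alpha>) / 4 / (\<alpha> * r\<^sup>2)" by (simp only: t2)
  also have "\<dots> = (r - \<alpha>) * (r + \<alpha>) / (4 * (\<alpha> * r\<^sup>2))" by simp
  also have "(r - \<alpha>) * (r + \<alpha>) / (4 * (\<alpha> * r\<^sup>2)) \<le> (r - \<alpha>) * (2 * r) / (4 * (\<alpha> * r\<^sup>2))"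
    using ra assms by (intro divide_right_mono mult_left_mono) auto
  also have "\<dots> = (1 / \<alpha> - 1 / r) / 2" using r0 assms by (simp add: field_simps power2_eq_square)
  finally show ?thesis unfolding r_def .
qed

text \<open>For t nonzero, 2 cos^2 = 1 + cos of the double angle splits the sum into block sums with
  exponents \<alpha> and \<alpha> + 2it, whose limits are near 1/\<alpha> and at most about
  1/|\<alpha> + 2it| in modulus. \<open>B\<close> is taken so large that e^(-\<alpha>B) is below the
  permitted loss.\<close>

lemma block_cos_sum_lower:
  assumes "GRH" "0 < \<alpha>" "\<alpha> < 1" "d > 0"
  shows "\<exists>B>0. \<forall>\<^sub>F \<mu> in at_top. (\<Sum>p\<in>block B \<mu>. real p powr (\<alpha> - 1) * \<bar>cos (t * ln (real p))\<bar>) \<ge> (shape \<alpha> t - d) * exp (\<alpha> * \<mu>) / \<mu>"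
proof -
  have "((\<lambda>B. exp (- \<alpha> * B) * (2 / \<alpha>)) \<longlongrightarrow> 0) at_top" using assms by real_asymp
  then have "\<forall>\<^sub>F B in at_top. exp (- \<alpha> * B) * (2 / \<alpha>) < d / 2" by (rule order_tendstoD) (use assms in simp)
  then have "\<forall>\<^sub>F B in at_top. exp (- \<alpha> * B) * (2 / \<alpha>) < d / 2 \<and> B > 0" using eventually_gt_at_top[of 0] by eventually_elim simp
  then obtain B where B: "exp (- \<alpha> * B) * (2 / \<alpha>) < d / 2" "B > 0" by (auto simp: eventually_at_top_linorder)
  define e where "e = exp (- \<alpha> * B)"
  have e0: "e > 0" by (simp add: e_def)
  have e\<alpha>: "e / \<alpha> < d / 4" using B(1) by (simp add: e_def mult.commute)
  let ?P = "\<lambda>\<mu>. \<Sum>p\<in>block B \<mu>. ln (real p) * real p powr (\<alpha> - 1)"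
  have "(1 - e) / \<alpha> - d / 4 < (1 - exp (- \<alpha> * B)) / \<alpha>" using assms by (simp add: e_def)
  from order_tendstoD(1)[OF block_sum_real[OF assms(1) B(2) assms(2)] this]
  have p1: "\<forall>\<^sub>F \<mu> in at_top. (1 - e) / \<alpha> - d / 4 < ?P \<mu> / exp (\<alpha> * \<mu>)" .
  have bl: "p \<in> block B \<mu> \<Longrightarrow> 0 \<le> ln (real p) \<and> ln (real p) \<le> \<mu> \<and> real p > 0" for p \<mu>
    unfolding block_def using prime_ge_1_nat[of p] by auto
  have "\<forall>\<^sub>F \<mu> in at_top. (\<Sum>p\<in>block B \<mu>. real p powr (\<alpha> - 1) * \<bar>cos (t * ln (real p))\<bar>) \<ge> (shape \<alpha> t - d) * exp (\<alpha> * \<mu>) / \<mu>"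
  proof (cases "t = 0")
    case True
    from p1 eventually_gt_at_top[of 0] show ?thesis
    proof eventually_elim
      case (elim \<mu>)
      have "(shape \<alpha> t - d) \<le> (1 - e) / \<alpha> - d / 4" using True e\<alpha> assms by (simp add: shape_def diff_divide_distrib)
      then have "shape \<alpha> t - d \<le> ?P \<mu> / exp (\<alpha> * \<mu>)" using elim by linarith
      then have "(shape \<alpha> t - d) * exp (\<alpha> * \<mu>) \<le> ?P \<mu>" by (simp add: pos_le_divide_eq)
      also have "\<dots> \<le> (\<Sum>p\<in>block B \<mu>. \<mu> * (real p powr (\<alpha> - 1) * \<bar>cos (t * ln (real p))\<bar>))"
        using bl True by (intro sum_mono) (simp add: mult_right_mono)
      also have "\<dots> = (\<Sum>p\<in>block B \<mu>. real p powr (\<alpha> - 1) * \<bar>cos (t * ln (real p))\<bar>) * \<mu>"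
        unfolding sum_distrib_left[symmetric] by (rule mult.commute)
      finally show ?case using elim by (simp add: pos_divide_le_eq)
    qed
  next
    case False
    define z where "z = Complex \<alpha> (2 * t)"
    define r where "r = cmod z"
    have z0: "z \<noteq> 0" using assms by (simp add: z_def complex_eq_iff)
    have ra: "r \<ge> \<alpha>" unfolding r_def z_def using abs_Re_le_cmod[of "Complex \<alpha> (2 * t)"] assms by simp
    have r0: "r > 0" using ra assms by linarith
    let ?Q = "\<lambda>\<mu>. \<Sum>p\<in>block B \<mu>. of_real (ln (real p)) * of_nat p powr (z - 1)"
    have "cmod ((1 - exp (- z * of_real B)) / z) \<le> (1 + e) / r"
    proof -
      have "cmod (1 - exp (- z * of_real B)) \<le> 1 + e"
        using norm_triangle_ineq4[of 1 "exp (- z * of_real B)"] by (simp add: e_def z_def)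
      then show ?thesis unfolding norm_divide r_def by (intro divide_right_mono) auto
    qed
    then have "cmod ((1 - exp (- z * of_real B)) / z) < (1 + e) / r + d / 4" using assms by linarith
    from order_tendstoD(2)[OF tendsto_norm[OF prime_block_sum[OF assms(1) B(2) z0]] this]
    have p2: "\<forall>\<^sub>F \<mu> in at_top. cmod (?Q \<mu> / exp (z * of_real \<mu>)) < (1 + e) / r + d / 4" .
    from p1 p2 eventually_gt_at_top[of 0] show ?thesis
    proof eventually_elim
      case (elim \<mu>)
      have P: "((1 - e) / \<alpha> - d / 4) * exp (\<alpha> * \<mu>) \<le> ?P \<mu>" using elim(1) by (simp add: pos_less_divide_eq less_imp_le)
      have "cmod (?Q \<mu>) / exp (\<alpha> * \<mu>) < (1 + e) / r + d / 4" using elim(2) by (simp add: norm_divide z_def)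
      then have "cmod (?Q \<mu>) \<le> ((1 + e) / r + d / 4) * exp (\<alpha> * \<mu>)" by (simp add: pos_divide_less_eq less_imp_le)
      then have Q: "Re (?Q \<mu>) \<ge> - (((1 + e) / r + d / 4) * exp (\<alpha> * \<mu>))" using abs_Re_le_cmod[of "?Q \<mu>"] by linarith
      have er: "e / r \<le> e / \<alpha>" using ra assms e0 by (intro divide_left_mono) auto
      have "(shape \<alpha> t - d) \<le> (((1 - e) / \<alpha> - d / 4) - ((1 + e) / r + d / 4)) / 2"
      proof -
        have "shape \<alpha> t \<le> (1 / \<alpha> - 1 / r) / 2" unfolding r_def z_def by (rule shape_le[OF assms(2) False])
        moreover have "(1 - e) / \<alpha> = 1 / \<alpha> - e / \<alpha>" "(1 + e) / r = 1 / r + e / r" by (simp_all add: diff_divide_distrib add_divide_distrib)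
        moreover have "h - d \<le> ((f1 - d / 4) - (f2 + d / 4)) / 2"
          if "h \<le> (u - w) / 2" "f1 = u - eu" "f2 = w + ew" "ew \<le> eu" "eu < d / 4" for h u w f1 f2 eu ew :: real
          using that assms(4) by simp
        ultimately show ?thesis using er e\<alpha> by blast
      qed
      then have "(shape \<alpha> t - d) * exp (\<alpha> * \<mu>) \<le> (((1 - e) / \<alpha> - d / 4) - ((1 + e) / r + d / 4)) / 2 * exp (\<alpha> * \<mu>)"
        by (intro mult_right_mono) auto
      also have "\<dots> = ((((1 - e) / \<alpha> - d / 4) * exp (\<alpha> * \<mu>)) - (((1 + e) / r + d / 4) * exp (\<alpha> * \<mu>))) / 2"
        by (simp only: left_diff_distrib times_divide_eq_left)
      also have "\<dots> \<le> (?P \<mu> + Re (?Q \<mu>)) / 2"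
        using add_mono[OF P Q] by (intro divide_right_mono) (simp_all only: add_uminus_conv_diff zero_le_numeral)
      also have "\<dots> = (\<Sum>p\<in>block B \<mu>. ln (real p) * (real p powr (\<alpha> - 1) * (cos (t * ln (real p)))\<^sup>2))"
      proof -
        have "Re (of_real (ln (real p)) * of_nat p powr (z - 1)) = ln (real p) * (real p powr (\<alpha> - 1) * (2 * (cos (t * ln (real p)))\<^sup>2 - 1))"
          if "p \<in> block B \<mu>" for p
        proof -
          have "- Complex (1 - \<alpha>) (- 2 * t) = z - 1" by (simp add: z_def complex_eq_iff)
          then have "Re (of_nat p powr (z - 1)) = real p powr (\<alpha> - 1) * cos (2 * (t * ln (real p)))"
            using dterm_one_Re[of p "1 - \<alpha>" "- 2 * t"] bl[OF that] by (simp add: dterm_def mult.assoc)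
          then show ?thesis by (simp add: cos_double_cos)
        qed
        then have "Re (?Q \<mu>) = (\<Sum>p\<in>block B \<mu>. ln (real p) * (real p powr (\<alpha> - 1) * (2 * (cos (t * ln (real p)))\<^sup>2 - 1)))"
          unfolding Re_sum by (intro sum.cong) auto
        then have "?P \<mu> + Re (?Q \<mu>) = (\<Sum>p\<in>block B \<mu>. 2 * (ln (real p) * (real p powr (\<alpha> - 1) * (cos (t * ln (real p)))\<^sup>2)))"
          unfolding sum.distrib[symmetric] by (simp add: sum.distrib[symmetric] algebra_simps)
        then show ?thesis by (simp add: sum_distrib_left[symmetric])
      qed
      also have "\<dots> \<le> (\<Sum>p\<in>block B \<mu>. \<mu> * (real p powr (\<alpha> - 1) * \<bar>cos (t * ln (real p))\<bar>))"
      proof (intro sum_mono mult_mono mult_left_mono)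
        fix p
        have "\<bar>cos (t * ln (real p))\<bar> * \<bar>cos (t * ln (real p))\<bar> \<le> \<bar>cos (t * ln (real p))\<bar> * 1"
          by (intro mult_left_mono) auto
        then show "(cos (t * ln (real p)))\<^sup>2 \<le> \<bar>cos (t * ln (real p))\<bar>" by (simp add: power2_eq_square)
      qed (use bl elim in auto)
      also have "\<dots> = (\<Sum>p\<in>block B \<mu>. real p powr (\<alpha> - 1) * \<bar>cos (t * ln (real p))\<bar>) * \<mu>"
        unfolding sum_distrib_left[symmetric] by (rule mult.commute)
      finally show ?case using elim by (simp add: pos_divide_le_eq)
    qed
  qed
  then show ?thesis using B(2) by blast
qed

lemma beta_fun_shape: "beta_fun s = (2 * ln 2) powr (Re s - 1) * shape (1 - Re s) (Im s)"
  unfolding beta_fun_def shape_def Let_def by simp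

section \<open>Choice of parameters and passage to o(1)\<close>

lemma infimum_diagonal:
  fixes R :: "real \<Rightarrow> real \<Rightarrow> bool"
  assumes ev: "\<And>d. d > 0 \<Longrightarrow> \<forall>\<^sub>F x in at_top. R x d"
    and mono: "\<And>x d d'. d \<le> d' \<Longrightarrow> R x d \<Longrightarrow> R x d'"
  shows "\<exists>e. (e \<longlongrightarrow> 0) at_top \<and> (\<forall>\<^sub>F x in at_top. R x (e x))"
proof -
  define D where "D x = {d. d > 0 \<and> R x d}" for x
  \<comment> \<open>The summand 1/x lifts \<open>e x\<close> strictly above the infimum, so an
    admissible d lies below it and monotonicity applies.\<close>
  define e where "e x = Inf (D x) + 1 / x" for x
  have bdd: "bdd_below (D x)" for x unfolding D_def by (intro bdd_belowI[of _ 0]) auto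
  have "(e \<longlongrightarrow> 0) at_top"
  proof (rule tendstoI)
    fix d :: real assume d: "d > 0"
    then have "d / 2 > 0" by simp
    from ev[OF this] eventually_gt_at_top[of "2 / d"] show "\<forall>\<^sub>F x in at_top. dist (e x) 0 < d"
    proof eventually_elim
      case (elim x)
      have x: "x > 0" using elim(2) d by (meson divide_pos_pos less_trans zero_less_numeral)
      have "d / 2 \<in> D x" using elim(1) d by (simp add: D_def)
      then have "Inf (D x) \<le> d / 2" by (rule cInf_lower[OF _ bdd])
      moreover have "Inf (D x) \<ge> 0"
      proof (rule cInf_greatest)
        show "D x \<noteq> {}" using \<open>d / 2 \<in> D x\<close> by blast
      qed (auto simp: D_def)
      moreover have "1 / x < d / 2" "1 / x > 0" using elim(2) x d by (simp_all add: field_simps)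
      ultimately show ?case by (simp add: e_def)
    qed
  qed
  moreover have "\<forall>\<^sub>F x in at_top. R x (e x)"
    using ev[OF zero_less_one] eventually_gt_at_top[of 0]
  proof eventually_elim
    case (elim x)
    have "1 \<in> D x" using elim by (simp add: D_def)
    then have ne: "D x \<noteq> {}" by blast
    have "Inf (D x) < e x" using elim by (simp add: e_def)
    then obtain d where "d \<in> D x" "d < e x" using cInf_lessD[OF ne] by blast
    then show ?case using mono[of d "e x"] by (auto simp: D_def)
  qed
  ultimately show ?thesis by blast
qed

text \<open>The block has at most y / (ln y - B) primes, about \<theta> log x of them, and \<theta>
  log 2 = 1/2 - 5d; the gap to 1/2 - 4d absorbs the ratio log log x / (ln y - B), which tends to
  1.\<close>

lemma block_admissible:
  assumes "GRH" "B > 0" "0 < d" "d < 1/20"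
  shows "\<forall>\<^sub>F x in at_top.
    let \<mu> = ln ((1 - 10 * d) / (2 * ln 2) * ln x * ln (ln x)) in
    (\<forall>q\<in>block B \<mu>. prime q \<and> q > 2 \<and> real q \<le> (ln x)\<^sup>2) \<and> real (card (block B \<mu>)) * ln 2 \<le> (1/2 - 4 * d) * ln x"
proof -
  define \<theta> where "\<theta> = (1 - 10 * d) / (2 * ln 2)"
  have \<theta>: "0 < \<theta>" "\<theta> \<le> 1"
  proof -
    have "2 * ln 2 \<ge> (1::real)" using ln2_ge_two_thirds by simp
    then show "\<theta> \<le> 1" unfolding \<theta>_def using assms by (simp add: divide_le_eq_1)
  qed (use assms in \<open>simp add: \<theta>_def\<close>)
  have mt: "filterlim (\<lambda>L::real. ln (\<theta> * L * ln L)) at_top at_top" using \<theta> by real_asymp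
  have ev1: "\<forall>\<^sub>F L in at_top. real (card (block B (ln (\<theta> * L * ln L)))) * (ln (\<theta> * L * ln L) - B) \<le> exp (ln (\<theta> * L * ln L))"
    using filterlim_iff[THEN iffD1, OF mt, rule_format, OF card_block[OF assms(1,2)]] .
  have ev2: "\<forall>\<^sub>F L in at_top. ln (\<theta> * L * ln L) > B + ln 2"
    using filterlim_iff[THEN iffD1, OF mt, rule_format, OF eventually_gt_at_top[of "B + ln 2"]] .
  have "((\<lambda>L::real. ln L / (ln (\<theta> * L * ln L) - B)) \<longlongrightarrow> 1) at_top" using \<theta> by real_asymp
  moreover have "1 < (1/2 - 4 * d) / (1/2 - 5 * d)" using assms by (simp add: less_divide_eq)
  ultimately have ev3: "\<forall>\<^sub>F L in at_top. ln L / (ln (\<theta> * L * ln L) - B) < (1/2 - 4 * d) / (1/2 - 5 * d)" by (rule order_tendstoD)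
  have "\<forall>\<^sub>F L in at_top. (\<forall>q\<in>block B (ln (\<theta> * L * ln L)). prime q \<and> q > 2 \<and> real q \<le> L\<^sup>2) \<and>
     real (card (block B (ln (\<theta> * L * ln L)))) * ln 2 \<le> (1/2 - 4 * d) * L"
    using ev1 ev2 ev3 eventually_gt_at_top[of 3]
  proof eventually_elim
    case (elim L)
    define y where "y = \<theta> * L * ln L"
    have lL: "ln L > 0" using elim by simp
    have y: "y > 0" unfolding y_def using \<theta> lL elim by simp
    have m: "ln y - B > ln 2" "ln y - B > 0" using elim(2) ln_gt_zero[of 2] unfolding y_def by linarith+
    have "prime q \<and> q > 2 \<and> real q \<le> L\<^sup>2" if q: "q \<in> block B (ln y)" for q
    proof -
      have pq: "prime q" "ln y - B \<le> ln (real q)" "ln (real q) \<le> ln y" "q > 0"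
        using q by (auto simp: block_def prime_gt_0_nat)
      have "ln 2 < ln (real q)" using m pq by linarith
      then have "real q > 2" using pq by simp
      moreover have "real q \<le> y" using pq y by simp
      moreover have "y \<le> L\<^sup>2"
      proof -
        have "ln L \<le> L" using elim ln_bound[of L] by simp
        then have "\<theta> * L * ln L \<le> 1 * L * L" using \<theta> lL elim by (intro mult_mono) auto
        then show ?thesis by (simp add: y_def power2_eq_square)
      qed
      ultimately show ?thesis using pq by auto
    qed
    moreover have "real (card (block B (ln y))) * ln 2 \<le> (1/2 - 4 * d) * L"
    proof -
      have "real (card (block B (ln y))) * (ln y - B) \<le> y" using elim(1) y unfolding y_def[symmetric] by simp
      then have "real (card (block B (ln y))) \<le> y / (ln y - B)" using m by (simp add: pos_le_divide_eq)
      then have "real (card (block B (ln y))) * ln 2 \<le> y / (ln y - B) * ln 2" by (intro mult_right_mono) auto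
      also have "\<dots> = (\<theta> * ln 2) * L * (ln L / (ln y - B))" by (simp add: y_def)
      also have "\<theta> * ln 2 = 1/2 - 5 * d" unfolding \<theta>_def by simp
      also have "(1/2 - 5 * d) * L * (ln L / (ln y - B)) \<le> (1/2 - 5 * d) * L * ((1/2 - 4 * d) / (1/2 - 5 * d))"
        using elim(3,4) assms unfolding y_def by (intro mult_left_mono) auto
      also have "\<dots> = (1/2 - 4 * d) * L" using assms by simp
      finally show ?thesis .
    qed
    ultimately show ?case unfolding y_def by blast
  qed
  from filterlim_iff[THEN iffD1, OF ln_at_top, rule_format, OF this]
  show ?thesis unfolding Let_def \<theta>_def .
qed

definition main_term :: "complex \<Rightarrow> real \<Rightarrow> real" where
  "main_term s x = ln x powr (1 - Re s) * ln (ln x) powr (- Re s)"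

lemma main_term_nonneg: "main_term s x \<ge> 0"
  unfolding main_term_def by simp

text \<open>With e^\<mu> = \<theta> L log L and L = log x, the quotient e^(\<alpha>\<mu>) / \<mu> is
  asymptotically \<theta>^\<alpha> L^\<alpha> (log L)^(\<alpha>-1); as d tends to 0, \<theta> tends
  to 1/(2 log 2) and the constant to \<open>beta_fun s\<close>.\<close>

lemma block_value:
  assumes "GRH" "1/2 < Re s" "Re s < 1" "e > 0"
  shows "\<exists>B>0. \<exists>d>0. d < 1/20 \<and> (\<forall>\<^sub>F x in at_top.
    (beta_fun s - e) * main_term s x \<le> (\<Sum>p\<in>block B (ln ((1 - 10 * d) / (2 * ln 2) * ln x * ln (ln x))). real p powr (- Re s) * \<bar>cos (Im s * ln (real p))\<bar>))"
proof -
  define \<alpha> where "\<alpha> = 1 - Re s"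
  define b where "b = (2 * ln 2) powr (- \<alpha>) * shape \<alpha> (Im s)"
  have \<alpha>: "0 < \<alpha>" "\<alpha> < 1" using assms by (auto simp: \<alpha>_def)
  have beta: "beta_fun s = b" unfolding beta_fun_shape b_def \<alpha>_def by simp
  have "((\<lambda>d. (shape \<alpha> (Im s) - d) * ((1 - 10 * d) / (2 * ln 2)) powr \<alpha>) \<longlongrightarrow> (shape \<alpha> (Im s) - 0) * ((1 - 10 * 0) / (2 * ln 2)) powr \<alpha>) (at_right 0)"
    by (intro tendsto_intros) auto
  moreover have "(shape \<alpha> (Im s) - 0) * ((1 - 10 * 0) / (2 * ln 2)) powr \<alpha> = b"
    unfolding b_def by (simp add: powr_divide powr_minus field_simps)
  ultimately have "((\<lambda>d. (shape \<alpha> (Im s) - d) * ((1 - 10 * d) / (2 * ln 2)) powr \<alpha>) \<longlongrightarrow> b) (at_right 0)" by simp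
  moreover have "b - e < b" using assms by simp
  ultimately have "\<forall>\<^sub>F d in at_right 0. b - e < (shape \<alpha> (Im s) - d) * ((1 - 10 * d) / (2 * ln 2)) powr \<alpha>"
    by (rule order_tendstoD)
  moreover have "\<forall>\<^sub>F d in at_right 0. d > (0::real) \<and> d < 1/20"
    by (intro eventually_conj eventually_at_right_less) (rule eventually_at_right[THEN iffD2, OF zero_less_one], rule exI[of _ "1/20"], simp)
  ultimately have "\<forall>\<^sub>F d in at_right 0. b - e < (shape \<alpha> (Im s) - d) * ((1 - 10 * d) / (2 * ln 2)) powr \<alpha> \<and> d > 0 \<and> d < 1/20"
    by eventually_elim simp
  then obtain d where d: "b - e < (shape \<alpha> (Im s) - d) * ((1 - 10 * d) / (2 * ln 2)) powr \<alpha>" "d > 0" "d < 1/20"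
    using eventually_happens'[OF trivial_limit_at_right_real] by blast
  define \<theta> where "\<theta> = (1 - 10 * d) / (2 * ln 2)"
  have \<theta>: "\<theta> > 0" unfolding \<theta>_def using d by simp
  obtain B where B: "B > 0" and Bv: "\<forall>\<^sub>F \<mu> in at_top. (\<Sum>p\<in>block B \<mu>. real p powr (\<alpha> - 1) * \<bar>cos (Im s * ln (real p))\<bar>) \<ge> (shape \<alpha> (Im s) - d) * exp (\<alpha> * \<mu>) / \<mu>"
    using block_cos_sum_lower[OF assms(1) \<alpha> d(2), of "Im s"] by blast
  have mt: "filterlim (\<lambda>L::real. ln (\<theta> * L * ln L)) at_top at_top" using \<theta> by real_asymp
  have ev1: "\<forall>\<^sub>F L in at_top. (\<Sum>p\<in>block B (ln (\<theta> * L * ln L)). real p powr (\<alpha> - 1) * \<bar>cos (Im s * ln (real p))\<bar>) \<ge> (shape \<alpha> (Im s) - d) * exp (\<alpha> * ln (\<theta> * L * ln L)) / ln (\<theta> * L * ln L)"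
    using filterlim_iff[THEN iffD1, OF mt, rule_format, OF Bv] .
  have "((\<lambda>L::real. ln L / ln (\<theta> * L * ln L)) \<longlongrightarrow> 1) at_top" using \<theta> by real_asymp
  from tendsto_mult[OF tendsto_const this, of "(shape \<alpha> (Im s) - d) * \<theta> powr \<alpha>"]
  have "((\<lambda>L::real. (shape \<alpha> (Im s) - d) * \<theta> powr \<alpha> * (ln L / ln (\<theta> * L * ln L))) \<longlongrightarrow> (shape \<alpha> (Im s) - d) * \<theta> powr \<alpha>) at_top" by simp
  from order_tendstoD(1)[OF this d(1)[folded \<theta>_def]]
  have ev2: "\<forall>\<^sub>F L in at_top. b - e < (shape \<alpha> (Im s) - d) * \<theta> powr \<alpha> * (ln L / ln (\<theta> * L * ln L))" .
  have "\<forall>\<^sub>F L in at_top. (b - e) * (L powr \<alpha> * ln L powr (\<alpha> - 1)) \<le> (\<Sum>p\<in>block B (ln (\<theta> * L * ln L)). real p powr (\<alpha> - 1) * \<bar>cos (Im s * ln (real p))\<bar>)"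
    using ev1 ev2 eventually_gt_at_top[of 1]
  proof eventually_elim
    case (elim L)
    define y where "y = \<theta> * L * ln L"
    have lL: "ln L > 0" using elim by simp
    have y: "y > 0" unfolding y_def using \<theta> lL elim by simp
    have ey: "exp (\<alpha> * ln y) = \<theta> powr \<alpha> * (L powr \<alpha> * ln L powr \<alpha>)"
    proof -
      have "exp (\<alpha> * ln y) = y powr \<alpha>" using y by (simp add: powr_def)
      then show ?thesis unfolding y_def using \<theta> lL elim by (simp add: powr_mult)
    qed
    have "(b - e) * (L powr \<alpha> * ln L powr (\<alpha> - 1)) \<le> (shape \<alpha> (Im s) - d) * \<theta> powr \<alpha> * (ln L / ln y) * (L powr \<alpha> * ln L powr (\<alpha> - 1))"
      using elim(2) unfolding y_def by (intro mult_right_mono) auto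
    also have "\<dots> = (shape \<alpha> (Im s) - d) * (\<theta> powr \<alpha> * (L powr \<alpha> * (ln L powr 1 * ln L powr (\<alpha> - 1)))) / ln y"
      using lL by simp
    also have "ln L powr 1 * ln L powr (\<alpha> - 1) = ln L powr \<alpha>" by (simp only: powr_add[symmetric]) simp
    finally show ?case using elim(1) unfolding y_def[symmetric] ey by linarith
  qed
  from filterlim_iff[THEN iffD1, OF ln_at_top, rule_format, OF this]
  have "\<forall>\<^sub>F x in at_top. (b - e) * main_term s x \<le> (\<Sum>p\<in>block B (ln (\<theta> * ln x * ln (ln x))). real p powr (- Re s) * \<bar>cos (Im s * ln (real p))\<bar>)"
    unfolding main_term_def \<alpha>_def by simp
  then show ?thesis unfolding beta \<theta>_def using B d by blast
qed

text \<open>Half of the loss e covers the block sum, the other half the bounded error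
  \<open>C\<close>, since the main term tends to infinity.\<close>

lemma extreme_counts:
  assumes "GRH" "1/2 < Re s" "Re s < 1" "e > 0"
  shows "\<forall>\<^sub>F x in at_top.
    sqrt x \<le> real (card {p. prime p \<and> odd p \<and> real p \<le> x \<and> (beta_fun s - e) * main_term s x \<le> ln (cmod (Lfun (legendre_char p) s))}) \<and>
    sqrt x \<le> real (card {p. prime p \<and> odd p \<and> real p \<le> x \<and> ln (cmod (Lfun (legendre_char p) s)) \<le> - ((beta_fun s - e) * main_term s x)})"
proof -
  have "e / 2 > 0" using assms by simp
  from block_value[OF assms(1-3) this] obtain B d where B: "B > 0" and d: "d > 0" "d < 1/20"
    and val: "\<forall>\<^sub>F x in at_top. (beta_fun s - e / 2) * main_term s x \<le> (\<Sum>p\<in>block B (ln ((1 - 10 * d) / (2 * ln 2) * ln x * ln (ln x))). real p powr (- Re s) * \<bar>cos (Im s * ln (real p))\<bar>)"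
    by blast
  have "d < 1/2" using d by simp
  from many_prescribed[OF assms(1-3) d(1) this] obtain C where C: "\<forall>\<^sub>F x in at_top. \<forall>S \<epsilon>. finite S \<and> (\<forall>q\<in>S. prime q \<and> q > 2 \<and> real q \<le> (ln x)\<^sup>2) \<and>
      real (card S) * ln 2 \<le> (1/2 - 4 * d) * ln x \<and> (\<forall>q\<in>S. \<bar>\<epsilon> q\<bar> = 1) \<longrightarrow>
      sqrt x \<le> real (card (prescribed s C S \<epsilon> x))" by blast
  have "filterlim (\<lambda>x. main_term s x) at_top at_top" unfolding main_term_def using assms by real_asymp
  then have big: "\<forall>\<^sub>F x in at_top. main_term s x \<ge> C / (e / 2)" by (simp only: filterlim_at_top)
  from val C block_admissible[OF assms(1) B d] big show ?thesis
  proof eventually_elim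
    case (elim x)
    define \<mu> where "\<mu> = ln ((1 - 10 * d) / (2 * ln 2) * ln x * ln (ln x))"
    define S where "S = block B \<mu>"
    define V where "V = (\<Sum>p\<in>S. real p powr (- Re s) * \<bar>cos (Im s * ln (real p))\<bar>)"
    \<comment> \<open>The sign turns each term into an absolute value; at a zero of the cosine it is
      set to 1 only to keep modulus one.\<close>
    define \<epsilon> :: "nat \<Rightarrow> real" where "\<epsilon> p = (if cos (Im s * ln (real p)) \<ge> 0 then 1 else -1)" for p
    have adm: "(\<forall>q\<in>S. prime q \<and> q > 2 \<and> real q \<le> (ln x)\<^sup>2) \<and> real (card S) * ln 2 \<le> (1/2 - 4 * d) * ln x"
      using elim(3) unfolding S_def \<mu>_def Let_def .
    \<comment> \<open>u = 1 will give the large values and u = -1 the small ones.\<close>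
    have cnt: "sqrt x \<le> real (card (prescribed s C S (\<lambda>p. u * \<epsilon> p) x))" if "\<bar>u\<bar> = 1" for u
      using elim(2)[rule_format, of S "\<lambda>p. u * \<epsilon> p"] adm that finite_block[of B \<mu>] by (simp add: S_def \<epsilon>_def abs_mult)
    have sumV: "Re (\<Sum>q\<in>S. of_real (u * \<epsilon> q) * of_nat q powr (-s)) = u * V" for u
    proof -
      have "Re (of_real (u * \<epsilon> q) * of_nat q powr (-s)) = u * (real q powr (- Re s) * \<bar>cos (Im s * ln (real q))\<bar>)" if "q \<in> S" for q
      proof -
        have "q > 0" using that by (simp add: S_def block_def prime_gt_0_nat)
        then have "Re (of_nat q powr (-s)) = real q powr (- Re s) * cos (Im s * ln (real q))"
          using dterm_one_Re[of q "Re s" "Im s"] by (simp add: dterm_def)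
        then show ?thesis by (simp add: \<epsilon>_def)
      qed
      then show ?thesis unfolding Re_sum V_def sum_distrib_left by (intro sum.cong) auto
    qed
    have "(beta_fun s - e / 2) * main_term s x \<le> V" using elim(1) unfolding V_def S_def \<mu>_def .
    moreover have "C \<le> e / 2 * main_term s x" using elim(4) assms(4) by (simp add: field_simps)
    ultimately have VC: "(beta_fun s - e) * main_term s x \<le> V - C" by (simp add: algebra_simps)
    have fin: "finite {p. prime p \<and> odd p \<and> real p \<le> x \<and> Q p}" for Q
      by (rule finite_subset[of _ "{..nat \<lfloor>x\<rfloor>}"]) (auto simp: le_nat_floor)
    have "prescribed s C S (\<lambda>p. 1 * \<epsilon> p) x \<subseteq> {p. prime p \<and> odd p \<and> real p \<le> x \<and> (beta_fun s - e) * main_term s x \<le> ln (cmod (Lfun (legendre_char p) s))}"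
      unfolding prescribed_def sumV using VC by auto
    moreover have "prescribed s C S (\<lambda>p. (-1) * \<epsilon> p) x \<subseteq> {p. prime p \<and> odd p \<and> real p \<le> x \<and> ln (cmod (Lfun (legendre_char p) s)) \<le> - ((beta_fun s - e) * main_term s x)}"
      unfolding prescribed_def sumV using VC by auto
    ultimately show ?case
      using cnt[of 1] cnt[of "-1"] card_mono[OF fin] by (meson abs_1 abs_neg_one of_nat_le_iff order_trans)
  qed
qed

theorem theorem1p8:
  fixes s :: complex
  assumes "GRH" and "1/2 < Re s" and "Re s < 1"
  shows "\<exists>c > 0. \<exists>\<epsilon> :: real \<Rightarrow> real. (\<epsilon> \<longlongrightarrow> 0) at_top \<and>
    (\<forall>\<^sub>F x in at_top.
       real (card {p :: nat. prime p \<and> odd p \<and> real p \<le> x \<and>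
          ln (cmod (Lfun (legendre_char p) s)) \<ge>
            (beta_fun s + \<epsilon> x) * ln x powr (1 - Re s) * ln (ln x) powr (- Re s)}) \<ge> c * sqrt x
     \<and> real (card {q :: nat. prime q \<and> odd q \<and> real q \<le> x \<and>
          ln (cmod (Lfun (legendre_char q) s)) \<le>
            - (beta_fun s + \<epsilon> x) * ln x powr (1 - Re s) * ln (ln x) powr (- Re s)}) \<ge> c * sqrt x)"
proof -
  define R where "R x e \<longleftrightarrow>
    sqrt x \<le> real (card {p. prime p \<and> odd p \<and> real p \<le> x \<and> (beta_fun s - e) * main_term s x \<le> ln (cmod (Lfun (legendre_char p) s))}) \<and>
    sqrt x \<le> real (card {p. prime p \<and> odd p \<and> real p \<le> x \<and> ln (cmod (Lfun (legendre_char p) s)) \<le> - ((beta_fun s - e) * main_term s x)})" for x e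
  have "R x d'" if dd: "d \<le> d'" and R: "R x d" for x d d'
  proof -
    have fin: "finite {p. prime p \<and> odd p \<and> real p \<le> x \<and> Q p}" for Q
      by (rule finite_subset[of _ "{..nat \<lfloor>x\<rfloor>}"]) (auto simp: le_nat_floor)
    have le: "(beta_fun s - d') * main_term s x \<le> (beta_fun s - d) * main_term s x"
      using dd main_term_nonneg by (intro mult_right_mono) auto
    have "card {p. prime p \<and> odd p \<and> real p \<le> x \<and> (beta_fun s - d) * main_term s x \<le> ln (cmod (Lfun (legendre_char p) s))}
      \<le> card {p. prime p \<and> odd p \<and> real p \<le> x \<and> (beta_fun s - d') * main_term s x \<le> ln (cmod (Lfun (legendre_char p) s))}"
      by (rule card_mono[OF fin]) (use le in auto)
    moreover have "card {p. prime p \<and> odd p \<and> real p \<le> x \<and> ln (cmod (Lfun (legendre_char p) s)) \<le> - ((beta_fun s - d) * main_term s x)}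
      \<le> card {p. prime p \<and> odd p \<and> real p \<le> x \<and> ln (cmod (Lfun (legendre_char p) s)) \<le> - ((beta_fun s - d') * main_term s x)}"
      by (rule card_mono[OF fin]) (use le in auto)
    ultimately show ?thesis using R unfolding R_def by linarith
  qed
  moreover have "\<forall>\<^sub>F x in at_top. R x d" if "d > 0" for d
    unfolding R_def by (rule extreme_counts[OF assms that])
  ultimately obtain e where e: "(e \<longlongrightarrow> 0) at_top" "\<forall>\<^sub>F x in at_top. R x (e x)"
    using infimum_diagonal[of R] by blast
  show ?thesis
  \<comment> \<open>The counts reach sqrt x itself, so the implied constant is 1; the loss enters as
    a negative o(1) in both inequalities.\<close>
  proof (intro exI[of _ 1] exI[of _ "\<lambda>x. - e x"] conjI)
    show "((\<lambda>x. - e x) \<longlongrightarrow> 0) at_top" using tendsto_minus[OF e(1)] by simp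
    show "\<forall>\<^sub>F x in at_top.
       real (card {p :: nat. prime p \<and> odd p \<and> real p \<le> x \<and>
          ln (cmod (Lfun (legendre_char p) s)) \<ge>
            (beta_fun s + - e x) * ln x powr (1 - Re s) * ln (ln x) powr (- Re s)}) \<ge> 1 * sqrt x
     \<and> real (card {q :: nat. prime q \<and> odd q \<and> real q \<le> x \<and>
          ln (cmod (Lfun (legendre_char q) s)) \<le>
            - (beta_fun s + - e x) * ln x powr (1 - Re s) * ln (ln x) powr (- Re s)}) \<ge> 1 * sqrt x"
    proof -
      have "(beta_fun s + - e x) * ln x powr (1 - Re s) * ln (ln x) powr (- Re s) = (beta_fun s - e x) * main_term s x"
        "- (beta_fun s + - e x) * ln x powr (1 - Re s) * ln (ln x) powr (- Re s) = - ((beta_fun s - e x) * main_term s x)" for x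
        by (simp_all add: main_term_def algebra_simps)
      then show ?thesis using e(2) unfolding R_def by (simp only: mult_1)
    qed
  qed simp
qed

end
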